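(* Let $G$ be a finitely generated, infinite, nilpotent (discrete) group with Hirsch length $\ell_{\mathrm{Hir}}(G)$ and let $X$ be a compact metric space of finite covering dimension. Let $\alpha:G\curvearrowright X$ be a free action (by homeomorphisms). Then the induced C*-algebraic action $\bar\alpha:G\curvearrowright C(X)$ has finite Rokhlin dimension, and in fact $$\dim_{\mathrm{Rok}}(\bar\alpha)+1\;\le\;3^{\ell_{\mathrm{Hir}}(G)}\cdot(\dim(X)+1).$$
   Context: The induced action is $\bar\alpha_g(f)=f\circ\alpha_{g^{-1}}$. $\dim(X)$ is the covering dimension. **Rokhlin dimension (separable $A$).** Let $\alpha$ be an action of a countable group $G$ on a separable C*-algebra $A$. Let $A_\infty=\ell^\infty(\mathbb N,A)/c_0(\mathbb N,A)$ with $A\subset A_\infty$ as constant sequences, $\operatorname{Ann}(A,A_\infty)=\{x\in A_\infty: xa=ax=0\ \forall a\in A\}$ and $F_\infty(A)=(A_\infty\cap A')/\operatorname{Ann}(A,A_\infty)$ (for unital $A$ this is just $A_\infty\cap A'$), with the action $\tilde\alpha_\infty$ induced by componentwise application of $\alpha$. For a finite-index subgroup $H\le G$, $\dim_{\mathrm{Rok}}(\alpha,H)$ is the smallest $d\in\mathbb N$ (including $0$; $\infty$ if none) such that there exist equivariant completely positive contractive order zero (i.e. orthogonality preserving) maps $\varphi_l:(C(G/H),G\text{-shift})\to(F_\infty(A),\tilde\alpha_\infty)$, $l=0,\dots,d$, with $\varphi_0(1)+\dots+\varphi_d(1)=1$. Here the $G$-shift is induced by left translation on $G/H$. The full Rokhlin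 dimension is $\dim_{\mathrm{Rok}}(\alpha)=\sup\{\dim_{\mathrm{Rok}}(\alpha,H):H\le G,\ [G:H]<\infty\}$. *)

theory Defs
  imports
    "HOL-Analysis.Analysis"
    "HOL-Algebra.Group_Action"
    "HOL-Algebra.Left_Coset"
    "HOL-Algebra.Generated_Groups"
    "HOL-Algebra.Elementary_Groups"
    "HOL-Algebra.QuotRing"
    "HOL-Library.Extended_Nat"
begin

section \<open>Groups\<close>

definition finitely_generated_group :: "('g, 'm) monoid_scheme \<Rightarrow> bool" where
  "finitely_generated_group G \<longleftrightarrow>
     group G \<and> (\<exists>S. finite S \<and> S \<subseteq> carrier G \<and> generate G S = carrier G)"

fun lower_central :: "('g, 'm) monoid_scheme \<Rightarrow> nat \<Rightarrow> 'g set" where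
  "lower_central G 0 = carrier G"
| "lower_central G (Suc n) =
     generate G {x \<otimes>\<^bsub>G\<^esub> y \<otimes>\<^bsub>G\<^esub> inv\<^bsub>G\<^esub> x \<otimes>\<^bsub>G\<^esub> inv\<^bsub>G\<^esub> y | x y.
       x \<in> lower_central G n \<and> y \<in> carrier G}"

definition nilpotent_group :: "('g, 'm) monoid_scheme \<Rightarrow> bool" where
  "nilpotent_group G \<longleftrightarrow> group G \<and> (\<exists>n. lower_central G n = {\<one>\<^bsub>G\<^esub>})"

text \<open>\<open>polycyclic_series G H n\<close>: the subgroup \<open>H\<close> has a finite subnormal series from the
  trivial subgroup up to \<open>H\<close> with cyclic factors, exactly \<open>n\<close> of which are infinite.\<close>

inductive polycyclic_series :: "('g, 'm) monoid_scheme \<Rightarrow> 'g set \<Rightarrow> nat \<Rightarrow> bool"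
  for G where
  trivial: "polycyclic_series G {\<one>\<^bsub>G\<^esub>} 0"
| finite_factor:
    "\<lbrakk> polycyclic_series G K n; subgroup H G; K \<lhd> (G\<lparr>carrier := H\<rparr>);
       cyclic_group ((G\<lparr>carrier := H\<rparr>) Mod K); finite (carrier ((G\<lparr>carrier := H\<rparr>) Mod K)) \<rbrakk>
     \<Longrightarrow> polycyclic_series G H n"
| infinite_factor:
    "\<lbrakk> polycyclic_series G K n; subgroup H G; K \<lhd> (G\<lparr>carrier := H\<rparr>);
       cyclic_group ((G\<lparr>carrier := H\<rparr>) Mod K); infinite (carrier ((G\<lparr>carrier := H\<rparr>) Mod K)) \<rbrakk>
     \<Longrightarrow> polycyclic_series G H (Suc n)"

text \<open>The number of infinite factors is the same for all such series of a polycyclic group (in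
  particular of a finitely generated nilpotent group), so \<open>LEAST\<close> merely selects this number.\<close>

definition hirsch_length :: "('g, 'm) monoid_scheme \<Rightarrow> nat" where
  "hirsch_length G = (LEAST n. polycyclic_series G (carrier G) n)"


section \<open>Covering dimension\<close>

definition covering_dim_le :: "'x topology \<Rightarrow> nat \<Rightarrow> bool" where
  "covering_dim_le X n \<longleftrightarrow>
     (\<forall>\<U>. finite \<U> \<and> (\<forall>U\<in>\<U>. openin X U) \<and> \<Union>\<U> = topspace X \<longrightarrow>
       (\<exists>\<V>. finite \<V> \<and> (\<forall>V\<in>\<V>. openin X V) \<and> \<Union>\<V> = topspace X \<and>
            (\<forall>V\<in>\<V>. \<exists>U\<in>\<U>. V \<subseteq> U) \<and>
            (\<forall>x\<in>topspace X. card {V \<in> \<V>. x \<in> V} \<le> n + 1)))"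

text \<open>The infimum of the empty set is \<open>\<infinity>\<close>. The values are natural numbers or \<open>\<infinity>\<close>, so the
  empty space has dimension \<open>0\<close> here.\<close>

definition covering_dim :: "'x topology \<Rightarrow> enat" where
  "covering_dim X = Inf {enat n | n. covering_dim_le X n}"


section \<open>C*-algebras\<close>

text \<open>The operations of a C*-algebra, extending the ring operations of HOL-Algebra. The field
  \<open>one\<close> is meaningful only for unital algebras.\<close>

record 'a cstar_alg = "'a ring" +
  csmult :: "complex \<Rightarrow> 'a \<Rightarrow> 'a"
  star :: "'a \<Rightarrow> 'a"
  anorm :: "'a \<Rightarrow> real"

text \<open>The algebra \<open>C(X)\<close>, meant for compact \<open>X\<close>. Functions are normalised to \<open>undefined\<close>
  outside \<open>X\<close>; the inserted \<open>0\<close> only matters for empty \<open>X\<close>.\<close>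

definition C_alg :: "'x topology \<Rightarrow> ('x \<Rightarrow> complex) cstar_alg" where
  "C_alg X = \<lparr>
     carrier = {f \<in> extensional (topspace X). continuous_map X euclidean f},
     monoid.mult = (\<lambda>f g. \<lambda>x\<in>topspace X. f x * g x),
     one = (\<lambda>x\<in>topspace X. 1),
     zero = (\<lambda>x\<in>topspace X. 0),
     add = (\<lambda>f g. \<lambda>x\<in>topspace X. f x + g x),
     csmult = (\<lambda>c f. \<lambda>x\<in>topspace X. c * f x),
     star = (\<lambda>f. \<lambda>x\<in>topspace X. cnj (f x)),
     anorm = (\<lambda>f. Sup (insert 0 ((\<lambda>x. cmod (f x)) ` topspace X)))\<rparr>"

text \<open>The quotient of \<open>A\<close> by a closed two-sided ideal \<open>I\<close>, with the quotient norm.\<close>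

definition quotient_alg :: "'a cstar_alg \<Rightarrow> 'a set \<Rightarrow> 'a set cstar_alg" where
  "quotient_alg A I = \<lparr>
     carrier = a_rcosets\<^bsub>A\<^esub> I,
     monoid.mult = rcoset_mult A I,
     one = I +>\<^bsub>A\<^esub> \<one>\<^bsub>A\<^esub>,
     zero = I,
     add = set_add A,
     csmult = (\<lambda>c S. \<Union>s\<in>S. I +>\<^bsub>A\<^esub> csmult A c s),
     star = (\<lambda>S. \<Union>s\<in>S. I +>\<^bsub>A\<^esub> star A s),
     anorm = (\<lambda>S. Inf (anorm A ` S))\<rparr>"

definition ell_infty :: "'a cstar_alg \<Rightarrow> (nat \<Rightarrow> 'a) cstar_alg" where
  "ell_infty A = \<lparr>
     carrier = {s. (\<forall>n. s n \<in> carrier A) \<and> bdd_above (range (\<lambda>n. anorm A (s n)))},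
     monoid.mult = (\<lambda>s t n. s n \<otimes>\<^bsub>A\<^esub> t n),
     one = (\<lambda>n. \<one>\<^bsub>A\<^esub>),
     zero = (\<lambda>n. \<zero>\<^bsub>A\<^esub>),
     add = (\<lambda>s t n. s n \<oplus>\<^bsub>A\<^esub> t n),
     csmult = (\<lambda>c s n. csmult A c (s n)),
     star = (\<lambda>s n. star A (s n)),
     anorm = (\<lambda>s. SUP n. anorm A (s n))\<rparr>"

definition c_zero :: "'a cstar_alg \<Rightarrow> (nat \<Rightarrow> 'a) set" where
  "c_zero A = {s \<in> carrier (ell_infty A). (\<lambda>n. anorm A (s n)) \<longlonglongrightarrow> 0}"

definition A_infty :: "'a cstar_alg \<Rightarrow> (nat \<Rightarrow> 'a) set cstar_alg" where
  "A_infty A = quotient_alg (ell_infty A) (c_zero A)"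

definition const_embed :: "'a cstar_alg \<Rightarrow> 'a \<Rightarrow> (nat \<Rightarrow> 'a) set" where
  "const_embed A a = c_zero A +>\<^bsub>ell_infty A\<^esub> (\<lambda>n. a)"

definition rel_commutant :: "'a cstar_alg \<Rightarrow> (nat \<Rightarrow> 'a) set set" where
  "rel_commutant A = {x \<in> carrier (A_infty A).
     \<forall>a\<in>carrier A. x \<otimes>\<^bsub>A_infty A\<^esub> const_embed A a = const_embed A a \<otimes>\<^bsub>A_infty A\<^esub> x}"

definition annihilator :: "'a cstar_alg \<Rightarrow> (nat \<Rightarrow> 'a) set set" where
  "annihilator A = {x \<in> carrier (A_infty A).
     \<forall>a\<in>carrier A. x \<otimes>\<^bsub>A_infty A\<^esub> const_embed A a = \<zero>\<^bsub>A_infty A\<^esub> \<and>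
                   const_embed A a \<otimes>\<^bsub>A_infty A\<^esub> x = \<zero>\<^bsub>A_infty A\<^esub>}"

text \<open>\<open>F_infty A\<close> is unital for every separable \<open>A\<close>, also when \<open>A\<close> itself has no unit; its unit
  is therefore not taken from \<open>A\<close>.\<close>

definition F_infty :: "'a cstar_alg \<Rightarrow> (nat \<Rightarrow> 'a) set set cstar_alg" where
  "F_infty A =
     (let Q = quotient_alg ((A_infty A)\<lparr>carrier := rel_commutant A\<rparr>) (annihilator A)
      in Q\<lparr>one := (THE e. e \<in> carrier Q \<and> (\<forall>x\<in>carrier Q. e \<otimes>\<^bsub>Q\<^esub> x = x \<and> x \<otimes>\<^bsub>Q\<^esub> e = x))\<rparr>)"

text \<open>Both quotients have cosets as elements, and an automorphism of \<open>A\<close> maps cosets onto cosets;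
  hence the induced action is given by taking images twice.\<close>

definition F_infty_action ::
    "('g \<Rightarrow> 'a \<Rightarrow> 'a) \<Rightarrow> 'g \<Rightarrow> (nat \<Rightarrow> 'a) set set \<Rightarrow> (nat \<Rightarrow> 'a) set set" where
  "F_infty_action \<beta> g = image (image (\<lambda>s n. \<beta> g (s n)))"


section \<open>Completely positive contractive order zero maps\<close>

definition positive_matrix :: "'a cstar_alg \<Rightarrow> nat \<Rightarrow> (nat \<Rightarrow> nat \<Rightarrow> 'a) \<Rightarrow> bool" where
  "positive_matrix A n x \<longleftrightarrow>
     (\<exists>y. (\<forall>i<n. \<forall>j<n. y i j \<in> carrier A) \<and>
          (\<forall>i<n. \<forall>j<n. x i j = (\<Oplus>\<^bsub>A\<^esub>k\<in>{..<n}. star A (y k i) \<otimes>\<^bsub>A\<^esub> y k j)))"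

definition positive_element :: "'a cstar_alg \<Rightarrow> 'a \<Rightarrow> bool" where
  "positive_element A x \<longleftrightarrow> (\<exists>y\<in>carrier A. x = star A y \<otimes>\<^bsub>A\<^esub> y)"

definition orthogonal_in :: "'a cstar_alg \<Rightarrow> 'a \<Rightarrow> 'a \<Rightarrow> bool" where
  "orthogonal_in A a b \<longleftrightarrow>
     a \<otimes>\<^bsub>A\<^esub> b = \<zero>\<^bsub>A\<^esub> \<and> b \<otimes>\<^bsub>A\<^esub> a = \<zero>\<^bsub>A\<^esub> \<and>
     star A a \<otimes>\<^bsub>A\<^esub> b = \<zero>\<^bsub>A\<^esub> \<and> a \<otimes>\<^bsub>A\<^esub> star A b = \<zero>\<^bsub>A\<^esub>"

definition linear_between :: "'a cstar_alg \<Rightarrow> 'b cstar_alg \<Rightarrow> ('a \<Rightarrow> 'b) \<Rightarrow> bool" where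
  "linear_between A B \<phi> \<longleftrightarrow>
     \<phi> \<in> carrier A \<rightarrow> carrier B \<and>
     (\<forall>x\<in>carrier A. \<forall>y\<in>carrier A. \<phi> (x \<oplus>\<^bsub>A\<^esub> y) = \<phi> x \<oplus>\<^bsub>B\<^esub> \<phi> y) \<and>
     (\<forall>c. \<forall>x\<in>carrier A. \<phi> (csmult A c x) = csmult B c (\<phi> x))"

definition completely_positive :: "'a cstar_alg \<Rightarrow> 'b cstar_alg \<Rightarrow> ('a \<Rightarrow> 'b) \<Rightarrow> bool" where
  "completely_positive A B \<phi> \<longleftrightarrow>
     linear_between A B \<phi> \<and>
     (\<forall>n x. positive_matrix A n x \<longrightarrow> positive_matrix B n (\<lambda>i j. \<phi> (x i j)))"

definition cpc_order_zero :: "'a cstar_alg \<Rightarrow> 'b cstar_alg \<Rightarrow> ('a \<Rightarrow> 'b) \<Rightarrow> bool" where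
  "cpc_order_zero A B \<phi> \<longleftrightarrow>
     completely_positive A B \<phi> \<and>
     (\<forall>x\<in>carrier A. anorm B (\<phi> x) \<le> anorm A x) \<and>
     (\<forall>a b. positive_element A a \<and> positive_element A b \<and> orthogonal_in A a b
        \<longrightarrow> orthogonal_in B (\<phi> a) (\<phi> b))"


section \<open>Rokhlin dimension\<close>

definition induced_action ::
    "('g, 'm) monoid_scheme \<Rightarrow> 'x topology \<Rightarrow> ('g \<Rightarrow> 'x \<Rightarrow> 'x) \<Rightarrow>
     'g \<Rightarrow> ('x \<Rightarrow> complex) \<Rightarrow> ('x \<Rightarrow> complex)" where
  "induced_action G X \<alpha> g f = (\<lambda>x\<in>topspace X. f (\<alpha> (inv\<^bsub>G\<^esub> g) x))"

abbreviation coset_space :: "('g, 'm) monoid_scheme \<Rightarrow> 'g set \<Rightarrow> 'g set topology" where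
  "coset_space G H \<equiv> discrete_topology (lcosets\<^bsub>G\<^esub> H)"

definition G_shift ::
    "('g, 'm) monoid_scheme \<Rightarrow> 'g set \<Rightarrow> 'g \<Rightarrow> ('g set \<Rightarrow> complex) \<Rightarrow> ('g set \<Rightarrow> complex)" where
  "G_shift G H = induced_action G (coset_space G H) (\<lambda>g S. g <#\<^bsub>G\<^esub> S)"

definition rokhlin_dim_sub_le ::
    "('g, 'm) monoid_scheme \<Rightarrow> 'a cstar_alg \<Rightarrow> ('g \<Rightarrow> 'a \<Rightarrow> 'a) \<Rightarrow> 'g set \<Rightarrow> nat \<Rightarrow> bool" where
  "rokhlin_dim_sub_le G A \<beta> H d \<longleftrightarrow>
     (\<exists>\<phi> :: nat \<Rightarrow> ('g set \<Rightarrow> complex) \<Rightarrow> (nat \<Rightarrow> 'a) set set.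
        (\<forall>l\<le>d. cpc_order_zero (C_alg (coset_space G H)) (F_infty A) (\<phi> l) \<and>
           (\<forall>g\<in>carrier G. \<forall>f\<in>carrier (C_alg (coset_space G H)).
              \<phi> l (G_shift G H g f) = F_infty_action \<beta> g (\<phi> l f))) \<and>
        (\<Oplus>\<^bsub>F_infty A\<^esub>l\<in>{..d}. \<phi> l \<one>\<^bsub>C_alg (coset_space G H)\<^esub>) = \<one>\<^bsub>F_infty A\<^esub>)"

definition rokhlin_dim_sub ::
    "('g, 'm) monoid_scheme \<Rightarrow> 'a cstar_alg \<Rightarrow> ('g \<Rightarrow> 'a \<Rightarrow> 'a) \<Rightarrow> 'g set \<Rightarrow> enat" where
  "rokhlin_dim_sub G A \<beta> H = Inf {enat d | d. rokhlin_dim_sub_le G A \<beta> H d}"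

definition rokhlin_dim ::
    "('g, 'm) monoid_scheme \<Rightarrow> 'a cstar_alg \<Rightarrow> ('g \<Rightarrow> 'a \<Rightarrow> 'a) \<Rightarrow> enat" where
  "rokhlin_dim G A \<beta> =
     Sup {rokhlin_dim_sub G A \<beta> H | H. subgroup H G \<and> finite (lcosets\<^bsub>G\<^esub> H)}"

end

theory Submission
  imports Defs
begin

text \<open>The colours come from two sources. A finitely generated nilpotent group \<open>G\<close> has a
  central series with cyclic factors; climbing it, every infinite factor triples the number \<open>m\<close> of
  almost invariant functions \<open>\<phi>\<^sub>j\<close> on \<open>G\<close>, with finite supports \<open>S\<^sub>j\<close>, whose sum is at least \<open>1\<close> on the
  finite set \<open>E\<close> of all quotients \<open>g\<^sup>-\<^sup>1 h\<close> with \<open>g, h \<in> S\<^sub>j\<close>: an interval of length \<open>4 n\<close> is covered by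
  three intervals of length \<open>2 n\<close>, with room to spare. On the dynamical side, \<open>d + 1\<close> real functions on a
  space of dimension \<open>d\<close> can be perturbed to have no common zero. Since the action is free, this applies
  to translates of functions, and a greedy construction then gives open sets \<open>Z\<^sub>0, \<dots>, Z\<^sub>d\<close> whose
  translates by \<open>E\<close> cover \<open>X\<close>, while no \<open>Z\<^sub>i\<close> meets its translate by a nontrivial element of \<open>E\<close>.
  With bump functions \<open>\<psi>\<^sub>i\<close> on \<open>Z\<^sub>i\<close>, the functions \<open>\<Sum>\<^bsub>g \<in> c\<^esub> \<phi>\<^sub>j(g) \<psi>\<^sub>i(g\<^sup>-\<^sup>1 x)\<close>, indexed by cosets \<open>c\<close>, are
  orthogonal for each of the \<open>m (d + 1)\<close> colours and almost equivariant, and their sum is bounded below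
  by \<open>1\<close>; after normalisation they define the required order zero maps.\<close>

section \<open>Nilpotent groups and their central series\<close>

text \<open>The supports grow with the required invariance, so no estimate may depend on their size;
  it is freeness that bounds the number of overlapping terms. If \<open>x\<close> lies in the
  translates of \<open>Z_i\<close> by two elements \<open>g\<close>, \<open>h\<close> of one
  support, then \<open>g^-1 h\<close> lies in \<open>E\<close>, and freeness of \<open>Z_i\<close>
  for \<open>E\<close> forces \<open>g = h\<close>: each colour has at most one non-zero term at
  \<open>x\<close>. In return the translates of the \<open>Z_i\<close> cover only through elements
  of \<open>E\<close>, so the tower functions must be large on all of \<open>E\<close>. This fixes
  the factor 3: a slowly sloping function on an interval of length \<open>2 n\<close> equals 1 on a
  shorter plateau, and two such plateaus cannot cover length \<open>4 n\<close>. Heights along an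
  infinite cyclic factor are additive on \<open>G\<close> only up to an error; it is bounded on
  finitely many representatives of the previous stage and absorbed by the ramps. Finally,
  \<open>hirsch_length\<close> is a minimum over all polycyclic series, so the infinite factors of
  one central series have to be compared with those of every other series; chains of subgroups with
  steps of infinite index provide the invariant.\<close>

context group
begin

text \<open>Together with associativity and the inverse of a product, cancellation brings group
  words into a normal form; \<open>group_word\<close> settles the identities between commutators and
  conjugates below.\<close>

lemma cancel_left:
  "\<lbrakk>x \<in> carrier G; y \<in> carrier G\<rbrakk> \<Longrightarrow> x \<otimes> (inv x \<otimes> y) = y"
  "\<lbrakk>x \<in> carrier G; y \<in> carrier G\<rbrakk> \<Longrightarrow> inv x \<otimes> (x \<otimes> y) = y"
  by (simp_all add: m_assoc [symmetric])

lemmas group_word = m_assoc inv_mult_group cancel_left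

text \<open>Conjugating a commutator conjugates both of its entries, so the generating set of each
  term is stable under conjugation once the preceding term is normal. Both claims are proved
  together because the commutator identities need elements of the carrier.\<close>

lemma lower_central_carrier: "lower_central G n \<subseteq> carrier G"
  and lower_central_normal: "lower_central G n \<lhd> G"
proof (induction n)
  case 0
  show "lower_central G 0 \<subseteq> carrier G" by simp
  show "lower_central G 0 \<lhd> G" by (auto intro!: normal_invI subgroup_self)
next
  case (Suc n)
  let ?C = "{x \<otimes> y \<otimes> inv x \<otimes> inv y | x y. x \<in> lower_central G n \<and> y \<in> carrier G}"
  have C: "?C \<subseteq> carrier G" using Suc by auto
  then show "lower_central G (Suc n) \<subseteq> carrier G" using generate_incl by simp
  have "g \<otimes> h \<otimes> inv g \<in> ?C" if hC: "h \<in> ?C" and g: "g \<in> carrier G" for g h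
  proof -
    obtain x y where h: "h = x \<otimes> y \<otimes> inv x \<otimes> inv y" and x: "x \<in> lower_central G n" and y: "y \<in> carrier G"
      using hC by auto
    have xc: "x \<in> carrier G" using x Suc by auto
    have "g \<otimes> h \<otimes> inv g = (g \<otimes> x \<otimes> inv g) \<otimes> (g \<otimes> y \<otimes> inv g) \<otimes> inv (g \<otimes> x \<otimes> inv g) \<otimes> inv (g \<otimes> y \<otimes> inv g)"
      using g xc y by (simp add: h group_word)
    moreover have "g \<otimes> x \<otimes> inv g \<in> lower_central G n"
      using normal.inv_op_closed2[OF Suc(2) g x] .
    moreover have "g \<otimes> y \<otimes> inv g \<in> carrier G" using g y by simp
    ultimately show ?thesis by blast
  qed
  then show "lower_central G (Suc n) \<lhd> G"
    using normal_generateI[OF C] by simp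
qed

lemma lower_central_commutator:
  "\<lbrakk>x \<in> lower_central G n; y \<in> carrier G\<rbrakk> \<Longrightarrow> x \<otimes> y \<otimes> inv x \<otimes> inv y \<in> lower_central G (Suc n)"
  by (auto intro: generate.incl)

text \<open>Swapping the entries inverts a commutator. The series is defined with one order,
  \<open>centre_mod\<close> uses the other.\<close>

lemma lower_central_commutator':
  assumes "x \<in> lower_central G n" "y \<in> carrier G"
  shows "y \<otimes> x \<otimes> inv y \<otimes> inv x \<in> lower_central G (Suc n)"
proof -
  have "x \<in> carrier G" using assms lower_central_carrier by blast
  then have "inv (x \<otimes> y \<otimes> inv x \<otimes> inv y) = y \<otimes> x \<otimes> inv y \<otimes> inv x"
    using assms(2) by (simp add: group_word)
  then show ?thesis
    using lower_central_commutator[OF assms] normal_imp_subgroup[OF lower_central_normal]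
      subgroup.m_inv_closed by metis
qed

lemma lower_central_Suc_subset: "lower_central G (Suc n) \<subseteq> lower_central G n"
proof -
  have "subgroup (lower_central G n) G" by (rule normal_imp_subgroup[OF lower_central_normal])
  moreover have "{x \<otimes> y \<otimes> inv x \<otimes> inv y | x y. x \<in> lower_central G n \<and> y \<in> carrier G} \<subseteq> lower_central G n"
  proof clarify
    fix x y assume x: "x \<in> lower_central G n" and y: "y \<in> carrier G"
    have xc: "x \<in> carrier G" using x lower_central_carrier by blast
    have "x \<otimes> y \<otimes> inv x \<otimes> inv y = x \<otimes> (y \<otimes> inv x \<otimes> inv y)" using xc y by (simp add: m_assoc)
    moreover have "y \<otimes> inv x \<otimes> inv y \<in> lower_central G n"
      using normal.inv_op_closed2[OF lower_central_normal y] x calculation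
        subgroup.m_inv_closed[OF normal_imp_subgroup[OF lower_central_normal]] by blast
    ultimately show "x \<otimes> y \<otimes> inv x \<otimes> inv y \<in> lower_central G n"
      using x subgroup.m_closed[OF normal_imp_subgroup[OF lower_central_normal]] by metis
  qed
  ultimately show ?thesis using generate_subgroup_incl by simp
qed

text \<open>For normal \<open>D\<close> this is the preimage of the centre of \<open>G / D\<close>;
  with preimages the whole series stays inside \<open>G\<close>.\<close>

definition centre_mod :: "'a set \<Rightarrow> 'a set" where
  "centre_mod D = {x \<in> carrier G. \<forall>g\<in>carrier G. g \<otimes> x \<otimes> inv g \<otimes> inv x \<in> D}"

text \<open>Closure under products rests on \<open>[g, x y] = [g, x] (x [g, y] x^-1)\<close>, whose
  second factor is a conjugate of an element of \<open>D\<close>.\<close>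

lemma subgroup_centre_mod:
  assumes D: "D \<lhd> G"
  shows "subgroup (centre_mod D) G"
proof -
  interpret D: normal D G by fact
  show ?thesis
  proof (rule subgroupI)
    show "centre_mod D \<subseteq> carrier G" by (auto simp: centre_mod_def)
    show "centre_mod D \<noteq> {}" by (auto simp: centre_mod_def intro!: exI[of _ \<one>])
  next
    fix x assume x: "x \<in> centre_mod D"
    then have xc: "x \<in> carrier G" by (simp add: centre_mod_def)
    { fix g assume g: "g \<in> carrier G"
      have "g \<otimes> inv x \<otimes> inv g \<otimes> inv (inv x) = inv x \<otimes> inv (g \<otimes> x \<otimes> inv g \<otimes> inv x) \<otimes> x"
        using g xc by (simp add: group_word)
      moreover have "inv (g \<otimes> x \<otimes> inv g \<otimes> inv x) \<in> D"
        using x g by (simp add: centre_mod_def)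
      ultimately have "g \<otimes> inv x \<otimes> inv g \<otimes> inv (inv x) \<in> D"
        using D.inv_op_closed1[OF xc] by metis }
    then show "inv x \<in> centre_mod D" using xc by (simp add: centre_mod_def)
  next
    fix x y assume x: "x \<in> centre_mod D" and y: "y \<in> centre_mod D"
    then have xc: "x \<in> carrier G" and yc: "y \<in> carrier G" by (simp_all add: centre_mod_def)
    { fix g assume g: "g \<in> carrier G"
      have "g \<otimes> (x \<otimes> y) \<otimes> inv g \<otimes> inv (x \<otimes> y) =
          (g \<otimes> x \<otimes> inv g \<otimes> inv x) \<otimes> (x \<otimes> (g \<otimes> y \<otimes> inv g \<otimes> inv y) \<otimes> inv x)"
        using g xc yc by (simp add: group_word)
      moreover have "g \<otimes> x \<otimes> inv g \<otimes> inv x \<in> D" "g \<otimes> y \<otimes> inv g \<otimes> inv y \<in> D"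
        using x y g by (simp_all add: centre_mod_def)
      ultimately have "g \<otimes> (x \<otimes> y) \<otimes> inv g \<otimes> inv (x \<otimes> y) \<in> D"
        using D.inv_op_closed2[OF xc] by (metis D.m_closed) }
    then show "x \<otimes> y \<in> centre_mod D" using xc yc by (simp add: centre_mod_def)
  qed
qed

lemma subset_centre_mod:
  assumes D: "D \<lhd> G"
  shows "D \<subseteq> centre_mod D"
proof -
  interpret D: normal D G by fact
  show ?thesis
    unfolding centre_mod_def using D.inv_op_closed2 D.m_closed D.m_inv_closed D.subset by auto
qed

text \<open>The image in \<open>G / D\<close> is central, hence normal: conjugation changes an
  element only by a commutator, which lies in \<open>D\<close>.\<close>

lemma normal_between_centre_mod:
  assumes D: "D \<lhd> G" and N: "subgroup N G" "D \<subseteq> N" "N \<subseteq> centre_mod D"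
  shows "N \<lhd> G"
proof (rule normal_invI[OF N(1)])
  fix g h assume g: "g \<in> carrier G" and h: "h \<in> N"
  then have hc: "h \<in> carrier G" using N(1) subgroup.subset by blast
  have "g \<otimes> h \<otimes> inv g = (g \<otimes> h \<otimes> inv g \<otimes> inv h) \<otimes> h" using g hc by (simp add: group_word)
  moreover have "g \<otimes> h \<otimes> inv g \<otimes> inv h \<in> N" using h N g by (auto simp: centre_mod_def)
  ultimately show "g \<otimes> h \<otimes> inv g \<in> N" using h N(1) subgroup.m_closed by metis
qed

text \<open>Modulo the next term, the commutator is bilinear on \<open>lower_central G n\<close> and \<open>G\<close>.\<close>

lemma subgroup_commutator_left:
  assumes "Q \<lhd> G" and y: "y \<in> carrier G"
  shows "subgroup {x \<in> carrier G. x \<otimes> y \<otimes> inv x \<otimes> inv y \<in> Q} G"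
proof -
  interpret Q: normal Q G by fact
  show ?thesis
  proof (rule subgroupI)
    show "{x \<in> carrier G. x \<otimes> y \<otimes> inv x \<otimes> inv y \<in> Q} \<noteq> {}"
      using y by (auto intro!: exI[of _ \<one>])
  next
    fix x assume "x \<in> {x \<in> carrier G. x \<otimes> y \<otimes> inv x \<otimes> inv y \<in> Q}"
    then have x: "x \<in> carrier G" "x \<otimes> y \<otimes> inv x \<otimes> inv y \<in> Q" by auto
    have "inv x \<otimes> y \<otimes> inv (inv x) \<otimes> inv y = inv x \<otimes> inv (x \<otimes> y \<otimes> inv x \<otimes> inv y) \<otimes> x"
      using x y by (simp add: group_word)
    then show "inv x \<in> {x \<in> carrier G. x \<otimes> y \<otimes> inv x \<otimes> inv y \<in> Q}"
      using x Q.inv_op_closed1[OF x(1) Q.m_inv_closed[OF x(2)]] by simp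
  next
    fix x x' assume "x \<in> {x \<in> carrier G. x \<otimes> y \<otimes> inv x \<otimes> inv y \<in> Q}"
      "x' \<in> {x \<in> carrier G. x \<otimes> y \<otimes> inv x \<otimes> inv y \<in> Q}"
    then have x: "x \<in> carrier G" "x \<otimes> y \<otimes> inv x \<otimes> inv y \<in> Q"
      and x': "x' \<in> carrier G" "x' \<otimes> y \<otimes> inv x' \<otimes> inv y \<in> Q" by auto
    have "(x \<otimes> x') \<otimes> y \<otimes> inv (x \<otimes> x') \<otimes> inv y =
        (x \<otimes> (x' \<otimes> y \<otimes> inv x' \<otimes> inv y) \<otimes> inv x) \<otimes> (x \<otimes> y \<otimes> inv x \<otimes> inv y)"
      using x x' y by (simp add: group_word)
    then show "x \<otimes> x' \<in> {x \<in> carrier G. x \<otimes> y \<otimes> inv x \<otimes> inv y \<in> Q}"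
      using x x' Q.inv_op_closed2[OF x(1) x'(2)] by simp
  qed auto
qed

lemma subgroup_commutator_right:
  assumes Q: "Q \<lhd> G" and x: "x \<in> carrier G"
  shows "subgroup {y \<in> carrier G. x \<otimes> y \<otimes> inv x \<otimes> inv y \<in> Q} G"
proof -
  interpret Q: normal Q G by fact
  \<comment> \<open>Inversion exchanges the two entries and preserves \<open>Q\<close>, which
    reduces the claim to the other variable.\<close>
  have "x \<otimes> y \<otimes> inv x \<otimes> inv y \<in> Q \<longleftrightarrow> y \<otimes> x \<otimes> inv y \<otimes> inv x \<in> Q" if y: "y \<in> carrier G" for y
  proof -
    have "inv (x \<otimes> y \<otimes> inv x \<otimes> inv y) = y \<otimes> x \<otimes> inv y \<otimes> inv x"
      "inv (y \<otimes> x \<otimes> inv y \<otimes> inv x) = x \<otimes> y \<otimes> inv x \<otimes> inv y"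
      using x y by (simp_all add: group_word)
    then show ?thesis using Q.m_inv_closed by metis
  qed
  then have "{y \<in> carrier G. x \<otimes> y \<otimes> inv x \<otimes> inv y \<in> Q} = {y \<in> carrier G. y \<otimes> x \<otimes> inv y \<otimes> inv x \<in> Q}"
    by blast
  then show ?thesis using subgroup_commutator_left[OF Q x] by simp
qed

text \<open>By bilinearity, if \<open>B\<close> generates one factor of the series and
  \<open>S\<close> generates \<open>G\<close>, the commutators of \<open>B\<close> with
  \<open>S\<close> generate the next factor. Finite generation thus passes from \<open>G\<close> to
  all factors.\<close>

lemma lower_central_finitely_generated_mod:
  assumes S: "finite S" "S \<subseteq> carrier G" "generate G S = carrier G"
  shows "\<exists>B. finite B \<and> B \<subseteq> lower_central G n \<and>
             lower_central G n = generate G (B \<union> lower_central G (Suc n))"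
proof (induction n)
  case 0
  have "generate G (S \<union> lower_central G (Suc 0)) = carrier G"
    using S mono_generate[of S "S \<union> lower_central G (Suc 0)"]
      generate_incl[of "S \<union> lower_central G (Suc 0)"] lower_central_carrier[of "Suc 0"] by blast
  then show ?case using S by (intro exI[of _ S]) simp
next
  case (Suc n)
  then obtain B where B: "finite B" "B \<subseteq> lower_central G n"
    "lower_central G n = generate G (B \<union> lower_central G (Suc n))" by blast
  define L where "L = lower_central G (Suc n)"
  define D where "D = lower_central G (Suc (Suc n))"
  have L: "L \<lhd> G" "L \<subseteq> carrier G" and D: "D \<lhd> G" and DL: "D \<subseteq> L"
    unfolding D_def L_def by (rule lower_central_normal lower_central_carrier lower_central_Suc_subset)+
  define c where "c x y = x \<otimes> y \<otimes> inv x \<otimes> inv y" for x y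
  define B' where "B' = (\<lambda>(x, y). c x y) ` (B \<times> S)"
  have nc: "lower_central G n \<subseteq> carrier G" by (rule lower_central_carrier)
  have L_gen: "L = generate G {c x y | x y. x \<in> lower_central G n \<and> y \<in> carrier G}"
    by (simp add: L_def c_def)
  have B'L: "B' \<subseteq> L"
  proof -
    have "c x y \<in> L" if "x \<in> B" "y \<in> S" for x y
      unfolding c_def L_def using that B(2) S(2) by (intro lower_central_commutator) auto
    then show ?thesis unfolding B'_def by auto
  qed
  have LZ: "L \<subseteq> centre_mod D"
    using lower_central_commutator' L(2) unfolding centre_mod_def D_def L_def by blast
  define Q where "Q = generate G (B' \<union> D)"
  have sub: "B' \<union> D \<subseteq> L" using B'L DL by blast
  have Q: "subgroup Q G" unfolding Q_def
    using sub L(2) by (intro generate_is_subgroup) blast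
  have QL: "Q \<subseteq> L" unfolding Q_def by (rule generate_subgroup_incl[OF sub normal_imp_subgroup[OF L(1)]])
  have DQ: "D \<subseteq> Q" and BQ: "B' \<subseteq> Q" unfolding Q_def by (auto intro: generate.incl)
  \<comment> \<open>Normality of \<open>Q\<close> allows commutators to be computed modulo
    \<open>Q\<close>; it holds because everything between \<open>D\<close> and \<open>L\<close> is
    central modulo \<open>D\<close>.\<close>
  have Qn: "Q \<lhd> G" using normal_between_centre_mod[OF D Q DQ] QL LZ by blast
  \<comment> \<open>One variable at a time: \<open>y\<close> stays a generator while
    \<open>x\<close> spreads from \<open>B\<close> to the whole term. The part of \<open>x\<close>
    in \<open>L\<close> costs only commutators in \<open>D\<close>.\<close>
  have 1: "c x y \<in> Q" if x: "x \<in> lower_central G n" and y: "y \<in> S" for x y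
  proof -
    have yc: "y \<in> carrier G" using y S by blast
    have "B \<union> L \<subseteq> {x \<in> carrier G. c x y \<in> Q}"
    proof -
      have "c x y \<in> Q" if "x \<in> B" for x
        using that y BQ unfolding B'_def by blast
      moreover have "c x y \<in> Q" if "x \<in> L" for x
        using lower_central_commutator[of x "Suc n" y] that yc DQ unfolding c_def L_def D_def by blast
      ultimately show ?thesis using B(2) nc L(2) by blast
    qed
    then have "lower_central G n \<subseteq> {x \<in> carrier G. c x y \<in> Q}"
      using B(3) generate_subgroup_incl[OF _ subgroup_commutator_left[OF Qn yc]] unfolding c_def L_def
      by (simp del: lower_central.simps)
    then show ?thesis using x by blast
  qed
  have 2: "c x y \<in> Q" if x: "x \<in> lower_central G n" and y: "y \<in> carrier G" for x y
  proof -
    have xc: "x \<in> carrier G" using x nc by blast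
    have "S \<subseteq> {y \<in> carrier G. c x y \<in> Q}" using 1 x S by blast
    then have "generate G S \<subseteq> {y \<in> carrier G. c x y \<in> Q}"
      using generate_subgroup_incl subgroup_commutator_right[OF Qn xc] unfolding c_def by blast
    then show ?thesis using S(3) y by blast
  qed
  have "L \<subseteq> Q" unfolding L_gen
    using 2 by (intro generate_subgroup_incl Q) blast
  with QL have "L = generate G (B' \<union> D)" unfolding Q_def by blast
  moreover have "finite B'" unfolding B'_def using B(1) S(1) by blast
  ultimately show ?case using B'L unfolding L_def D_def by blast
qed

text \<open>Finitely many left translates of \<open>N\<close> cover \<open>H\<close>. The
  formulation makes sense for arbitrary subsets, and the representatives may lie outside
  \<open>H\<close>.\<close>

definition finite_index_in :: "'a set \<Rightarrow> 'a set \<Rightarrow> bool" where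
  "finite_index_in N H \<longleftrightarrow> (\<exists>R. finite R \<and> R \<subseteq> carrier G \<and> (\<forall>x\<in>H. \<exists>r\<in>R. inv r \<otimes> x \<in> N))"

text \<open>\<open>H / N\<close> is a cyclic subgroup of the centre of \<open>G / N\<close>,
  generated by the image of \<open>c\<close>.\<close>

definition central_step :: "'a set \<Rightarrow> 'a set \<Rightarrow> bool" where
  "central_step H N \<longleftrightarrow> H \<lhd> G \<and> N \<lhd> G \<and> N \<subseteq> H \<and>
     (\<exists>c\<in>H. (\<forall>x\<in>H. \<exists>t::int. inv (c [^] t) \<otimes> x \<in> N) \<and> c \<in> centre_mod N)"

text \<open>The chain descends from \<open>G\<close>, the direction in which towers are lifted from
  \<open>G / H\<close> to \<open>G / N\<close>; the number counts the infinite factors, each of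
  which triples the colours.\<close>

inductive central_chain :: "'a set \<Rightarrow> nat \<Rightarrow> bool" where
  top: "central_chain (carrier G) 0"
| finite_step: "\<lbrakk>central_chain H n; central_step H N; finite_index_in N H\<rbrakk> \<Longrightarrow> central_chain N n"
| infinite_step: "\<lbrakk>central_chain H n; central_step H N; \<not> finite_index_in N H\<rbrakk> \<Longrightarrow> central_chain N (Suc n)"

lemma central_chain_step:
  "\<lbrakk>central_chain H n; central_step H N\<rbrakk> \<Longrightarrow> \<exists>m. central_chain N m"
  using finite_step infinite_step by blast

text \<open>All generators are central modulo \<open>D\<close>, so both subgroups are normal, and
  modulo the smaller one the larger is generated by \<open>b\<close> alone.\<close>

lemma central_step_generate:
  assumes D: "D \<lhd> G" and B: "insert b B \<subseteq> centre_mod D"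
  shows "central_step (generate G (insert b B \<union> D)) (generate G (B \<union> D))"
proof -
  let ?H = "generate G (insert b B \<union> D)" and ?N = "generate G (B \<union> D)"
  interpret D: normal D G by fact
  note Z = subgroup_centre_mod[OF D]
  have Zc: "centre_mod D \<subseteq> carrier G" using Z subgroup.subset by blast
  have HZ: "insert b B \<union> D \<subseteq> centre_mod D" using B subset_centre_mod[OF D] by blast
  have Hs: "subgroup ?H G" and Ns: "subgroup ?N G"
    using HZ Zc by (intro generate_is_subgroup; blast)+
  have HZ': "?H \<subseteq> centre_mod D" by (rule generate_subgroup_incl[OF HZ Z])
  have NH: "?N \<subseteq> ?H" by (rule mono_generate) blast
  have DN: "D \<subseteq> ?N" by (auto intro: generate.incl)
  have Hn: "?H \<lhd> G" using normal_between_centre_mod[OF D Hs] DN NH HZ' by blast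
  have Nn: "?N \<lhd> G" using normal_between_centre_mod[OF D Ns DN] NH HZ' by blast
  interpret N: normal ?N G by (rule Nn)
  have b: "b \<in> ?H" by (auto intro: generate.incl)
  have bc: "b \<in> carrier G" using B Zc by blast
  \<comment> \<open>The elements that are powers of \<open>b\<close> modulo \<open>?N\<close> form a
    subgroup; it contains all generators of \<open>?H\<close> and hence \<open>?H\<close>
    itself.\<close>
  have "subgroup {x \<in> carrier G. \<exists>t::int. inv (b [^] t) \<otimes> x \<in> ?N} G"
  proof (rule subgroupI)
    show "{x \<in> carrier G. \<exists>t::int. inv (b [^] t) \<otimes> x \<in> ?N} \<noteq> {}"
      by (auto intro!: exI[of _ \<one>] exI[of _ "0::int"])
  next
    fix x assume "x \<in> {x \<in> carrier G. \<exists>t::int. inv (b [^] t) \<otimes> x \<in> ?N}"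
    then obtain t :: int where x: "x \<in> carrier G" "inv (b [^] t) \<otimes> x \<in> ?N" by blast
    let ?p = "b [^] t"
    have p: "?p \<in> carrier G" using bc by simp
    have "inv (b [^] (- t)) \<otimes> inv x = ?p \<otimes> inv (inv ?p \<otimes> x) \<otimes> inv ?p"
      using x p by (simp add: int_pow_neg bc group_word)
    then show "inv x \<in> {x \<in> carrier G. \<exists>t::int. inv (b [^] t) \<otimes> x \<in> ?N}"
      using x N.inv_op_closed2[OF p N.m_inv_closed[OF x(2)]] by (auto intro!: exI[of _ "- t"])
  next
    fix x y assume "x \<in> {x \<in> carrier G. \<exists>t::int. inv (b [^] t) \<otimes> x \<in> ?N}"
      "y \<in> {x \<in> carrier G. \<exists>t::int. inv (b [^] t) \<otimes> x \<in> ?N}"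
    then obtain s t :: int where x: "x \<in> carrier G" "inv (b [^] s) \<otimes> x \<in> ?N"
      and y: "y \<in> carrier G" "inv (b [^] t) \<otimes> y \<in> ?N" by blast
    let ?p = "b [^] s" and ?q = "b [^] t"
    have p: "?p \<in> carrier G" and q: "?q \<in> carrier G" using bc by simp_all
    have "inv (b [^] (s + t)) \<otimes> (x \<otimes> y) = (inv ?q \<otimes> (inv ?p \<otimes> x) \<otimes> ?q) \<otimes> (inv ?q \<otimes> y)"
      using x y p q by (simp add: int_pow_mult bc group_word)
    then show "x \<otimes> y \<in> {x \<in> carrier G. \<exists>t::int. inv (b [^] t) \<otimes> x \<in> ?N}"
      using x y N.inv_op_closed1[OF q x(2)] by (auto intro!: exI[of _ "s + t"])
  qed auto
  moreover have "insert b B \<union> D \<subseteq> {x \<in> carrier G. \<exists>t::int. inv (b [^] t) \<otimes> x \<in> ?N}"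
  proof -
    have "inv (b [^] (1::int)) \<otimes> b \<in> ?N" using bc by (simp add: int_pow_1 N.one_closed)
    moreover have "inv (b [^] (0::int)) \<otimes> x \<in> ?N" if "x \<in> B \<union> D" for x
      using that HZ Zc by (auto intro: generate.incl)
    ultimately show ?thesis using HZ Zc by blast
  qed
  ultimately have "?H \<subseteq> {x \<in> carrier G. \<exists>t::int. inv (b [^] t) \<otimes> x \<in> ?N}"
    using generate_subgroup_incl by blast
  moreover have "b \<in> centre_mod ?N" using B DN unfolding centre_mod_def by blast
  ultimately show ?thesis unfolding central_step_def using Hn Nn NH b by blast
qed

text \<open>The factor between \<open>D\<close> and \<open>generate G (B \<union> D)\<close> is
  split by discarding one generator after the other, until only \<open>D\<close> is left.\<close>

lemma central_chain_refine:
  assumes D: "D \<lhd> G" and "finite B" "B \<subseteq> centre_mod D" "central_chain (generate G (B \<union> D)) n"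
  shows "\<exists>m. central_chain D m"
  using assms(2-)
proof (induction arbitrary: n rule: finite_induct)
  case empty
  have "generate G D = D"
    using generateI[OF normal_imp_subgroup[OF D], of D] by simp
  then show ?case using empty by auto
next
  case (insert b B)
  have "central_step (generate G (insert b B \<union> D)) (generate G (B \<union> D))"
    by (rule central_step_generate[OF D insert.prems(1)])
  then obtain m where "central_chain (generate G (B \<union> D)) m"
    using central_chain_step[OF insert.prems(2)] by blast
  then show ?case using insert.IH insert.prems(1) by auto
qed

lemma central_chain_lower_central:
  assumes S: "finite S" "S \<subseteq> carrier G" "generate G S = carrier G"
  shows "\<exists>m. central_chain (lower_central G n) m"
proof (induction n)
  case 0
  then show ?case using top by auto
next
  case (Suc n)
  then obtain m where m: "central_chain (lower_central G n) m" by blast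
  obtain B where B: "finite B" "B \<subseteq> lower_central G n"
    "lower_central G n = generate G (B \<union> lower_central G (Suc n))"
    using lower_central_finitely_generated_mod[OF S] by blast
  have "B \<subseteq> centre_mod (lower_central G (Suc n))"
    using B(2) lower_central_commutator' lower_central_carrier unfolding centre_mod_def by blast
  then show ?case using central_chain_refine[OF lower_central_normal B(1)] m B(3) by metis
qed

end

lemma nilpotent_central_chain:
  assumes "finitely_generated_group G" "nilpotent_group G"
  shows "\<exists>n. group.central_chain G {\<one>\<^bsub>G\<^esub>} n"
  using assms group.central_chain_lower_central
  unfolding finitely_generated_group_def nilpotent_group_def by metis

section \<open>Hirsch length\<close>

context group
begin

text \<open>The quotient \<open>Mod\<close> consists of right cosets, while finite index is phrased
  with left translates; normality of \<open>K\<close> in \<open>H\<close> turns one into the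
  other.\<close>

lemma subnormal_coset_eq_iff:
  assumes H: "subgroup H G" and K: "K \<lhd> (G\<lparr>carrier := H\<rparr>)" and x: "x \<in> H" and r: "r \<in> H"
  shows "K #> x = K #> r \<longleftrightarrow> inv r \<otimes> x \<in> K"
proof -
  interpret K: normal K "G\<lparr>carrier := H\<rparr>" by fact
  have xc: "x \<in> carrier G" and rc: "r \<in> carrier G" using x r H subgroup.subset by blast+
  have Kc: "K \<subseteq> carrier G" and KG: "subgroup K G"
    using incl_subgroup[OF H K.subgroup_axioms] subgroup.subset by blast+
  have inv_eq: "inv\<^bsub>G\<lparr>carrier := H\<rparr>\<^esub> r = inv r" using m_inv_consistent[OF H r] .
  have "x \<in> K #> r \<longleftrightarrow> inv r \<otimes> x \<in> K"
  proof
    assume "x \<in> K #> r"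
    then obtain k where k: "k \<in> K" "x = k \<otimes> r" by (auto simp: r_coset_def)
    then have "inv r \<otimes> k \<otimes> r \<in> K" using K.inv_op_closed1[of r k] inv_eq r by simp
    then show "inv r \<otimes> x \<in> K" using rc k Kc by (simp add: m_assoc subset_iff)
  next
    assume a: "inv r \<otimes> x \<in> K"
    have "x = (r \<otimes> (inv r \<otimes> x) \<otimes> inv r) \<otimes> r" using xc rc by (simp add: group_word)
    moreover have "r \<otimes> (inv r \<otimes> x) \<otimes> inv r \<in> K"
      using K.inv_op_closed2[of r "inv r \<otimes> x"] a r inv_eq by simp
    ultimately show "x \<in> K #> r" unfolding r_coset_def by auto
  qed
  moreover have "x \<in> K #> x" using rcos_self[OF xc KG] .
  ultimately show ?thesis using repr_independence[OF _ rc KG] by metis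
qed

lemma finite_index_in_iff_finite_quotient:
  assumes H: "subgroup H G" and K: "K \<lhd> (G\<lparr>carrier := H\<rparr>)"
  shows "finite (carrier ((G\<lparr>carrier := H\<rparr>) Mod K)) \<longleftrightarrow> finite_index_in K H"
proof -
  have Hc: "H \<subseteq> carrier G" using H subgroup.subset by blast
  have KH: "K \<subseteq> H" using normal_imp_subgroup[OF K] subgroup.subset by fastforce
  have carr: "carrier ((G\<lparr>carrier := H\<rparr>) Mod K) = (\<lambda>a. K #> a) ` H"
    by (auto simp: FactGroup_def RCOSETS_def r_coset_def)
  note mem = subnormal_coset_eq_iff[OF H K]
  show ?thesis
  proof
    assume "finite (carrier ((G\<lparr>carrier := H\<rparr>) Mod K))"
    then have "finite ((\<lambda>a. K #> a) ` H)" using carr by simp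
    then obtain R where R: "R \<subseteq> H" "finite R" "(\<lambda>a. K #> a) ` H = (\<lambda>a. K #> a) ` R"
      using finite_subset_image[OF _ subset_refl, of "\<lambda>a. K #> a" H] by metis
    have "\<exists>r\<in>R. inv r \<otimes> x \<in> K" if x: "x \<in> H" for x
    proof -
      have "K #> x \<in> (\<lambda>a. K #> a) ` R" using R(3) x by blast
      then obtain r where r: "r \<in> R" "K #> x = K #> r" by auto
      then have "inv r \<otimes> x \<in> K" using mem[OF x, of r] R(1) by auto
      then show ?thesis using r by auto
    qed
    then show "finite_index_in K H" unfolding finite_index_in_def using R(1,2) Hc by (metis subset_trans)
  next
    assume "finite_index_in K H"
    then obtain R where R: "finite R" "R \<subseteq> carrier G" "\<And>x. x \<in> H \<Longrightarrow> \<exists>r\<in>R. inv r \<otimes> x \<in> K"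
      unfolding finite_index_in_def by metis
    \<comment> \<open>A representative that serves some \<open>x \<in> H\<close> lies in
      \<open>H\<close> itself, because \<open>K \<subseteq> H\<close>.\<close>
    have "\<exists>r\<in>R \<inter> H. K #> x = K #> r" if x: "x \<in> H" for x
    proof -
      obtain r where r: "r \<in> R" "inv r \<otimes> x \<in> K" using R(3) x by blast
      have rc: "r \<in> carrier G" and xc: "x \<in> carrier G" using r x R Hc by auto
      have "r = x \<otimes> inv (inv r \<otimes> x)" using rc xc by (simp add: group_word)
      then have "r \<in> H" using r x KH H by (metis subgroup.m_closed subgroup.m_inv_closed subsetD)
      then show ?thesis using mem[OF x] r by blast
    qed
    then have "(\<lambda>a. K #> a) ` H \<subseteq> (\<lambda>a. K #> a) ` (R \<inter> H)" by blast
    then show "finite (carrier ((G\<lparr>carrier := H\<rparr>) Mod K))"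
      using R(1) unfolding carr by (meson finite_Int finite_imageI finite_subset)
  qed
qed

lemma cyclic_quotient_iff:
  assumes H: "subgroup H G" and K: "K \<lhd> (G\<lparr>carrier := H\<rparr>)"
  shows "cyclic_group ((G\<lparr>carrier := H\<rparr>) Mod K) \<longleftrightarrow>
    (\<exists>c\<in>H. \<forall>x\<in>H. \<exists>t::int. inv (c [^] t) \<otimes> x \<in> K)"
proof -
  interpret K: normal K "G\<lparr>carrier := H\<rparr>" by fact
  interpret Q: group "(G\<lparr>carrier := H\<rparr>) Mod K" by (rule K.factorgroup_is_group)
  have pow_eq: "x [^]\<^bsub>G\<lparr>carrier := H\<rparr>\<^esub> t = x [^] t" if "x \<in> H" for x and t :: int
    using int_pow_consistent[OF H that] by simp
  have pow_H: "x [^] t \<in> H" if "x \<in> H" for x and t :: int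
    using subgroup_int_pow_closed[OF H that] .
  have hom: "(\<lambda>a. K #>\<^bsub>G\<lparr>carrier := H\<rparr>\<^esub> a) \<in> hom (G\<lparr>carrier := H\<rparr>) ((G\<lparr>carrier := H\<rparr>) Mod K)"
    by (rule K.r_coset_hom_Mod)
  interpret h: group_hom "G\<lparr>carrier := H\<rparr>" "(G\<lparr>carrier := H\<rparr>) Mod K" "\<lambda>a. K #>\<^bsub>G\<lparr>carrier := H\<rparr>\<^esub> a"
    using hom by unfold_locales
  have rc: "K #>\<^bsub>G\<lparr>carrier := H\<rparr>\<^esub> a = K #> a" for a by (simp add: r_coset_def)
  have pow: "(K #> c) [^]\<^bsub>(G\<lparr>carrier := H\<rparr>) Mod K\<^esub> t = K #> (c [^] t)" if "c \<in> H" for c and t :: int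
    using h.hom_int_pow[of c t] that pow_eq by (simp add: rc)
  have carr: "carrier ((G\<lparr>carrier := H\<rparr>) Mod K) = (\<lambda>a. K #> a) ` H"
    by (auto simp: FactGroup_def RCOSETS_def r_coset_def)
  have "cyclic_group ((G\<lparr>carrier := H\<rparr>) Mod K) \<longleftrightarrow>
      (\<exists>c\<in>H. (\<lambda>a. K #> a) ` H = range (\<lambda>t::int. K #> (c [^] t)))"
    unfolding Q.cyclic_group carr using pow by (auto cong: image_cong)
  also have "\<dots> \<longleftrightarrow> (\<exists>c\<in>H. \<forall>x\<in>H. \<exists>t::int. K #> x = K #> (c [^] t))"
  proof (intro bex_cong refl)
    fix c assume "c \<in> H"
    then have "range (\<lambda>t::int. K #> (c [^] t)) \<subseteq> (\<lambda>a. K #> a) ` H" using pow_H by blast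
    then show "(\<lambda>a. K #> a) ` H = range (\<lambda>t::int. K #> (c [^] t)) \<longleftrightarrow>
        (\<forall>x\<in>H. \<exists>t::int. K #> x = K #> (c [^] t))"
      unfolding set_eq_subset[of "(\<lambda>a. K #> a) ` H"] image_subset_iff by (simp add: image_iff)
  qed
  also have "\<dots> \<longleftrightarrow> (\<exists>c\<in>H. \<forall>x\<in>H. \<exists>t::int. inv (c [^] t) \<otimes> x \<in> K)"
    using subnormal_coset_eq_iff[OF H K] pow_H by (intro bex_cong ball_cong refl ex_cong1) auto
  finally show ?thesis .
qed

lemma central_step_subnormal:
  assumes "central_step H N"
  shows "subgroup H G" "N \<lhd> (G\<lparr>carrier := H\<rparr>)" "cyclic_group ((G\<lparr>carrier := H\<rparr>) Mod N)"
proof -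
  show H: "subgroup H G" using assms normal_imp_subgroup unfolding central_step_def by blast
  show N: "N \<lhd> (G\<lparr>carrier := H\<rparr>)"
    using normal_restrict_supergroup[OF H] assms unfolding central_step_def by blast
  show "cyclic_group ((G\<lparr>carrier := H\<rparr>) Mod N)"
    using assms unfolding cyclic_quotient_iff[OF H N] central_step_def by blast
qed

text \<open>A central chain grows downwards, a polycyclic series upwards. So the series of the
  bottom group \<open>N\<close> is prolonged along the chain, and \<open>m\<close> has to vary in
  the induction.\<close>

lemma central_chain_imp_polycyclic_series:
  assumes "central_chain N n" "polycyclic_series G N m"
  shows "polycyclic_series G (carrier G) (m + n)"
  using assms
proof (induction arbitrary: m rule: central_chain.induct)
  case top
  then show ?case by simp
next
  case (finite_step H n N)
  note H = central_step_subnormal[OF finite_step(2)]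
  have "polycyclic_series G H m"
    using polycyclic_series.finite_factor[OF finite_step.prems H(1,2,3)]
      finite_index_in_iff_finite_quotient[OF H(1,2)] finite_step(3) by simp
  then show ?case by (rule finite_step.IH)
next
  case (infinite_step H n N)
  note H = central_step_subnormal[OF infinite_step(2)]
  have "polycyclic_series G H (Suc m)"
    using polycyclic_series.infinite_factor[OF infinite_step.prems H(1,2,3)]
      finite_index_in_iff_finite_quotient[OF H(1,2)] infinite_step(3) by simp
  then have "polycyclic_series G (carrier G) (Suc m + n)" by (rule infinite_step.IH)
  then show ?case by simp
qed

section \<open>Chains of subgroups as an invariant of the number of infinite factors\<close>

text \<open>\<open>subgroup_chain H n\<close>: some finite chain of subgroups from the trivial subgroup up to \<open>H\<close>
  has at least \<open>n\<close> steps of infinite index.\<close>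

inductive subgroup_chain :: "'a set \<Rightarrow> nat \<Rightarrow> bool" where
  trivial: "subgroup_chain {\<one>} 0"
| weak: "\<lbrakk>subgroup_chain K n; K \<subseteq> H; subgroup H G\<rbrakk> \<Longrightarrow> subgroup_chain H n"
| strict: "\<lbrakk>subgroup_chain K n; K \<subseteq> H; subgroup H G; \<not> finite_index_in K H\<rbrakk> \<Longrightarrow> subgroup_chain H (Suc n)"

lemma subgroup_chain_subgroup: "subgroup_chain H n \<Longrightarrow> subgroup H G"
  by (induction rule: subgroup_chain.induct) (auto simp: triv_subgroup)

lemma subgroup_chain_mono: "subgroup_chain H n \<Longrightarrow> m \<le> n \<Longrightarrow> subgroup_chain H m"
proof (induction arbitrary: m rule: subgroup_chain.induct)
  case (strict K n H)
  then show ?case using weak subgroup_chain.strict by (metis le_Suc_eq)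
qed (auto intro: subgroup_chain.intros)

lemma central_chain_imp_subgroup_chain:
  assumes "central_chain N n" "subgroup_chain N m"
  shows "subgroup_chain (carrier G) (m + n)"
  using assms
proof (induction arbitrary: m rule: central_chain.induct)
  case top
  then show ?case by simp
next
  case (finite_step H n N)
  then have "subgroup_chain H m"
    using weak central_step_subnormal(1) unfolding central_step_def by blast
  then show ?case by (rule finite_step.IH)
next
  case (infinite_step H n N)
  then have "subgroup_chain H (Suc m)"
    using strict central_step_subnormal(1) unfolding central_step_def by blast
  then have "subgroup_chain (carrier G) (Suc m + n)" by (rule infinite_step.IH)
  then show ?case by simp
qed

lemma finite_index_in_trans:
  assumes "finite_index_in A B" "finite_index_in B C" "A \<subseteq> carrier G" "B \<subseteq> carrier G" "C \<subseteq> carrier G"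
  shows "finite_index_in A C"
proof -
  obtain R where R: "finite R" "R \<subseteq> carrier G" "\<And>x. x \<in> B \<Longrightarrow> \<exists>r\<in>R. inv r \<otimes> x \<in> A"
    using assms(1) unfolding finite_index_in_def by blast
  obtain S where S: "finite S" "S \<subseteq> carrier G" "\<And>x. x \<in> C \<Longrightarrow> \<exists>r\<in>S. inv r \<otimes> x \<in> B"
    using assms(2) unfolding finite_index_in_def by blast
  have "\<exists>q\<in>(\<lambda>(s, r). s \<otimes> r) ` (S \<times> R). inv q \<otimes> x \<in> A" if x: "x \<in> C" for x
  proof -
    obtain s where s: "s \<in> S" "inv s \<otimes> x \<in> B" using S x by blast
    obtain r where r: "r \<in> R" "inv r \<otimes> (inv s \<otimes> x) \<in> A" using R s by blast
    have "inv (s \<otimes> r) \<otimes> x = inv r \<otimes> (inv s \<otimes> x)"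
      using s r S R x assms by (simp add: group_word subset_iff)
    then show ?thesis using s r by force
  qed
  moreover have "finite ((\<lambda>(s, r). s \<otimes> r) ` (S \<times> R))" "(\<lambda>(s, r). s \<otimes> r) ` (S \<times> R) \<subseteq> carrier G"
    using R S by auto
  ultimately show ?thesis unfolding finite_index_in_def by blast
qed

lemma finite_index_in_subset:
  "finite_index_in A B \<Longrightarrow> A \<subseteq> A' \<Longrightarrow> B' \<subseteq> B \<Longrightarrow> finite_index_in A' B'"
  unfolding finite_index_in_def by (meson subsetD)

text \<open>A representative of \<open>K\<close> in \<open>H\<close> need not lie in
  \<open>L\<close>; it is replaced by an element of \<open>L\<close> in the same coset. Two elements
  of \<open>L\<close> in one coset differ by an element of \<open>L \<inter> K\<close>.\<close>

lemma finite_index_in_Int: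
  assumes "finite_index_in K H" "L \<subseteq> H" "subgroup L G" "subgroup K G"
  shows "finite_index_in (L \<inter> K) L"
proof -
  obtain R where R: "finite R" "R \<subseteq> carrier G" "\<And>x. x \<in> L \<Longrightarrow> \<exists>r\<in>R. inv r \<otimes> x \<in> K"
    using assms unfolding finite_index_in_def by (meson subsetD)
  define f where "f r = (SOME x. x \<in> L \<and> inv r \<otimes> x \<in> K)" for r
  have "\<exists>r\<in>f ` R \<inter> L. inv r \<otimes> x \<in> L \<inter> K" if x: "x \<in> L" for x
  proof -
    obtain r where r: "r \<in> R" "inv r \<otimes> x \<in> K" using R x by blast
    have f: "f r \<in> L" "inv r \<otimes> f r \<in> K" unfolding f_def using someI_ex[of "\<lambda>x. x \<in> L \<and> inv r \<otimes> x \<in> K"] x r by blast+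
    have c: "x \<in> carrier G" "r \<in> carrier G" "f r \<in> carrier G"
      using x r R f assms subgroup.subset by blast+
    have "inv (f r) \<otimes> x = inv (inv r \<otimes> f r) \<otimes> (inv r \<otimes> x)" using c by (simp add: group_word)
    moreover have "\<dots> \<in> K" using f r assms(4) by (meson subgroup.m_closed subgroup.m_inv_closed)
    moreover have "inv (f r) \<otimes> x \<in> L" using f x assms(3) by (meson subgroup.m_closed subgroup.m_inv_closed)
    ultimately have "inv (f r) \<otimes> x \<in> L \<inter> K" by simp
    then show ?thesis using f(1) r(1) by blast
  qed
  moreover have "f ` R \<inter> L \<subseteq> carrier G" using assms subgroup.subset by blast
  ultimately show ?thesis unfolding finite_index_in_def using R(1) by (metis finite_Int finite_imageI)
qed

text \<open>No step is lost: if \<open>A \<inter> K\<close> had finite index in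
  \<open>B \<inter> K\<close>, it would have finite index in \<open>B\<close>, since
  \<open>B \<inter> K\<close> has; so would the larger \<open>A\<close>.\<close>

lemma subgroup_chain_Int_finite_index:
  assumes "subgroup_chain L n" "L \<subseteq> H" "finite_index_in K H" "subgroup K G"
  shows "subgroup_chain (L \<inter> K) n"
  using assms(1,2)
proof (induction rule: subgroup_chain.induct)
  case trivial
  have "{\<one>} \<inter> K = {\<one>}" using assms(4) subgroup.one_closed by blast
  then show ?case by (simp add: subgroup_chain.trivial)
next
  case (weak A n B)
  then have "subgroup_chain (A \<inter> K) n" by auto
  then show ?case using subgroup_chain.weak weak assms(4) subgroups_Inter_pair by (metis Int_mono order_refl)
next
  case (strict A n B)
  have A: "subgroup A G" using strict(1) subgroup_chain_subgroup by blast
  have "subgroup_chain (A \<inter> K) n" using strict by auto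
  moreover have "subgroup (B \<inter> K) G" using strict assms(4) subgroups_Inter_pair by blast
  moreover have "\<not> finite_index_in (A \<inter> K) (B \<inter> K)"
  proof
    assume "finite_index_in (A \<inter> K) (B \<inter> K)"
    moreover have "finite_index_in (B \<inter> K) B"
      using finite_index_in_Int[OF assms(3) strict.prems strict(3) assms(4)] .
    ultimately have "finite_index_in (A \<inter> K) B"
      using finite_index_in_trans A strict(3) subgroup.subset by (meson inf.coboundedI1)
    then show False using strict(4) finite_index_in_subset by blast
  qed
  ultimately show ?case using subgroup_chain.strict[of "A \<inter> K" n "B \<inter> K"] strict(2) by blast
qed

text \<open>The relation \<open>x \<in> c^s K\<close> between elements and exponents is additive. It
  is kept as a relation because the exponent is not unique when \<open>H / K\<close> is
  finite.\<close>

lemma subnormal_int_pow_hom: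
  fixes s t :: int
  assumes H: "subgroup H G" and K: "K \<lhd> (G\<lparr>carrier := H\<rparr>)" and c: "c \<in> H"
    and x: "x \<in> H" "inv (c [^] s) \<otimes> x \<in> K"
  shows "\<lbrakk>y \<in> H; inv (c [^] t) \<otimes> y \<in> K\<rbrakk> \<Longrightarrow> inv (c [^] (s + t)) \<otimes> (x \<otimes> y) \<in> K"
    and "inv (c [^] (- s)) \<otimes> inv x \<in> K"
proof -
  interpret K: normal K "G\<lparr>carrier := H\<rparr>" by fact
  have Hc: "H \<subseteq> carrier G" using H subgroup.subset by blast
  have KG: "subgroup K G" using incl_subgroup[OF H K.subgroup_axioms] .
  have inv_eq: "inv\<^bsub>G\<lparr>carrier := H\<rparr>\<^esub> x = inv x" if "x \<in> H" for x
    using m_inv_consistent[OF H that] .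
  have conj1: "inv x \<otimes> k \<otimes> x \<in> K" if "x \<in> H" "k \<in> K" for x k
    using K.inv_op_closed1[of x k] that inv_eq by simp
  have conj2: "x \<otimes> k \<otimes> inv x \<in> K" if "x \<in> H" "k \<in> K" for x k
    using K.inv_op_closed2[of x k] that inv_eq by simp
  have pow: "c [^] i \<in> carrier G" "c [^] i \<in> H" for i :: int
    using subgroup_int_pow_closed[OF H c] Hc by auto
  have cc: "c \<in> carrier G" using c Hc by blast
  have "inv (c [^] (- s)) \<otimes> inv x = c [^] s \<otimes> inv (inv (c [^] s) \<otimes> x) \<otimes> inv (c [^] s)"
    using x pow Hc by (simp add: int_pow_neg cc group_word subset_iff)
  then show "inv (c [^] (- s)) \<otimes> inv x \<in> K"
    using conj2[OF pow(2)[of s]] x(2) KG subgroup.m_inv_closed by metis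
  assume y: "y \<in> H" "inv (c [^] t) \<otimes> y \<in> K"
  have "inv (c [^] (s + t)) \<otimes> (x \<otimes> y) =
      (inv (c [^] t) \<otimes> (inv (c [^] s) \<otimes> x) \<otimes> c [^] t) \<otimes> (inv (c [^] t) \<otimes> y)"
    using x y pow Hc by (simp add: int_pow_mult cc group_word subset_iff)
  then show "inv (c [^] (s + t)) \<otimes> (x \<otimes> y) \<in> K"
    using conj1[OF pow(2) x(2)] y(2) KG subgroup.m_closed by metis
qed

text \<open>A cyclic quotient absorbs at most one step of infinite index. While the lower group
  \<open>A\<close> stays inside \<open>K\<close>, its chain survives entirely. Once \<open>A\<close>
  contains some \<open>a\<close> outside \<open>K\<close>, the exponents of \<open>A\<close> have
  finite index in the integers, so if \<open>A\<close> had finite index in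
  \<open>B \<inter> K\<close>, it would have finite index in \<open>B\<close>.\<close>

lemma subgroup_chain_Int_cyclic:
  assumes "subgroup_chain L n" "L \<subseteq> H" "subgroup H G" "K \<lhd> (G\<lparr>carrier := H\<rparr>)"
    and c: "c \<in> H" "\<And>x. x \<in> H \<Longrightarrow> \<exists>t::int. inv (c [^] t) \<otimes> x \<in> K"
  shows "subgroup_chain (L \<inter> K) (n - 1)"
proof -
  have Hc: "H \<subseteq> carrier G" using assms(3) subgroup.subset by blast
  have KG: "subgroup K G" using incl_subgroup[OF assms(3) normal_imp_subgroup[OF assms(4)]] .
  note hom = subnormal_int_pow_hom(1)[OF assms(3,4) c(1)]
  note hom_inv = subnormal_int_pow_hom(2)[OF assms(3,4) c(1)]
  have cc: "c \<in> carrier G" using c Hc by blast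
  define h where "h x = (SOME t::int. inv (c [^] t) \<otimes> x \<in> K)" for x
  have h: "inv (c [^] h x) \<otimes> x \<in> K" if "x \<in> H" for x
    unfolding h_def using someI_ex[OF c(2)[OF that]] .
  show "subgroup_chain (L \<inter> K) (n - 1)"
    using assms(1,2)
  proof (induction rule: subgroup_chain.induct)
    case trivial
    have "{\<one>} \<inter> K = {\<one>}" using KG subgroup.one_closed by blast
    then show ?case by (simp add: subgroup_chain.trivial)
  next
    case (weak A n B)
    then have "subgroup_chain (A \<inter> K) (n - 1)" by auto
    then show ?case using subgroup_chain.weak weak KG subgroups_Inter_pair by (metis Int_mono order_refl)
  next
    case (strict A n B)
    have A: "subgroup A G" using strict(1) subgroup_chain_subgroup by blast
    have BK: "subgroup (B \<inter> K) G" using strict KG subgroups_Inter_pair by blast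
    show ?case
    proof (cases "A \<subseteq> K")
      \<comment> \<open>The chain of \<open>A\<close> keeps its full length inside
        \<open>B \<inter> K\<close>; only the present step is given up.\<close>
      case True
      then have "subgroup_chain A n" "A \<subseteq> B \<inter> K" using strict by auto
      then show ?thesis using subgroup_chain.weak BK by simp
    next
      case False
      then obtain a where a: "a \<in> A" "a \<notin> K" by blast
      have aH: "a \<in> H" using a strict by blast
      then have ac: "a \<in> carrier G" using Hc by blast
      define m where "m = h a"
      have sub_pow: "x [^] t \<in> H" if "x \<in> H" for x and t :: int
        using subgroup_int_pow_closed[OF assms(3) that] .
      \<comment> \<open>Exponent 0 would put \<open>a\<close> into \<open>K\<close>.\<close>
      have "m \<noteq> 0" using h[OF aH] a(2) ac unfolding m_def by (auto simp: m_def)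
      have pow_nat: "inv (c [^] (int k * m)) \<otimes> a [^] int k \<in> K" for k
      proof (induction k)
        case 0
        then show ?case using KG subgroup.one_closed by simp
      next
        case (Suc k)
        have "inv (c [^] (int k * m + m)) \<otimes> (a [^] int k \<otimes> a) \<in> K"
          using hom[OF sub_pow[OF aH] Suc aH h[OF aH, folded m_def]] .
        moreover have "a [^] int (Suc k) = a [^] int k \<otimes> a"
          using int_pow_mult[OF ac, of "int k" 1] ac by (simp add: add.commute)
        moreover have "int (Suc k) * m = int k * m + m" by (simp add: algebra_simps)
        ultimately show ?case by simp
      qed
      have pow: "inv (c [^] (k * m)) \<otimes> a [^] k \<in> K" for k :: int
      proof (cases "k \<ge> 0")
        case True
        then show ?thesis using pow_nat[of "nat k"] by simp
      next
        case False
        have "inv (c [^] (- (int (nat (- k)) * m))) \<otimes> inv (a [^] int (nat (- k))) \<in> K"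
          using hom_inv[OF sub_pow[OF aH] pow_nat] .
        moreover have "inv (a [^] int (nat (- k))) = a [^] k"
          using False int_pow_neg[OF ac, of "- k"] by simp
        ultimately show ?thesis using False by simp
      qed
      have "subgroup_chain (A \<inter> K) (n - 1)" using strict by auto
      moreover have "\<not> finite_index_in (A \<inter> K) (B \<inter> K)"
      proof
        assume "finite_index_in (A \<inter> K) (B \<inter> K)"
        then have "finite_index_in A (B \<inter> K)" by (rule finite_index_in_subset) auto
        moreover have "finite_index_in A B"
        proof -
          obtain R where R: "finite R" "R \<subseteq> carrier G" "\<And>x. x \<in> B \<inter> K \<Longrightarrow> \<exists>r\<in>R. inv r \<otimes> x \<in> A"
            using calculation(1) unfolding finite_index_in_def by blast
          \<comment> \<open>One element of \<open>B\<close> for each residue of the exponent modulo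
            \<open>\<bar>m\<bar>\<close>. For a residue that does not occur the value is arbitrary,
            hence the intersection with \<open>carrier G\<close> below.\<close>
          define g where "g i = (SOME x. x \<in> B \<and> h x mod \<bar>m\<bar> = i)" for i
          let ?I = "{0..<\<bar>m\<bar>}"
          have "\<exists>q\<in>(\<lambda>(i, r). g i \<otimes> r) ` (?I \<times> R) \<inter> carrier G. inv q \<otimes> x \<in> A" if x: "x \<in> B" for x
          proof -
            define i where "i = h x mod \<bar>m\<bar>"
            have i: "i \<in> ?I" using \<open>m \<noteq> 0\<close> by (simp add: i_def)
            have g: "g i \<in> B" "h (g i) mod \<bar>m\<bar> = i"
              using someI[of "\<lambda>x. x \<in> B \<and> h x mod \<bar>m\<bar> = i" x] x unfolding g_def i_def by blast+
            have "m dvd h x - h (g i)"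
              using g(2) unfolding i_def by (metis abs_dvd_iff mod_eq_dvd_iff)
            then obtain k where k: "h x - h (g i) = k * m" by (metis dvd_def mult.commute)
            have xH: "x \<in> H" and gH: "g i \<in> H" using x g strict by auto
            have "inv (c [^] (- h (g i) + h x)) \<otimes> (inv (g i) \<otimes> x) \<in> K"
              using hom[OF _ hom_inv[OF gH h[OF gH]] xH h[OF xH]] gH assms(3) subgroup.m_inv_closed by metis
            then have 1: "inv (c [^] (k * m)) \<otimes> (inv (g i) \<otimes> x) \<in> K" using k by (simp add: algebra_simps)
            \<comment> \<open>Multiplication by \<open>a^-k\<close> cancels the exponent
              \<open>k m\<close>, so the product lies in \<open>B \<inter> K\<close>, where the
              representatives from \<open>R\<close> apply.\<close>
            have 2: "inv (c [^] (k * m + - k * m)) \<otimes> ((inv (g i) \<otimes> x) \<otimes> a [^] (- k)) \<in> K"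
              using hom[OF _ 1 sub_pow[OF aH] pow[of "- k"]] xH gH assms(3)
              by (meson subgroup.m_inv_closed subgroup.m_closed)
            let ?y = "inv (g i) \<otimes> x \<otimes> a [^] (- k)"
            have c1: "x \<in> carrier G" "g i \<in> carrier G" using xH gH Hc by auto
            have akA: "a [^] k \<in> A" "a [^] (- k) \<in> A" using subgroup_int_pow_closed[OF A a(1)] by auto
            have "?y \<in> B" using strict(2,3) akA x g by (meson subgroup.m_closed subgroup.m_inv_closed subsetD)
            moreover have "?y \<in> K" using 2 c1 ac by simp
            ultimately obtain r where r: "r \<in> R" "inv r \<otimes> ?y \<in> A" using R by blast
            have rc: "r \<in> carrier G" using r R by blast
            have "inv (g i \<otimes> r) \<otimes> x = inv r \<otimes> ?y \<otimes> a [^] k"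
              using c1 rc ac by (simp add: int_pow_neg group_word)
            moreover have "inv r \<otimes> ?y \<otimes> a [^] k \<in> A" using r(2) akA(1) A subgroup.m_closed by metis
            ultimately show ?thesis using i r c1 rc by (intro bexI[of _ "g i \<otimes> r"]) auto
          qed
          then show ?thesis unfolding finite_index_in_def using R(1)
            by (intro exI[of _ "(\<lambda>(i, r). g i \<otimes> r) ` (?I \<times> R) \<inter> carrier G"]) auto
        qed
        ultimately show False using strict(4) by blast
      qed
      ultimately have "subgroup_chain (B \<inter> K) (Suc (n - 1))"
        using subgroup_chain.strict[of "A \<inter> K" "n - 1" "B \<inter> K"] strict(2) BK by blast
      then show ?thesis using subgroup_chain_mono by simp
    qed
  qed
qed

text \<open>Induct along the series and intersect the chain with the next smaller group: a finite
  factor costs no step of infinite index, an infinite cyclic one at most one.\<close>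

lemma polycyclic_series_bounds_subgroup_chain:
  assumes "polycyclic_series G H m"
  shows "subgroup_chain H n \<Longrightarrow> n \<le> m"
  using assms
proof (induction arbitrary: n rule: polycyclic_series.induct)
  case trivial
  have "H = {\<one>} \<longrightarrow> n = 0" if "subgroup_chain H n" for H n
    using that
  proof (induction rule: subgroup_chain.induct)
    case (weak K n H)
    then show ?case using subgroup_chain_subgroup[OF weak(1)] subgroup.one_closed by blast
  next
    case (strict K n H)
    have "\<one> \<in> K" using subgroup_chain_subgroup[OF strict(1)] subgroup.one_closed by blast
    then have "finite_index_in K {\<one>}" unfolding finite_index_in_def by (intro exI[of _ "{\<one>}"]) simp
    then show ?case using strict by blast
  qed simp
  then show ?case using trivial by blast
next
  case (finite_factor K m H)
  have K: "K \<subseteq> H" using normal_imp_subgroup[OF finite_factor(3)] subgroup.subset by fastforce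
  have "subgroup_chain (H \<inter> K) n"
    using subgroup_chain_Int_finite_index[OF finite_factor(7) order_refl]
      finite_index_in_iff_finite_quotient[OF finite_factor(2,3)] finite_factor(5)
      incl_subgroup[OF finite_factor(2) normal_imp_subgroup[OF finite_factor(3)]] by blast
  then show ?case using finite_factor.IH K by (metis inf.absorb2)
next
  case (infinite_factor K m H)
  have K: "K \<subseteq> H" using normal_imp_subgroup[OF infinite_factor(3)] subgroup.subset by fastforce
  obtain c where "c \<in> H" "\<And>x. x \<in> H \<Longrightarrow> \<exists>t::int. inv (c [^] t) \<otimes> x \<in> K"
    using infinite_factor(4) cyclic_quotient_iff[OF infinite_factor(2,3)] by blast
  then have "subgroup_chain (H \<inter> K) (n - 1)"
    using subgroup_chain_Int_cyclic[OF infinite_factor(7) order_refl infinite_factor(2,3)] by blast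
  then have "n - 1 \<le> m" using infinite_factor.IH K by (metis inf.absorb2)
  then show ?case by simp
qed

text \<open>The central chain is itself a chain of subgroups with \<open>n\<close> infinite steps,
  so no polycyclic series has fewer than \<open>n\<close> infinite factors. Read as a series, it
  also shows that \<open>LEAST\<close> ranges over a non-empty set.\<close>

lemma central_chain_le_hirsch_length:
  assumes "central_chain {\<one>} n"
  shows "n \<le> hirsch_length G"
proof -
  have "polycyclic_series G (carrier G) (0 + n)"
    using central_chain_imp_polycyclic_series[OF assms polycyclic_series.trivial] .
  then have "polycyclic_series G (carrier G) (hirsch_length G)"
    unfolding hirsch_length_def by (rule LeastI)
  moreover have "subgroup_chain (carrier G) (0 + n)"
    using central_chain_imp_subgroup_chain[OF assms subgroup_chain.trivial] .
  ultimately show ?thesis using polycyclic_series_bounds_subgroup_chain by fastforce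
qed

end

section \<open>Almost invariant functions on nilpotent groups\<close>

text \<open>Half-width \<open>n\<close> with ramps of width \<open>q\<close>; a large
  \<open>q\<close> makes the function nearly invariant under bounded shifts.\<close>

definition trapezoid :: "real \<Rightarrow> real \<Rightarrow> real \<Rightarrow> real" where
  "trapezoid n q t = max 0 (min 1 ((n - \<bar>t\<bar>) / q))"

lemma trapezoid_range: "0 \<le> trapezoid n q t" "trapezoid n q t \<le> 1"
  by (auto simp: trapezoid_def)

lemma trapezoid_support: "q > 0 \<Longrightarrow> trapezoid n q t \<noteq> 0 \<Longrightarrow> \<bar>t\<bar> < n"
  by (auto simp: trapezoid_def max_def min_def divide_simps split: if_splits)

lemma trapezoid_eq_1: "q > 0 \<Longrightarrow> \<bar>t\<bar> \<le> n - q \<Longrightarrow> trapezoid n q t = 1"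
  by (auto simp: trapezoid_def max_def min_def divide_simps)

lemma trapezoid_lipschitz:
  assumes "q > 0"
  shows "\<bar>trapezoid n q s - trapezoid n q t\<bar> \<le> \<bar>s - t\<bar> / q"
proof -
  have "\<bar>(n - \<bar>s\<bar>) / q - (n - \<bar>t\<bar>) / q\<bar> = \<bar>\<bar>t\<bar> - \<bar>s\<bar>\<bar> / q"
    using assms by (simp add: diff_divide_distrib[symmetric])
  also have "\<dots> \<le> \<bar>s - t\<bar> / q"
    using assms by (intro divide_right_mono) auto
  finally show ?thesis unfolding trapezoid_def by linarith
qed

text \<open>Three trapezoids of half-width \<open>n = 3 q + r\<close> and centres \<open>- p, 0, p\<close>, where \<open>p = 4 q + 2 r\<close>,
  have plateaus covering the interval of half-width \<open>2 n + r\<close>.\<close>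

lemma trapezoids_cover:
  fixes q r t :: real
  assumes "q > 0" "r \<ge> 0" "\<bar>t\<bar> \<le> 2 * (3 * q + r) + r"
  shows "\<exists>b<3::nat. trapezoid (3 * q + r) q (t - (real b - 1) * (4 * q + 2 * r)) = 1"
proof -
  \<comment> \<open>The plateaus have half-width \<open>2 q + r\<close>, half of the spacing, so
    they abut; the outermost point is \<open>(4 q + 2 r) + (2 q + r) = 2 (3 q + r) + r\<close>. This
    is how the spacing and the half-width are matched.\<close>
  let ?P = "\<lambda>b::nat. \<bar>t - (real b - 1) * (4 * q + 2 * r)\<bar> \<le> (3 * q + r) - q"
  have "?P 0 \<or> ?P 1 \<or> ?P 2" using assms by (auto simp: abs_if split: if_splits)
  then obtain b where "b < (3::nat)" "?P b"
    by (metis less_numeral_extra(1) one_less_numeral_iff semiring_norm(77) zero_less_numeral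
        numeral_less_iff semiring_norm(80) lessI numeral_2_eq_2 numeral_3_eq_3)
  then show ?thesis using trapezoid_eq_1[OF assms(1)] by blast
qed

lemma finite_bounded_int:
  fixes f :: "'b \<Rightarrow> int"
  assumes "finite A"
  shows "\<exists>B\<ge>0. \<forall>a\<in>A. \<bar>f a\<bar> \<le> B"
proof (intro exI conjI ballI)
  show "(\<Sum>a\<in>A. \<bar>f a\<bar>) \<ge> 0" by (simp add: sum_nonneg)
  show "\<bar>f a\<bar> \<le> (\<Sum>a\<in>A. \<bar>f a\<bar>)" if "a \<in> A" for a
    using assms that by (intro member_le_sum) auto
qed

section \<open>Towers over the quotients of a central chain\<close>

context group
begin

text \<open>Only \<open>N\<close>-invariant functions are considered: they live on \<open>G / N\<close>, where their supports
  are finite.\<close>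

definition tower_family :: "'a set \<Rightarrow> nat \<Rightarrow> 'a set \<Rightarrow> real \<Rightarrow> (nat \<Rightarrow> 'a \<Rightarrow> real) \<Rightarrow> bool" where
  "tower_family N m K \<epsilon> \<phi> \<longleftrightarrow>
     (\<forall>j<m. \<forall>g\<in>carrier G. 0 \<le> \<phi> j g \<and> \<phi> j g \<le> 1) \<and>
     (\<forall>j<m. \<forall>g\<in>carrier G. \<forall>n\<in>N. \<phi> j (g \<otimes> n) = \<phi> j g) \<and>
     (\<exists>R. finite R \<and> R \<subseteq> carrier G \<and>
        (\<forall>j<m. \<forall>g\<in>carrier G. \<phi> j g \<noteq> 0 \<longrightarrow> (\<exists>r\<in>R. inv r \<otimes> g \<in> N))) \<and>
     (\<forall>j<m. \<forall>k\<in>K. \<forall>g\<in>carrier G. \<bar>\<phi> j (k \<otimes> g) - \<phi> j g\<bar> \<le> \<epsilon>) \<and>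
     1 \<le> (\<Sum>j<m. \<phi> j \<one>) \<and>
     (\<forall>j<m. \<forall>g\<in>carrier G. \<forall>h\<in>carrier G. \<phi> j g \<noteq> 0 \<and> \<phi> j h \<noteq> 0 \<longrightarrow>
        1 \<le> (\<Sum>i<m. \<phi> i (inv g \<otimes> h)))"

text \<open>\<open>m\<close> is fixed in advance, whereas the supports may depend on
  \<open>K\<close> and \<open>\<epsilon>\<close>.\<close>

definition has_towers :: "'a set \<Rightarrow> nat \<Rightarrow> bool" where
  "has_towers N m \<longleftrightarrow> (\<forall>K \<epsilon>. finite K \<and> K \<subseteq> carrier G \<and> \<epsilon> > 0 \<longrightarrow> (\<exists>\<phi>. tower_family N m K \<epsilon> \<phi>))"

lemma tower_family_finite_support:
  assumes "tower_family N m K \<epsilon> \<phi>"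
  obtains R where "finite R" "R \<subseteq> carrier G"
    "\<And>j g. \<lbrakk>j < m; g \<in> carrier G; \<phi> j g \<noteq> 0\<rbrakk> \<Longrightarrow> \<exists>r\<in>R. inv r \<otimes> g \<in> N"
proof -
  have "\<exists>R. finite R \<and> R \<subseteq> carrier G \<and>
      (\<forall>j<m. \<forall>g\<in>carrier G. \<phi> j g \<noteq> 0 \<longrightarrow> (\<exists>r\<in>R. inv r \<otimes> g \<in> N))"
    using assms by (simp add: tower_family_def)
  then show ?thesis using that by blast
qed

lemma has_towers_carrier: "has_towers (carrier G) 1"
proof -
  have "tower_family (carrier G) 1 K \<epsilon> (\<lambda>_ _. 1)" if "\<epsilon> > 0" for K \<epsilon>
    unfolding tower_family_def using that by (auto intro!: exI[of _ "{\<one>}"])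
  then show ?thesis unfolding has_towers_def by blast
qed

text \<open>The same functions serve: invariance under \<open>H\<close> is stronger than under
  \<open>N\<close>, and a support that is finite over \<open>H\<close> stays finite over
  \<open>N\<close> because the index is finite.\<close>

lemma has_towers_finite_step:
  assumes "has_towers H m" "N \<subseteq> H" "finite_index_in N H" "N \<subseteq> carrier G"
  shows "has_towers N m"
proof -
  obtain S where S: "finite S" "S \<subseteq> carrier G" "\<And>x. x \<in> H \<Longrightarrow> \<exists>r\<in>S. inv r \<otimes> x \<in> N"
    using assms(3) unfolding finite_index_in_def by metis
  have "tower_family N m K \<epsilon> \<phi>" if tf: "tower_family H m K \<epsilon> \<phi>" for K \<epsilon> \<phi>
  proof -
    obtain R where R: "finite R" "R \<subseteq> carrier G"
      "\<And>j g. \<lbrakk>j < m; g \<in> carrier G; \<phi> j g \<noteq> 0\<rbrakk> \<Longrightarrow> \<exists>r\<in>R. inv r \<otimes> g \<in> H"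
      using tower_family_finite_support[OF tf] by blast
    have "\<exists>q\<in>(\<lambda>(r, s). r \<otimes> s) ` (R \<times> S). inv q \<otimes> g \<in> N"
      if j: "j < m" "g \<in> carrier G" "\<phi> j g \<noteq> 0" for j g
    proof -
      obtain r where r: "r \<in> R" "inv r \<otimes> g \<in> H" using R(3)[OF j] by blast
      obtain s where s: "s \<in> S" "inv s \<otimes> (inv r \<otimes> g) \<in> N" using S(3)[OF r(2)] by blast
      have "inv (r \<otimes> s) \<otimes> g = inv s \<otimes> (inv r \<otimes> g)"
        using r s R S j by (simp add: group_word subset_iff)
      then have "inv (r \<otimes> s) \<otimes> g \<in> N" using s by simp
      then show ?thesis using r(1) s(1) by force
    qed
    moreover have "finite ((\<lambda>(r, s). r \<otimes> s) ` (R \<times> S))" "(\<lambda>(r, s). r \<otimes> s) ` (R \<times> S) \<subseteq> carrier G"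
      using R S by auto
    ultimately have "\<exists>R. finite R \<and> R \<subseteq> carrier G \<and>
        (\<forall>j<m. \<forall>g\<in>carrier G. \<phi> j g \<noteq> 0 \<longrightarrow> (\<exists>r\<in>R. inv r \<otimes> g \<in> N))" by meson
    then show ?thesis using tf assms(2) unfolding tower_family_def by (simp add: subset_iff)
  qed
  then show ?thesis using assms(1) unfolding has_towers_def by meson
qed

text \<open>As \<open>H / N\<close> is infinite cyclic, \<open>h\<close> is the quotient map to the
  integers. \<open>\<tau>\<close> extends it to \<open>G\<close> by measuring height from a chosen
  point of each coset of \<open>H\<close>, so it is additive only for right translation by
  \<open>H\<close>. Invariance of \<open>h\<close> under conjugation expresses that
  \<open>H / N\<close> is central.\<close>

lemma central_step_height:
  assumes "central_step H N" "\<not> finite_index_in N H"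
  obtains c \<tau> h where "c \<in> H" "c \<in> carrier G" "\<And>x. x \<in> H \<Longrightarrow> inv (c [^] (h x :: int)) \<otimes> x \<in> N"
    "\<And>g x. \<lbrakk>g \<in> carrier G; x \<in> H\<rbrakk> \<Longrightarrow> \<tau> (g \<otimes> x) = \<tau> g + h x"
    "\<And>x. x \<in> N \<Longrightarrow> h x = 0"
    "\<And>x. x \<in> H \<Longrightarrow> h (inv x) = - h x"
    "\<And>x w. \<lbrakk>x \<in> H; w \<in> carrier G\<rbrakk> \<Longrightarrow> h (inv w \<otimes> x \<otimes> w) = h x"
proof -
  note H = central_step_subnormal[OF assms(1)]
  obtain c where c: "c \<in> H" "\<And>x. x \<in> H \<Longrightarrow> \<exists>t::int. inv (c [^] t) \<otimes> x \<in> N" "c \<in> centre_mod N"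
    using assms(1) unfolding central_step_def by metis
  have Hn: "H \<lhd> G" and Nn: "N \<lhd> G" and NH: "N \<subseteq> H" using assms(1) unfolding central_step_def by auto
  have Hc: "H \<subseteq> carrier G" using H(1) subgroup.subset by blast
  have N: "subgroup N G" using Nn normal_imp_subgroup by blast
  have cc: "c \<in> carrier G" using c(1) Hc by blast
  \<comment> \<open>If a non-trivial power of \<open>c\<close> were in \<open>N\<close>, the powers
    below it would represent all of \<open>H / N\<close>.\<close>
  have pow0: "t = 0" if t: "c [^] t \<in> N" for t :: int
  proof (rule ccontr)
    assume t0: "t \<noteq> 0"
    define s where "s = \<bar>t\<bar>"
    have s: "s > 0" using t0 by (simp add: s_def)
    have cs: "c [^] s \<in> N"
      using t subgroup.m_inv_closed[OF N t] cc by (cases "t \<ge> 0") (simp_all add: s_def int_pow_neg)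
    have "\<exists>r\<in>(\<lambda>i. c [^] i) ` {0..<s}. inv r \<otimes> x \<in> N" if x: "x \<in> H" for x
    proof -
      obtain u :: int where u: "inv (c [^] u) \<otimes> x \<in> N" using c(2)[OF x] by blast
      have "(c [^] s) [^] (u div s) \<in> N" using subgroup_int_pow_closed[OF N cs] .
      then have p: "c [^] (s * (u div s)) \<in> N" using cc int_pow_pow by metis
      have "c [^] u = c [^] (u mod s) \<otimes> c [^] (s * (u div s))"
        using int_pow_mult[OF cc, of "u mod s" "s * (u div s)"] by simp
      then have "inv (c [^] (u mod s)) \<otimes> x = c [^] (s * (u div s)) \<otimes> (inv (c [^] u) \<otimes> x)"
        using cc x Hc by (simp add: group_word subset_iff)
      then have "inv (c [^] (u mod s)) \<otimes> x \<in> N" using p u subgroup.m_closed[OF N] by metis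
      then show ?thesis using s by force
    qed
    then have "finite_index_in N H" unfolding finite_index_in_def using cc
      by (intro exI[of _ "(\<lambda>i. c [^] i) ` {0..<s}"]) auto
    with assms(2) show False by blast
  qed
  define h where "h x = (SOME t::int. inv (c [^] t) \<otimes> x \<in> N)" for x
  have h: "inv (c [^] h x) \<otimes> x \<in> N" if "x \<in> H" for x
    unfolding h_def using someI_ex[OF c(2)[OF that]] .
  have uniq: "h x = t" if x: "x \<in> H" and t: "inv (c [^] t) \<otimes> x \<in> N" for x t
  proof -
    have "c [^] (- h x + t) = inv (c [^] h x) \<otimes> x \<otimes> inv (inv (c [^] t) \<otimes> x)"
      unfolding int_pow_mult[OF cc] int_pow_neg[OF cc] using x Hc cc by (simp add: group_word subset_iff)
    also have "\<dots> \<in> N"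
      using h[OF x] t subgroup.m_closed[OF N] subgroup.m_inv_closed[OF N] by blast
    finally show ?thesis using pow0 by fastforce
  qed
  have hmult: "h (x \<otimes> y) = h x + h y" if "x \<in> H" "y \<in> H" for x y
    using uniq subnormal_int_pow_hom(1)[OF H(1,2) c(1) that(1) h[OF that(1)] that(2) h[OF that(2)]]
      that subgroup.m_closed[OF H(1)] by blast
  have hinv: "h (inv x) = - h x" if "x \<in> H" for x
    using uniq subnormal_int_pow_hom(2)[OF H(1,2) c(1) that h[OF that]]
      that subgroup.m_inv_closed[OF H(1)] by blast
  have hN: "h x = 0" if "x \<in> N" for x
  proof -
    have "x \<in> carrier G" "x \<in> H" using that NH Hc by auto
    then show ?thesis using uniq[of x 0] that by simp
  qed
  have HZ: "H \<subseteq> centre_mod N"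
  proof
    fix x assume x: "x \<in> H"
    have "x = c [^] h x \<otimes> (inv (c [^] h x) \<otimes> x)" using x Hc cc by (simp add: group_word subset_iff)
    moreover have "c [^] h x \<in> centre_mod N" using subgroup_int_pow_closed[OF subgroup_centre_mod[OF Nn] c(3)] .
    moreover have "inv (c [^] h x) \<otimes> x \<in> centre_mod N" using h[OF x] subset_centre_mod[OF Nn] by blast
    ultimately show "x \<in> centre_mod N" using subgroup.m_closed[OF subgroup_centre_mod[OF Nn]] by metis
  qed
  have hconj: "h (inv w \<otimes> x \<otimes> w) = h x" if x: "x \<in> H" and w: "w \<in> carrier G" for x w
  proof -
    have "inv w \<otimes> x \<otimes> inv (inv w) \<otimes> inv x \<in> N" using x HZ w unfolding centre_mod_def by blast
    then have n: "inv w \<otimes> x \<otimes> w \<otimes> inv x \<in> N" using w by simp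
    have xc: "x \<in> carrier G" using x Hc by blast
    have "inv w \<otimes> x \<otimes> w = (inv w \<otimes> x \<otimes> w \<otimes> inv x) \<otimes> x" using xc w by (simp add: group_word)
    then have "h (inv w \<otimes> x \<otimes> w) = h (inv w \<otimes> x \<otimes> w \<otimes> inv x) + h x" using hmult n NH x by (metis subsetD)
    then show ?thesis using hN[OF n] by simp
  qed
  \<comment> \<open>The choice has to depend on the coset of \<open>g\<close> alone; it does,
    because the defining predicates for \<open>g\<close> and \<open>g \<otimes> x\<close> with
    \<open>x \<in> H\<close> coincide.\<close>
  define \<rho> where "\<rho> g = (SOME r. r \<in> carrier G \<and> inv r \<otimes> g \<in> H)" for g
  have \<rho>: "\<rho> g \<in> carrier G" "inv (\<rho> g) \<otimes> g \<in> H" if "g \<in> carrier G" for g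
  proof -
    have "g \<in> carrier G \<and> inv g \<otimes> g \<in> H" using that subgroup.one_closed[OF H(1)] by simp
    then show "\<rho> g \<in> carrier G" "inv (\<rho> g) \<otimes> g \<in> H"
      unfolding \<rho>_def using someI[of "\<lambda>r. r \<in> carrier G \<and> inv r \<otimes> g \<in> H" g] by blast+
  qed
  have \<rho>_cong: "\<rho> (g \<otimes> x) = \<rho> g" if g: "g \<in> carrier G" and x: "x \<in> H" for g x
  proof -
    have "inv r \<otimes> (g \<otimes> x) \<in> H \<longleftrightarrow> inv r \<otimes> g \<in> H" if r: "r \<in> carrier G" for r
    proof -
      have xc: "x \<in> carrier G" using x Hc by blast
      have "inv r \<otimes> (g \<otimes> x) = (inv r \<otimes> g) \<otimes> x" "inv r \<otimes> g = (inv r \<otimes> (g \<otimes> x)) \<otimes> inv x"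
        using g xc r by (simp_all add: group_word)
      then show ?thesis using x subgroup.m_closed[OF H(1)] subgroup.m_inv_closed[OF H(1)] by metis
    qed
    then show ?thesis unfolding \<rho>_def by metis
  qed
  define \<tau> where "\<tau> g = h (inv (\<rho> g) \<otimes> g)" for g
  have "\<tau> (g \<otimes> x) = \<tau> g + h x" if g: "g \<in> carrier G" and x: "x \<in> H" for g x
  proof -
    have "inv (\<rho> g) \<otimes> (g \<otimes> x) = (inv (\<rho> g) \<otimes> g) \<otimes> x" using g x \<rho>[OF g] Hc by (simp add: m_assoc subset_iff)
    then show ?thesis unfolding \<tau>_def \<rho>_cong[OF g x] using hmult \<rho>[OF g] x by simp
  qed
  then show ?thesis using that[of c h \<tau>] c(1) cc h hN hinv hconj by blast
qed

text \<open>Each old function is multiplied by three trapezoids in the height; \<open>j\<close>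
  encodes the pair \<open>(j div 3, j mod 3)\<close>. Over the old supports the additivity errors of
  the height take finitely many values, so they are bounded by some \<open>r\<close> before the ramp
  width \<open>q\<close> is chosen.\<close>

lemma has_towers_infinite_step:
  assumes "has_towers H m" "central_step H N" "\<not> finite_index_in N H"
  shows "has_towers N (3 * m)"
  unfolding has_towers_def
proof (intro allI impI, elim conjE)
  fix K :: "'a set" and \<epsilon> :: real
  assume K: "finite K" "K \<subseteq> carrier G" and \<epsilon>: "\<epsilon> > 0"
  have H: "subgroup H G" and Hn: "H \<lhd> G" and NH: "N \<subseteq> H" using assms(2) central_step_subnormal unfolding central_step_def by auto
  have Hc: "H \<subseteq> carrier G" using H subgroup.subset by blast
  obtain c h \<tau> where c: "c \<in> H" "c \<in> carrier G" "\<And>x. x \<in> H \<Longrightarrow> inv (c [^] (h x :: int)) \<otimes> x \<in> N"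
    and \<tau>: "\<And>g x. \<lbrakk>g \<in> carrier G; x \<in> H\<rbrakk> \<Longrightarrow> \<tau> (g \<otimes> x) = \<tau> g + h x"
    and hN: "\<And>x. x \<in> N \<Longrightarrow> h x = 0"
    and hinv: "\<And>x. x \<in> H \<Longrightarrow> h (inv x) = - h x"
    and hconj: "\<And>x w. \<lbrakk>x \<in> H; w \<in> carrier G\<rbrakk> \<Longrightarrow> h (inv w \<otimes> x \<otimes> w) = h x"
    by (rule central_step_height[OF assms(2,3)]) (rule that; assumption)
  obtain \<phi> where \<phi>: "tower_family H m K (\<epsilon> / 2) \<phi>"
    using assms(1) K \<epsilon> unfolding has_towers_def by (meson half_gt_zero)
  then obtain R where R: "finite R" "R \<subseteq> carrier G"
    "\<And>j g. \<lbrakk>j < m; g \<in> carrier G; \<phi> j g \<noteq> 0\<rbrakk> \<Longrightarrow> \<exists>r\<in>R. inv r \<otimes> g \<in> H"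
    by (rule tower_family_finite_support) (rule that; assumption)
  have \<phi>01: "\<And>j g. \<lbrakk>j < m; g \<in> carrier G\<rbrakk> \<Longrightarrow> 0 \<le> \<phi> j g \<and> \<phi> j g \<le> 1"
    and \<phi>H: "\<And>j g n. \<lbrakk>j < m; g \<in> carrier G; n \<in> H\<rbrakk> \<Longrightarrow> \<phi> j (g \<otimes> n) = \<phi> j g"
    and \<phi>K: "\<And>j k g. \<lbrakk>j < m; k \<in> K; g \<in> carrier G\<rbrakk> \<Longrightarrow> \<bar>\<phi> j (k \<otimes> g) - \<phi> j g\<bar> \<le> \<epsilon> / 2"
    and \<phi>1: "1 \<le> (\<Sum>j<m. \<phi> j \<one>)"
    and \<phi>S: "\<And>j g h. \<lbrakk>j < m; g \<in> carrier G; h \<in> carrier G; \<phi> j g \<noteq> 0; \<phi> j h \<noteq> 0\<rbrakk> \<Longrightarrow>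
        1 \<le> (\<Sum>i<m. \<phi> i (inv g \<otimes> h))"
    using \<phi> unfolding tower_family_def by auto
  have rep: "\<exists>r\<in>R. \<exists>x\<in>H. g = r \<otimes> x" if j: "j < m" "g \<in> carrier G" "\<phi> j g \<noteq> 0" for j g
  proof -
    obtain r where r: "r \<in> R" "inv r \<otimes> g \<in> H" using R(3)[OF j] by blast
    then have "g = r \<otimes> (inv r \<otimes> g)" using R(2) j(2) by (simp add: cancel_left subset_iff)
    then show ?thesis using r by blast
  qed
  \<comment> \<open>The heights of the \<open>H\<close>-parts cancel in these differences, so it
    suffices to bound them on representatives from \<open>R\<close>. \<open>B1\<close> controls left
    translation by \<open>K\<close>, \<open>B2\<close> the quotients within a support,
    \<open>B3\<close> the finiteness of the new supports.\<close>
  obtain B1 where B1: "B1 \<ge> 0" "\<And>a. a \<in> K \<times> R \<Longrightarrow> \<bar>\<tau> (fst a \<otimes> snd a) - \<tau> (snd a)\<bar> \<le> B1"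
    using finite_bounded_int[of "K \<times> R" "\<lambda>a. \<tau> (fst a \<otimes> snd a) - \<tau> (snd a)"] K R by auto
  obtain B2 where B2: "B2 \<ge> 0" "\<And>a. a \<in> R \<times> R \<Longrightarrow> \<bar>\<tau> (inv (fst a) \<otimes> snd a) - \<tau> (snd a) + \<tau> (fst a)\<bar> \<le> B2"
    using finite_bounded_int[of "R \<times> R" "\<lambda>a. \<tau> (inv (fst a) \<otimes> snd a) - \<tau> (snd a) + \<tau> (fst a)"] R by auto
  obtain B3 where B3: "B3 \<ge> 0" "\<And>a. a \<in> R \<Longrightarrow> \<bar>\<tau> a\<bar> \<le> B3"
    using finite_bounded_int[of R \<tau>] R by auto
  \<comment> \<open>\<open>\<tau> \<one>\<close> enters because the chosen point of the coset
    \<open>H\<close> need not be the neutral element.\<close>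
  define r where "r = real_of_int (B1 + B2 + \<bar>\<tau> \<one>\<bar>)"
  have r0: "r \<ge> 0" using B1 B2 by (simp add: r_def)
  \<comment> \<open>Large enough for \<open>r / q \<le> \<epsilon> / 2\<close>; the other half of
    \<open>\<epsilon>\<close> is spent by the old functions.\<close>
  define q where "q = 1 + 2 * r / \<epsilon>"
  have q: "q > 0" using r0 \<epsilon> by (simp add: q_def add_pos_nonneg)
  have rq: "r / q \<le> \<epsilon> / 2" using q \<epsilon> by (simp add: q_def field_simps)
  define n where "n = 3 * q + r"
  define p where "p = 4 * q + 2 * r"
  define \<psi> where "\<psi> b t = trapezoid n q (real_of_int t - (real b - 1) * p)" for b :: nat and t :: int
  have \<psi>01: "0 \<le> \<psi> b t" "\<psi> b t \<le> 1" for b t unfolding \<psi>_def by (rule trapezoid_range)+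
  have \<psi>_lip: "\<bar>\<psi> b s - \<psi> b t\<bar> \<le> \<bar>s - t\<bar> / q" for b s t
    unfolding \<psi>_def using trapezoid_lipschitz[OF q, of n "real_of_int s - (real b - 1) * p" "real_of_int t - (real b - 1) * p"]
    by simp
  have \<psi>_supp: "\<bar>real_of_int t - (real b - 1) * p\<bar> < n" if "\<psi> b t \<noteq> 0" for b t
    using trapezoid_support[OF q] that unfolding \<psi>_def by blast
  have \<psi>_cover: "\<exists>b<3. \<psi> b t = 1" if "\<bar>real_of_int t\<bar> \<le> 2 * n + r" for t
    using trapezoids_cover[OF q r0, of "real_of_int t"] that unfolding \<psi>_def n_def p_def by blast
  define \<Phi> where "\<Phi> j g = \<phi> (j div 3) g * \<psi> (j mod 3) (\<tau> g)" for j g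
  \<comment> \<open>A single \<open>b\<close> works for all \<open>j\<close> at once, since the
    height of \<open>g\<close> does not depend on \<open>j\<close>; the old sum is thus part of the
    new one.\<close>
  have sum_ge: "1 \<le> (\<Sum>j<3 * m. \<Phi> j g)"
    if g: "g \<in> carrier G" and 1: "1 \<le> (\<Sum>j<m. \<phi> j g)" and t: "\<bar>real_of_int (\<tau> g)\<bar> \<le> 2 * n + r" for g
  proof -
    obtain b where b: "b < 3" "\<psi> b (\<tau> g) = 1" using \<psi>_cover[OF t] by blast
    have "(\<Sum>j<m. \<phi> j g) = (\<Sum>j<m. \<Phi> (3 * j + b) g)"
      unfolding \<Phi>_def using b by (intro sum.cong) auto
    also have "\<dots> = (\<Sum>i\<in>(\<lambda>j. 3 * j + b) ` {..<m}. \<Phi> i g)"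
      by (subst sum.reindex) (auto simp: inj_on_def)
    also have "\<dots> \<le> (\<Sum>i<3 * m. \<Phi> i g)"
    proof (rule sum_mono2)
      show "(\<lambda>j. 3 * j + b) ` {..<m} \<subseteq> {..<3 * m}" using b(1) by auto
      show "0 \<le> \<Phi> i g" if "i \<in> {..<3 * m} - (\<lambda>j. 3 * j + b) ` {..<m}" for i
        using that \<phi>01[of "i div 3" g] g \<psi>01 by (auto simp: \<Phi>_def intro!: mult_nonneg_nonneg)
    qed simp
    finally show ?thesis using 1 by linarith
  qed
  have "tower_family N (3 * m) K \<epsilon> \<Phi>"
    unfolding tower_family_def
  proof (intro conjI allI ballI impI)
    fix j g assume j: "j < 3 * m" and g: "g \<in> carrier G"
    then have j': "j div 3 < m" by auto
    show "0 \<le> \<Phi> j g" "\<Phi> j g \<le> 1"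
      using \<phi>01[OF j' g] \<psi>01[of "j mod 3" "\<tau> g"] unfolding \<Phi>_def by (auto intro: mult_le_one)
    show "\<Phi> j (g \<otimes> x) = \<Phi> j g" if "x \<in> N" for x
      using that NH \<phi>H[OF j' g] \<tau>[OF g] hN[OF that] unfolding \<Phi>_def by (auto simp: subset_iff)
    show "\<bar>\<Phi> j (k \<otimes> g) - \<Phi> j g\<bar> \<le> \<epsilon>" if k: "k \<in> K" for k
    \<comment> \<open>If the old function vanishes at \<open>g\<close>, its value at
      \<open>k g\<close> is at most \<open>\<epsilon> / 2\<close>, whatever the height; otherwise
      \<open>g\<close> has a representative in \<open>R\<close> and the height changes by at most
      \<open>r\<close>.\<close>
    proof (cases "\<phi> (j div 3) g = 0")
      case True
      have "\<bar>\<Phi> j (k \<otimes> g) - \<Phi> j g\<bar> \<le> \<bar>\<phi> (j div 3) (k \<otimes> g)\<bar> * 1"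
        unfolding \<Phi>_def using True \<psi>01 by (simp add: abs_mult mult_left_le)
      also have "\<dots> \<le> \<epsilon> / 2" using \<phi>K[OF j' k g] True by simp
      finally show ?thesis using \<epsilon> by simp
    next
      case False
      then obtain s x where sx: "s \<in> R" "x \<in> H" "g = s \<otimes> x" using rep[OF j' g] by blast
      have kc: "k \<in> carrier G" and sc: "s \<in> carrier G" and xc: "x \<in> carrier G" using k K sx R Hc by auto
      have "k \<otimes> g = (k \<otimes> s) \<otimes> x" using kc sc xc sx by (simp add: m_assoc)
      then have "\<tau> (k \<otimes> g) - \<tau> g = \<tau> (k \<otimes> s) - \<tau> s" using \<tau> kc sc sx by simp
      then have "\<bar>\<tau> (k \<otimes> g) - \<tau> g\<bar> \<le> B1" using B1(2)[of "(k, s)"] k sx by simp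
      then have d: "\<bar>real_of_int (\<tau> (k \<otimes> g)) - real_of_int (\<tau> g)\<bar> \<le> r"
        unfolding r_def using B2(1) by linarith
      have "\<bar>\<psi> (j mod 3) (\<tau> (k \<otimes> g)) - \<psi> (j mod 3) (\<tau> g)\<bar> \<le> r / q"
        using \<psi>_lip[of "j mod 3" "\<tau> (k \<otimes> g)" "\<tau> g"] divide_right_mono[OF d, of q] q by simp
      then have e: "\<bar>\<psi> (j mod 3) (\<tau> (k \<otimes> g)) - \<psi> (j mod 3) (\<tau> g)\<bar> \<le> \<epsilon> / 2" using rq by linarith
      let ?a = "\<phi> (j div 3) (k \<otimes> g)" and ?a' = "\<phi> (j div 3) g"
      let ?b = "\<psi> (j mod 3) (\<tau> (k \<otimes> g))" and ?b' = "\<psi> (j mod 3) (\<tau> g)"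
      have "\<Phi> j (k \<otimes> g) - \<Phi> j g = (?a - ?a') * ?b + ?a' * (?b - ?b')"
        unfolding \<Phi>_def by (simp add: algebra_simps)
      also have "\<bar>\<dots>\<bar> \<le> \<bar>?a - ?a'\<bar> * \<bar>?b\<bar> + \<bar>?a'\<bar> * \<bar>?b - ?b'\<bar>"
        using abs_triangle_ineq[of "(?a - ?a') * ?b" "?a' * (?b - ?b')"] by (simp add: abs_mult)
      also have "\<dots> \<le> \<bar>?a - ?a'\<bar> * 1 + 1 * \<bar>?b - ?b'\<bar>"
        using \<psi>01[of "j mod 3" "\<tau> (k \<otimes> g)"] \<phi>01[OF j' g] by (intro add_mono mult_mono) auto
      also have "\<dots> \<le> \<epsilon>" using \<phi>K[OF j' k g] e by simp
      finally show ?thesis .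
    qed
    show "1 \<le> (\<Sum>i<3 * m. \<Phi> i (inv g \<otimes> g'))"
      if g': "g' \<in> carrier G" and nz: "\<Phi> j g \<noteq> 0 \<and> \<Phi> j g' \<noteq> 0" for g'
    proof (rule sum_ge)
      have nz1: "\<phi> (j div 3) g \<noteq> 0" "\<phi> (j div 3) g' \<noteq> 0"
        and nz2: "\<psi> (j mod 3) (\<tau> g) \<noteq> 0" "\<psi> (j mod 3) (\<tau> g') \<noteq> 0" using nz by (auto simp: \<Phi>_def)
      show "inv g \<otimes> g' \<in> carrier G" using g g' by simp
      show "1 \<le> (\<Sum>i<m. \<phi> i (inv g \<otimes> g'))" using \<phi>S[OF j' g g' nz1] .
      obtain s x where sx: "s \<in> R" "x \<in> H" "g = s \<otimes> x" using rep[OF j' g nz1(1)] by blast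
      obtain s' x' where sx': "s' \<in> R" "x' \<in> H" "g' = s' \<otimes> x'" using rep[OF j' g' nz1(2)] by blast
      have sc: "s \<in> carrier G" "x \<in> carrier G" "s' \<in> carrier G" "x' \<in> carrier G" using sx sx' R Hc by auto
      \<comment> \<open>Moving \<open>x^-1\<close> to the right of \<open>?w\<close> conjugates it
        into \<open>?y\<close>, whose height is \<open>- h x\<close> by centrality. The height of
        \<open>g^-1 g'\<close> is therefore the difference of the heights up to
        \<open>B2\<close>.\<close>
      let ?w = "inv s \<otimes> s'"
      let ?y = "inv ?w \<otimes> inv x \<otimes> ?w"
      have y: "?y \<in> H"
        using normal.inv_op_closed1[OF Hn, of ?w "inv x"] sc sx subgroup.m_inv_closed[OF H] by simp
      have "inv g \<otimes> g' = (?w \<otimes> ?y) \<otimes> x'" using sc sx sx' by (simp add: group_word)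
      then have "\<tau> (inv g \<otimes> g') = \<tau> (?w \<otimes> ?y) + h x'" using \<tau> sc sx' y Hc by (simp add: subset_iff)
      also have "\<tau> (?w \<otimes> ?y) = \<tau> ?w + h ?y" using \<tau>[OF _ y] sc by simp
      also have "h ?y = - h x" using hconj[of "inv x" ?w] hinv sx sc subgroup.m_inv_closed[OF H] by simp
      finally have "\<tau> (inv g \<otimes> g') - (\<tau> g' - \<tau> g) = \<tau> ?w - \<tau> s' + \<tau> s" using \<tau> sx sx' sc by simp
      moreover have "\<bar>\<tau> ?w - \<tau> s' + \<tau> s\<bar> \<le> B2" using B2(2)[of "(s, s')"] sx sx' by simp
      ultimately have "\<bar>real_of_int (\<tau> (inv g \<otimes> g'))\<bar> \<le> \<bar>real_of_int (\<tau> g') - real_of_int (\<tau> g)\<bar> + r"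
        unfolding r_def using B1(1) by linarith
      moreover have "\<bar>real_of_int (\<tau> g') - real_of_int (\<tau> g)\<bar> \<le> 2 * n"
        using \<psi>_supp[OF nz2(1)] \<psi>_supp[OF nz2(2)] by linarith
      ultimately show "\<bar>real_of_int (\<tau> (inv g \<otimes> g'))\<bar> \<le> 2 * n + r" by linarith
    qed
  next
    have "n \<ge> 0" using q r0 by (simp add: n_def)
    then have "\<bar>real_of_int (\<tau> \<one>)\<bar> \<le> 2 * n + r" using B1(1) B2(1) unfolding r_def by linarith
    then show "1 \<le> (\<Sum>j<3 * m. \<Phi> j \<one>)" using sum_ge[OF one_closed \<phi>1] by blast
  next
    \<comment> \<open>\<open>n + p\<close> bounds the height on the supports of all three
      trapezoids; subtracting the height of the representative costs \<open>B3\<close>.\<close>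
    define M where "M = \<lceil>n + p\<rceil> + B3"
    define R' where "R' = (\<lambda>(s, t). s \<otimes> c [^] t) ` (R \<times> {- M..M})"
    have "finite R'" "R' \<subseteq> carrier G" using R c(2) by (auto simp: R'_def)
    moreover have "\<exists>s\<in>R'. inv s \<otimes> g \<in> N"
      if j: "j < 3 * m" and g: "g \<in> carrier G" and nz: "\<Phi> j g \<noteq> 0" for j g
    proof -
      have j': "j div 3 < m" using j by auto
      have nz1: "\<phi> (j div 3) g \<noteq> 0" and nz2: "\<psi> (j mod 3) (\<tau> g) \<noteq> 0" using nz by (auto simp: \<Phi>_def)
      obtain s x where sx: "s \<in> R" "x \<in> H" "g = s \<otimes> x" using rep[OF j' g nz1] by blast
      have sc: "s \<in> carrier G" "x \<in> carrier G" using sx R Hc by auto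
      have "p \<ge> 0" using q r0 by (simp add: p_def)
      have "\<bar>(real (j mod 3) - 1) * p\<bar> \<le> 1 * p"
        unfolding abs_mult using \<open>p \<ge> 0\<close> by (intro mult_mono) auto
      then have "\<bar>real_of_int (\<tau> g)\<bar> \<le> n + p" using \<psi>_supp[OF nz2] by linarith
      then have "\<bar>\<tau> g\<bar> \<le> \<lceil>n + p\<rceil>" by linarith
      moreover have "\<tau> g = \<tau> s + h x" using \<tau> sx sc by simp
      moreover have "\<bar>\<tau> s\<bar> \<le> B3" using B3(2) sx by simp
      ultimately have "\<bar>h x\<bar> \<le> M" unfolding M_def by linarith
      then have "s \<otimes> c [^] h x \<in> R'" using sx by (force simp: R'_def)
      moreover have "inv (s \<otimes> c [^] h x) \<otimes> g = inv (c [^] h x) \<otimes> x" using sc sx c(2) by (simp add: group_word)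
      ultimately show ?thesis using c(3)[OF sx(2)] by metis
    qed
    ultimately show "\<exists>R. finite R \<and> R \<subseteq> carrier G \<and>
        (\<forall>j<3 * m. \<forall>g\<in>carrier G. \<Phi> j g \<noteq> 0 \<longrightarrow> (\<exists>r\<in>R. inv r \<otimes> g \<in> N))" by blast
  qed
  then show "\<exists>\<phi>. tower_family N (3 * m) K \<epsilon> \<phi>" by blast
qed

lemma central_chain_has_towers: "central_chain N n \<Longrightarrow> has_towers N (3 ^ n)"
proof (induction rule: central_chain.induct)
  case top
  then show ?case using has_towers_carrier by simp
next
  case (finite_step H n N)
  have "N \<subseteq> H" "N \<subseteq> carrier G"
    using finite_step(2) normal_imp_subgroup subgroup.subset unfolding central_step_def by blast+
  then show ?case using has_towers_finite_step finite_step by blast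
next
  case (infinite_step H n N)
  then show ?case using has_towers_infinite_step by simp
qed

end

section \<open>General position\<close>

text \<open>Gaussian elimination with fewer equations than unknowns: an equation with pivot
  \<open>k0\<close> removes the unknown \<open>n k0\<close> from the others.\<close>

lemma exists_normal_vector:
  fixes w :: "'i \<Rightarrow> 'k \<Rightarrow> real"
  assumes "finite J" "finite K" "card J < card K"
  shows "\<exists>n. (\<exists>k\<in>K. n k \<noteq> 0) \<and> (\<forall>i\<in>J. (\<Sum>k\<in>K. n k * w i k) = 0)"
  using assms
proof (induction arbitrary: K w rule: finite_induct)
  case empty
  then have "K \<noteq> {}" by auto
  then show ?case by (intro exI[of _ "\<lambda>_. 1"]) auto
next
  case (insert i J)
  show ?case
  proof (cases "\<forall>k\<in>K. w i k = 0")
    case True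
    have "card J < card K" using insert by simp
    then obtain n where "\<exists>k\<in>K. n k \<noteq> 0" "\<forall>i\<in>J. (\<Sum>k\<in>K. n k * w i k) = 0"
      using insert.IH[OF insert.prems(1)] by blast
    then show ?thesis using True by (intro exI[of _ n]) simp
  next
    case False
    then obtain k0 where k0: "k0 \<in> K" "w i k0 \<noteq> 0" by blast
    define K' where "K' = K - {k0}"
    have K': "finite K'" "k0 \<notin> K'" "K = insert k0 K'" "card J < card K'"
      using insert k0 by (auto simp: K'_def card_Diff_singleton)
    define c where "c l = w l k0 / w i k0" for l
    define w' where "w' l k = w l k - c l * w i k" for l k
    obtain n where n: "\<exists>k\<in>K'. n k \<noteq> 0" "\<forall>l\<in>J. (\<Sum>k\<in>K'. n k * w' l k) = 0"
      using insert.IH[OF K'(1,4)] by blast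
    define s where "s = (\<Sum>k\<in>K'. n k * w i k)"
    define n' where "n' = n(k0 := - s / w i k0)"
    have sum: "(\<Sum>k\<in>K. n' k * w l k) = (\<Sum>k\<in>K'. n k * w l k) - s * c l" for l
    proof -
      have "(\<Sum>k\<in>K'. n' k * w l k) = (\<Sum>k\<in>K'. n k * w l k)"
        unfolding n'_def using K'(2) by (intro sum.cong) auto
      then show ?thesis using K'(1,2) unfolding K'(3) by (simp add: n'_def c_def)
    qed
    have "(\<Sum>k\<in>K. n' k * w l k) = 0" if "l \<in> J" for l
    proof -
      have "(\<Sum>k\<in>K'. n k * w' l k) = (\<Sum>k\<in>K'. n k * w l k) - s * c l"
        unfolding s_def sum_distrib_right sum_subtractf[symmetric] w'_def
        by (intro sum.cong) (auto simp: algebra_simps)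
      then show ?thesis using sum[of l] n(2) that by simp
    qed
    moreover have "(\<Sum>k\<in>K. n' k * w i k) = 0" using sum[of i] k0(2) by (simp add: s_def c_def)
    moreover have "\<exists>k\<in>K. n' k \<noteq> 0" using n(1) K'(2,3) by (auto simp: n'_def)
    ultimately show ?thesis by blast
  qed
qed

text \<open>Along the curve with coordinates \<open>a k + t ^ Suc (e k)\<close>, where
  \<open>e\<close> is injective, each of the linear forms becomes a non-zero polynomial in
  \<open>t\<close>. All but finitely many small \<open>t\<close> avoid every root.\<close>

lemma perturb_off_hyperplanes:
  fixes a :: "'k \<Rightarrow> real"
  assumes K: "finite K" and Ns: "finite Ns" "\<And>n. n \<in> Ns \<Longrightarrow> \<exists>k\<in>K. n k \<noteq> 0" and "\<delta> > 0"
  shows "\<exists>y. (\<forall>k\<in>K. \<bar>y k - a k\<bar> < \<delta>) \<and> (\<forall>n\<in>Ns. (\<Sum>k\<in>K. n k * y k) \<noteq> 0)"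
proof -
  obtain e :: "'k \<Rightarrow> nat" where e: "inj_on e K"
    using finite_imp_inj_to_nat_seg[OF K] by blast
  define P where "P n = (\<Sum>k\<in>K. monom (n k) (Suc (e k))) + [:\<Sum>k\<in>K. n k * a k:]" for n
  have P: "poly (P n) t = (\<Sum>k\<in>K. n k * (a k + t ^ Suc (e k)))" for n t
    unfolding P_def by (simp add: poly_sum poly_monom distrib_left sum.distrib)
  have "P n \<noteq> 0" if n: "n \<in> Ns" for n
  proof -
    obtain k where k: "k \<in> K" "n k \<noteq> 0" using Ns(2)[OF n] by blast
    \<comment> \<open>The exponents are distinct and positive, so neither another coordinate nor the
      constant term interferes.\<close>
    have "coeff (P n) (Suc (e k)) = (\<Sum>l\<in>K. if l = k then n l else 0)"
      unfolding P_def using e k(1) by (auto simp: coeff_sum inj_on_def intro!: sum.cong)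
    also have "\<dots> = n k" using K k(1) by simp
    finally show ?thesis using k(2) by auto
  qed
  then have "finite (\<Union>n\<in>Ns. {t. poly (P n) t = 0})" using Ns(1) poly_roots_finite by blast
  moreover have "infinite {0<..<min \<delta> 1}" using assms(4) by (simp add: infinite_Ioo)
  ultimately obtain t where t: "t \<in> {0<..<min \<delta> 1}" "t \<notin> (\<Union>n\<in>Ns. {t. poly (P n) t = 0})"
    by (meson finite_subset subsetI)
  have "t ^ Suc m < \<delta>" for m
  proof -
    have "t ^ Suc m \<le> t ^ 1" using t(1) by (intro power_decreasing) auto
    then have "t ^ Suc m \<le> t" by (simp only: power_one_right)
    moreover have "t < \<delta>" using t(1) by simp
    ultimately show ?thesis by linarith
  qed
  then show ?thesis using t P by (intro exI[of _ "\<lambda>k. a k + t ^ Suc (e k)"]) auto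
qed

text \<open>The second clause is linear independence of any at most \<open>card K\<close> of the
  vectors. A new vector only has to avoid finitely many hyperplanes, one through each set of fewer
  than \<open>card K\<close> earlier vectors.\<close>

lemma general_position:
  fixes a :: "'i \<Rightarrow> 'k \<Rightarrow> real"
  assumes I: "finite I" and K: "finite K" and \<delta>: "\<delta> > 0"
  shows "\<exists>w. (\<forall>i\<in>I. \<forall>k\<in>K. \<bar>w i k - a i k\<bar> < \<delta>) \<and>
    (\<forall>J p. J \<subseteq> I \<and> J \<noteq> {} \<and> card J \<le> card K \<and> (\<forall>i\<in>J. p i \<noteq> 0) \<longrightarrow> (\<exists>k\<in>K. (\<Sum>i\<in>J. p i * w i k) \<noteq> 0))"
  using I
proof (induction rule: finite_induct)
  case empty
  then show ?case by auto
next
  case (insert x I)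
  obtain w where w': "(\<forall>i\<in>I. \<forall>k\<in>K. \<bar>w i k - a i k\<bar> < \<delta>) \<and>
    (\<forall>J p. J \<subseteq> I \<and> J \<noteq> {} \<and> card J \<le> card K \<and> (\<forall>i\<in>J. p i \<noteq> 0) \<longrightarrow> (\<exists>k\<in>K. (\<Sum>i\<in>J. p i * w i k) \<noteq> 0))"
    using insert.IH ..
  have w: "\<forall>i\<in>I. \<forall>k\<in>K. \<bar>w i k - a i k\<bar> < \<delta>"
    "\<And>J p. \<lbrakk>J \<subseteq> I; J \<noteq> {}; card J \<le> card K; \<forall>i\<in>J. p i \<noteq> 0\<rbrakk> \<Longrightarrow> \<exists>k\<in>K. (\<Sum>i\<in>J. p i * w i k) \<noteq> 0"
    using w' by simp_all
  have "\<forall>J. J \<subseteq> I \<and> card J < card K \<longrightarrow>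
      (\<exists>n. (\<exists>k\<in>K. n k \<noteq> 0) \<and> (\<forall>i\<in>J. (\<Sum>k\<in>K. n k * w i k) = 0))"
    using exists_normal_vector[OF finite_subset[OF _ insert(1)] K] by simp
  then obtain n where n: "\<And>J. J \<subseteq> I \<Longrightarrow> card J < card K \<Longrightarrow> \<exists>k\<in>K. n J k \<noteq> 0"
    "\<And>J i. J \<subseteq> I \<Longrightarrow> card J < card K \<Longrightarrow> i \<in> J \<Longrightarrow> (\<Sum>k\<in>K. n J k * w i k) = 0"
    by metis
  let ?Ns = "n ` {J. J \<subseteq> I \<and> card J < card K}"
  have fin: "finite ?Ns" using insert(1) by simp
  have nz: "\<exists>k\<in>K. m k \<noteq> 0" if "m \<in> ?Ns" for m using that n(1) by auto
  obtain y where y: "\<forall>k\<in>K. \<bar>y k - a x k\<bar> < \<delta>" "\<forall>n\<in>?Ns. (\<Sum>k\<in>K. n k * y k) \<noteq> 0"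
    using perturb_off_hyperplanes[OF K fin nz \<delta>, of "a x"] by metis
  define w' where "w' = w(x := y)"
  have "\<exists>k\<in>K. (\<Sum>i\<in>J. p i * w' i k) \<noteq> 0"
    if J: "J \<subseteq> insert x I" "J \<noteq> {}" "card J \<le> card K" and p: "\<forall>i\<in>J. p i \<noteq> 0" for J p
  proof (cases "x \<in> J")
    case False
    then have "(\<Sum>i\<in>J. p i * w' i k) = (\<Sum>i\<in>J. p i * w i k)" for k
      by (intro sum.cong) (auto simp: w'_def)
    then show ?thesis using w(2)[of J p] False J p by auto
  next
    case True
    define J' where "J' = J - {x}"
    have finJ: "finite J" using J(1) insert(1) finite_subset by blast
    have J': "J' \<subseteq> I" "finite J'" "x \<notin> J'" "J = insert x J'" "card J' < card K"
      using J True finJ card_Diff1_less[OF finJ True] by (auto simp: J'_def)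
    show ?thesis
    proof (rule ccontr)
      assume none: "\<not> (\<exists>k\<in>K. (\<Sum>i\<in>J. p i * w' i k) \<noteq> 0)"
      then have 0: "p x * y k + (\<Sum>i\<in>J'. p i * w i k) = 0" if "k \<in> K" for k
      proof -
        have "(\<Sum>i\<in>J'. p i * w' i k) = (\<Sum>i\<in>J'. p i * w i k)"
          using J'(3) by (intro sum.cong) (auto simp: w'_def)
        then show ?thesis using none that J'(2,3) unfolding J'(4) by (auto simp: w'_def)
      qed
      \<comment> \<open>Pairing with the normal vector of the hyperplane through \<open>J'\<close>
        removes the old vectors and leaves \<open>p x\<close> times a non-zero number.\<close>
      have "0 = (\<Sum>k\<in>K. n J' k * (p x * y k + (\<Sum>i\<in>J'. p i * w i k)))"
        using 0 by simp
      also have "\<dots> = p x * (\<Sum>k\<in>K. n J' k * y k) + (\<Sum>k\<in>K. \<Sum>i\<in>J'. p i * (n J' k * w i k))"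
        by (simp add: distrib_left sum.distrib sum_distrib_left algebra_simps)
      also have "(\<Sum>k\<in>K. \<Sum>i\<in>J'. p i * (n J' k * w i k)) = (\<Sum>i\<in>J'. p i * (\<Sum>k\<in>K. n J' k * w i k))"
        by (subst sum.swap) (simp add: sum_distrib_left)
      also have "\<dots> = 0" using n(2)[OF J'(1,5)] by simp
      finally show False using y(2) J'(1,5) p True by auto
    qed
  qed
  moreover have "\<forall>i\<in>insert x I. \<forall>k\<in>K. \<bar>w' i k - a i k\<bar> < \<delta>"
    using w(1) y(1) by (auto simp: w'_def)
  ultimately show ?case by blast
qed

section \<open>Compactness, Urysohn functions and covering dimension\<close>

lemma compact_space_finite_subcover:
  assumes "compact_space X" "\<And>x. x \<in> topspace X \<Longrightarrow> openin X (N x) \<and> x \<in> N x"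
  shows "\<exists>F. finite F \<and> F \<subseteq> topspace X \<and> topspace X \<subseteq> (\<Union>x\<in>F. N x)"
proof -
  have "\<exists>\<F>. finite \<F> \<and> \<F> \<subseteq> N ` topspace X \<and> topspace X \<subseteq> \<Union>\<F>"
    using assms(1)[unfolded compact_space_alt, rule_format, of "N ` topspace X"] assms(2) by blast
  then obtain \<F> where \<F>: "finite \<F>" "\<F> \<subseteq> N ` topspace X" "topspace X \<subseteq> \<Union>\<F>" by blast
  then obtain F where "F \<subseteq> topspace X" "finite F" "\<F> = N ` F"
    using finite_subset_image by metis
  then show ?thesis using \<F>(3) by auto
qed

lemma compact_space_positive_bound:
  fixes f :: "'x \<Rightarrow> real"
  assumes X: "compact_space X" and f: "continuous_map X euclideanreal f"
    and pos: "\<And>x. x \<in> topspace X \<Longrightarrow> f x > 0"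
  shows "\<exists>\<eta>>0. \<forall>x\<in>topspace X. \<eta> \<le> f x"
proof (cases "topspace X = {}")
  case False
  have "compactin euclideanreal (f ` topspace X)"
    using image_compactin[OF _ f] X by (simp add: compact_space_def)
  then have "compact (f ` topspace X)" by simp
  then obtain m where "m \<in> f ` topspace X" "\<forall>t\<in>f ` topspace X. m \<le> t"
    using compact_attains_inf[of "f ` topspace X"] False by auto
  then show ?thesis using pos by blast
qed (auto intro: zero_less_one)

text \<open>Urysohn functions are grouped by the member of the cover in which they live, added,
  doubled and cut off at 1. Wherever one of them exceeds 1/2, the value is therefore exactly 1,
  which later thresholds rely on.\<close>

lemma finite_open_cover_functions:
  assumes X: "compact_space X" "Hausdorff_space X"
    and V: "finite I" "\<And>i. i \<in> I \<Longrightarrow> openin X (V i)" "topspace X \<subseteq> (\<Union>i\<in>I. V i)"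
  obtains v :: "'i \<Rightarrow> 'x \<Rightarrow> real" where
    "\<And>i. i \<in> I \<Longrightarrow> continuous_map X euclideanreal (v i)"
    "\<And>i x. \<lbrakk>i \<in> I; x \<in> topspace X\<rbrakk> \<Longrightarrow> 0 \<le> v i x \<and> v i x \<le> 1"
    "\<And>i x. \<lbrakk>i \<in> I; x \<in> topspace X; v i x \<noteq> 0\<rbrakk> \<Longrightarrow> x \<in> V i"
    "\<And>x. x \<in> topspace X \<Longrightarrow> \<exists>i\<in>I. v i x = 1"
proof -
  have normal: "normal_space X"
    using X by (simp add: compact_Hausdorff_or_regular_imp_normal_space)
  have "\<forall>x\<in>topspace X. \<exists>i h. i \<in> I \<and> continuous_map X euclideanreal h \<and> (\<forall>y\<in>topspace X. 0 \<le> h y \<and> h y \<le> 1) \<and>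
      h x = (1::real) \<and> (\<forall>y\<in>topspace X. h y \<noteq> 0 \<longrightarrow> y \<in> V i)"
  proof
    fix x assume x: "x \<in> topspace X"
    then obtain i where i: "i \<in> I" "x \<in> V i" using V(3) by blast
    have "closedin X (topspace X - V i)" using V(2)[OF i(1)] by blast
    moreover have "closedin X {x}" using X(2) x closedin_Hausdorff_sing_eq by metis
    moreover have "disjnt (topspace X - V i) {x}" using i(2) by (simp add: disjnt_def)
    ultimately obtain h where h: "continuous_map X (top_of_set {0..1::real}) h"
      "h ` (topspace X - V i) \<subseteq> {0}" "h ` {x} \<subseteq> {1}"
      using Urysohn_lemma[OF normal, of "topspace X - V i" "{x}" 0 1] by auto
    have "continuous_map X euclideanreal h" "\<forall>y\<in>topspace X. 0 \<le> h y \<and> h y \<le> 1"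
      using h(1) by (auto simp: continuous_map_in_subtopology)
    then show "\<exists>i h. i \<in> I \<and> continuous_map X euclideanreal h \<and> (\<forall>y\<in>topspace X. 0 \<le> h y \<and> h y \<le> 1) \<and>
      h x = (1::real) \<and> (\<forall>y\<in>topspace X. h y \<noteq> 0 \<longrightarrow> y \<in> V i)"
      using h(2,3) i(1) by (intro exI[of _ i] exI[of _ h]) auto
  qed
  then obtain \<iota> h where h: "\<And>x. x \<in> topspace X \<Longrightarrow> \<iota> x \<in> I \<and> continuous_map X euclideanreal (h x) \<and>
      (\<forall>y\<in>topspace X. 0 \<le> h x y \<and> h x y \<le> 1) \<and> h x x = (1::real) \<and> (\<forall>y\<in>topspace X. h x y \<noteq> 0 \<longrightarrow> y \<in> V (\<iota> x))"
    by metis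
  have op: "openin X {y \<in> topspace X. h x y \<in> {1/2<..}} \<and> x \<in> {y \<in> topspace X. h x y \<in> {1/2<..}}"
    if x: "x \<in> topspace X" for x
    using openin_continuous_map_preimage[of X euclideanreal "h x" "{1/2<..}"] h[OF x] x by simp
  obtain F where F: "finite F" "F \<subseteq> topspace X"
    "topspace X \<subseteq> (\<Union>x\<in>F. {y \<in> topspace X. h x y \<in> {1/2<..}})"
    using compact_space_finite_subcover[OF X(1) op] by auto
  define v where "v i y = min 1 (2 * (\<Sum>x\<in>{x\<in>F. \<iota> x = i}. h x y))" for i y
  have hF: "x \<in> F \<Longrightarrow> x \<in> topspace X" for x using F(2) by blast
  show ?thesis
  proof
    fix i assume "i \<in> I"
    show "continuous_map X euclideanreal (v i)"
      unfolding v_def using h hF F(1)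
      by (auto simp: continuous_map_atin intro!: tendsto_intros tendsto_min)
    fix x assume x: "x \<in> topspace X"
    show "0 \<le> v i x \<and> v i x \<le> 1"
      unfolding v_def using h[OF hF] x by (auto intro!: sum_nonneg)
    assume "v i x \<noteq> 0"
    then have "(\<Sum>z\<in>{z\<in>F. \<iota> z = i}. h z x) \<noteq> 0" by (auto simp: v_def)
    then obtain z where "z \<in> F" "\<iota> z = i" "h z x \<noteq> 0" by (auto elim: sum.not_neutral_contains_not_neutral)
    then show "x \<in> V i" using h[OF hF] x by auto
  next
    fix x assume x: "x \<in> topspace X"
    then obtain z where z: "z \<in> F" "h z x > 1/2" using F(3) by auto
    have "h z x \<le> (\<Sum>x'\<in>{x'\<in>F. \<iota> x' = \<iota> z}. h x' x)"
      using z(1) F(1) h[OF hF] x by (intro member_le_sum[of z]) auto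
    then have "v (\<iota> z) x = 1" using z(2) by (auto simp: v_def)
    then show "\<exists>i\<in>I. v i x = 1" using h[OF hF[OF z(1)]] by blast
  qed
qed

text \<open>Map \<open>X\<close> to the nerve of a fine cover and place its vertices in general position: a
  simplex with at most \<open>d + 1\<close> vertices then misses the origin of a \<open>(d + 1)\<close>-dimensional space.\<close>

lemma covering_dim_perturb_no_common_zero:
  fixes f :: "'k \<Rightarrow> 'x \<Rightarrow> real"
  assumes X: "compact_space X" "Hausdorff_space X" and dim: "covering_dim_le X d"
    and K: "finite K" "card K = d + 1" and f: "\<And>k. k \<in> K \<Longrightarrow> continuous_map X euclideanreal (f k)"
    and \<epsilon>: "\<epsilon> > 0"
  shows "\<exists>f'. (\<forall>k\<in>K. continuous_map X euclideanreal (f' k) \<and> (\<forall>x\<in>topspace X. \<bar>f' k x - f k x\<bar> < \<epsilon>)) \<and>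
     (\<exists>\<eta>>0. \<forall>x\<in>topspace X. \<eta> \<le> (\<Sum>k\<in>K. \<bar>f' k x\<bar>))"
proof -
  \<comment> \<open>Two thirds of \<open>\<epsilon>\<close> go to the oscillation of
    \<open>f k\<close> on a member of the cover, one third to moving the vertices into general
    position.\<close>
  define \<delta> where "\<delta> = \<epsilon> / 3"
  have \<delta>: "\<delta> > 0" using \<epsilon> by (simp add: \<delta>_def)
  define N where "N x = topspace X \<inter> (\<Inter>k\<in>K. {y \<in> topspace X. f k y \<in> {f k x - \<delta> <..< f k x + \<delta>}})" for x
  have op: "openin X (N x) \<and> x \<in> N x" if x: "x \<in> topspace X" for x
  proof
    show "openin X (N x)"
    proof (cases "K = {}")
      case False
      have "openin X (\<Inter>k\<in>K. {y \<in> topspace X. f k y \<in> {f k x - \<delta> <..< f k x + \<delta>}})"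
        using False K(1) f by (intro openin_INT2 openin_continuous_map_preimage[where Y = euclideanreal]) auto
      then show ?thesis unfolding N_def by blast
    qed (simp add: N_def)
    show "x \<in> N x" using x \<delta> by (auto simp: N_def)
  qed
  obtain F where F: "finite F" "F \<subseteq> topspace X" "topspace X \<subseteq> (\<Union>x\<in>F. N x)"
    using compact_space_finite_subcover[OF X(1) op] by auto
  have NX: "N x \<subseteq> topspace X" for x by (auto simp: N_def)
  have "finite (N ` F)" "\<forall>U\<in>N ` F. openin X U" "\<Union>(N ` F) = topspace X"
    using F NX op by auto
  then have "\<exists>\<V>. finite \<V> \<and> (\<forall>V\<in>\<V>. openin X V) \<and> \<Union>\<V> = topspace X \<and>
      (\<forall>V\<in>\<V>. \<exists>U\<in>N ` F. V \<subseteq> U) \<and> (\<forall>x\<in>topspace X. card {V \<in> \<V>. x \<in> V} \<le> d + 1)"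
    using dim[unfolded covering_dim_le_def, rule_format, of "N ` F"] by simp
  then obtain \<V> where VV: "finite \<V> \<and> (\<forall>V\<in>\<V>. openin X V) \<and> \<Union>\<V> = topspace X \<and>
      (\<forall>V\<in>\<V>. \<exists>U\<in>N ` F. V \<subseteq> U) \<and> (\<forall>x\<in>topspace X. card {V \<in> \<V>. x \<in> V} \<le> d + 1)" ..
  have V: "finite \<V>" "\<And>V. V \<in> \<V> \<Longrightarrow> openin X V" "\<Union>\<V> = topspace X"
    "\<And>V. V \<in> \<V> \<Longrightarrow> \<exists>U\<in>N ` F. V \<subseteq> U" "\<And>x. x \<in> topspace X \<Longrightarrow> card {V \<in> \<V>. x \<in> V} \<le> d + 1"
    using VV by simp_all
  have osc: "\<bar>f k x - f k y\<bar> < 2 * \<delta>" if "V \<in> \<V>" "x \<in> V" "y \<in> V" "k \<in> K" for V x y k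
  proof -
    have "\<exists>U\<in>N ` F. V \<subseteq> U" using V(4) that(1) by blast
    then obtain z where "V \<subseteq> N z" by auto
    then have "x \<in> N z" "y \<in> N z" using that by auto
    then have "f k x \<in> {f k z - \<delta> <..< f k z + \<delta>}" "f k y \<in> {f k z - \<delta> <..< f k z + \<delta>}"
      using that(4) by (auto simp: N_def)
    then have "\<bar>f k x - f k z\<bar> < \<delta>" "\<bar>f k y - f k z\<bar> < \<delta>" by (auto simp: abs_less_iff)
    then show ?thesis by linarith
  qed
  obtain v :: "'x set \<Rightarrow> 'x \<Rightarrow> real" where v: "\<And>V. V \<in> \<V> \<Longrightarrow> continuous_map X euclideanreal (v V)"
    "\<And>V x. \<lbrakk>V \<in> \<V>; x \<in> topspace X\<rbrakk> \<Longrightarrow> 0 \<le> v V x \<and> v V x \<le> 1"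
    "\<And>V x. \<lbrakk>V \<in> \<V>; x \<in> topspace X; v V x \<noteq> 0\<rbrakk> \<Longrightarrow> x \<in> V"
    "\<And>x. x \<in> topspace X \<Longrightarrow> \<exists>V\<in>\<V>. v V x = 1"
    using finite_open_cover_functions[OF X V(1), of "\<lambda>V. V"] V(2,3) by auto
  define s where "s x = (\<Sum>V\<in>\<V>. v V x)" for x
  have s: "s x \<ge> 1" if x: "x \<in> topspace X" for x
  proof -
    obtain V where "V \<in> \<V>" "v V x = 1" using v(4)[OF x] by blast
    then show ?thesis unfolding s_def using member_le_sum[of V \<V> "\<lambda>V. v V x"] v(2) x V(1) by auto
  qed
  define p where "p V x = v V x / s x" for V x
  have p_sum: "(\<Sum>V\<in>\<V>. p V x) = 1" if "x \<in> topspace X" for x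
    using s[OF that] unfolding p_def sum_divide_distrib[symmetric] s_def[symmetric] by simp
  have p_nonneg: "p V x \<ge> 0" if "V \<in> \<V>" "x \<in> topspace X" for V x
    using s[OF that(2)] v(2)[OF that] unfolding p_def by simp
  have p_supp: "x \<in> V" if "V \<in> \<V>" "x \<in> topspace X" "p V x \<noteq> 0" for V x
    using v(3) that unfolding p_def by auto
  have p_cont: "continuous_map X euclideanreal (p V)" if "V \<in> \<V>" for V
    unfolding continuous_map_atin p_def s_def
  proof (intro ballI)
    fix x assume x: "x \<in> topspace X"
    then have "(\<Sum>V\<in>\<V>. v V x) \<noteq> 0" using s[OF x] by (auto simp: s_def)
    then have "((\<lambda>x. v V x / (\<Sum>V\<in>\<V>. v V x)) \<longlongrightarrow> v V x / (\<Sum>V\<in>\<V>. v V x)) (atin X x)"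
      using v(1) x that by (intro tendsto_intros) (auto simp: continuous_map_atin)
    then show "limitin euclideanreal (\<lambda>x. v V x / (\<Sum>V\<in>\<V>. v V x)) (v V x / (\<Sum>V\<in>\<V>. v V x)) (atin X x)"
      by simp
  qed
  \<comment> \<open>A sample point of \<open>V\<close>; the vertex for \<open>V\<close> is placed
    near the values of \<open>f\<close> there. An empty member is harmless since its weight
    vanishes.\<close>
  define z where "z V = (SOME x. x \<in> V)" for V :: "'x set"
  have z: "z V \<in> V" if "x \<in> V" for V x using that someI[of "\<lambda>x. x \<in> V"] unfolding z_def by blast
  obtain w where w: "\<forall>V\<in>\<V>. \<forall>k\<in>K. \<bar>w V k - f k (z V)\<bar> < \<delta>"
    "\<And>J p. \<lbrakk>J \<subseteq> \<V>; J \<noteq> {}; card J \<le> card K; \<forall>V\<in>J. p V \<noteq> 0\<rbrakk> \<Longrightarrow> \<exists>k\<in>K. (\<Sum>V\<in>J. p V * w V k) \<noteq> 0"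
    using general_position[OF V(1) K(1) \<delta>, of "\<lambda>V k. f k (z V)"] by metis
  define f' where "f' k x = (\<Sum>V\<in>\<V>. p V x * w V k)" for k x
  have cont: "continuous_map X euclideanreal (f' k)" for k
    unfolding f'_def using p_cont by (auto simp: continuous_map_atin intro!: tendsto_intros)
  moreover have "\<bar>f' k x - f k x\<bar> < \<epsilon>" if k: "k \<in> K" and x: "x \<in> topspace X" for k x
  proof -
    have "f' k x - f k x = (\<Sum>V\<in>\<V>. p V x * (w V k - f k x))"
      using p_sum[OF x] by (simp add: f'_def right_diff_distrib sum_subtractf sum_distrib_right[symmetric])
    also have "\<bar>\<dots>\<bar> \<le> (\<Sum>V\<in>\<V>. \<bar>p V x * (w V k - f k x)\<bar>)" by (rule sum_abs)
    also have "\<dots> < (\<Sum>V\<in>\<V>. p V x * \<epsilon>)"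
    proof (rule sum_strict_mono_ex1)
      have bound: "\<bar>w V k - f k x\<bar> < \<epsilon>" if "V \<in> \<V>" "p V x \<noteq> 0" for V
      proof -
        have xV: "x \<in> V" using p_supp that x by blast
        have "\<bar>f k (z V) - f k x\<bar> < 2 * \<delta>" using osc[OF that(1) z[OF xV] xV k] .
        moreover have "\<bar>w V k - f k (z V)\<bar> < \<delta>" using w(1) that k by blast
        ultimately show ?thesis unfolding \<delta>_def by linarith
      qed
      show "finite \<V>" by (rule V)
      show "\<forall>V\<in>\<V>. \<bar>p V x * (w V k - f k x)\<bar> \<le> p V x * \<epsilon>"
      proof
        fix V assume V: "V \<in> \<V>"
        show "\<bar>p V x * (w V k - f k x)\<bar> \<le> p V x * \<epsilon>"
          using bound[OF V] p_nonneg[OF V x] by (cases "p V x = 0") (auto simp: abs_mult intro!: mult_left_mono)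
      qed
      obtain V where V: "V \<in> \<V>" "p V x \<noteq> 0" using p_sum[OF x] by (metis sum.neutral zero_neq_one)
      then have "p V x > 0" using p_nonneg[OF V(1) x] by linarith
      then have "\<bar>p V x * (w V k - f k x)\<bar> < p V x * \<epsilon>"
        using bound[OF V] by (simp add: abs_mult)
      then show "\<exists>V\<in>\<V>. \<bar>p V x * (w V k - f k x)\<bar> < p V x * \<epsilon>" using V(1) by blast
    qed
    also have "\<dots> = \<epsilon>" using p_sum[OF x] by (simp add: sum_distrib_right[symmetric])
    finally show ?thesis .
  qed
  moreover have "\<exists>\<eta>>0. \<forall>x\<in>topspace X. \<eta> \<le> (\<Sum>k\<in>K. \<bar>f' k x\<bar>)"
  proof (rule compact_space_positive_bound[OF X(1)])
    show "continuous_map X euclideanreal (\<lambda>x. \<Sum>k\<in>K. \<bar>f' k x\<bar>)"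
      using cont by (auto simp: continuous_map_atin intro!: tendsto_intros)
    fix x assume x: "x \<in> topspace X"
    \<comment> \<open>The vertices of the simplex that carries \<open>x\<close>. The dimension
      bounds their number by \<open>d + 1\<close>, so their combination with the non-zero
      coefficients \<open>p V x\<close> does not vanish.\<close>
    let ?J = "{V \<in> \<V>. p V x \<noteq> 0}"
    have "?J \<subseteq> {V \<in> \<V>. x \<in> V}" using p_supp x by blast
    then have "card ?J \<le> card K" using V(5)[OF x] card_mono[of "{V \<in> \<V>. x \<in> V}" ?J] V(1) K(2) by simp
    moreover have "?J \<noteq> {}" using p_sum[OF x] by (metis (mono_tags, lifting) empty_Collect_eq sum.neutral zero_neq_one)
    ultimately have "\<exists>k\<in>K. (\<Sum>V\<in>?J. p V x * w V k) \<noteq> 0" by (intro w(2)) auto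
    then obtain k where k: "k \<in> K" "(\<Sum>V\<in>?J. p V x * w V k) \<noteq> 0" ..
    have "f' k x = (\<Sum>V\<in>?J. p V x * w V k)"
      unfolding f'_def using V(1) by (intro sum.mono_neutral_right) auto
    then have "0 < \<bar>f' k x\<bar>" using k by simp
    also have "\<bar>f' k x\<bar> \<le> (\<Sum>k\<in>K. \<bar>f' k x\<bar>)" using k(1) K(1) by (intro member_le_sum) auto
    finally show "0 < (\<Sum>k\<in>K. \<bar>f' k x\<bar>)" .
  qed
  ultimately show ?thesis by blast
qed

section \<open>Free actions and perturbation along orbits\<close>

locale free_compact_action = group G for G :: "('g, 'm) monoid_scheme" (structure) +
  fixes X :: "'x topology" and \<alpha> :: "'g \<Rightarrow> 'x \<Rightarrow> 'x"
  assumes compact: "compact_space X" and Hausdorff: "Hausdorff_space X"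
    and act_cont: "g \<in> carrier G \<Longrightarrow> continuous_map X X (\<alpha> g)"
    and act_one: "x \<in> topspace X \<Longrightarrow> \<alpha> \<one> x = x"
    and act_mult: "\<lbrakk>g \<in> carrier G; h \<in> carrier G; x \<in> topspace X\<rbrakk> \<Longrightarrow> \<alpha> (g \<otimes> h) x = \<alpha> g (\<alpha> h x)"
    and free: "\<lbrakk>g \<in> carrier G; x \<in> topspace X; \<alpha> g x = x\<rbrakk> \<Longrightarrow> g = \<one>"
begin

lemma act_closed: "g \<in> carrier G \<Longrightarrow> x \<in> topspace X \<Longrightarrow> \<alpha> g x \<in> topspace X"
  using act_cont continuous_map_image_subset_topspace by fastforce

lemma act_inv:
  "\<lbrakk>g \<in> carrier G; x \<in> topspace X\<rbrakk> \<Longrightarrow> \<alpha> (inv g) (\<alpha> g x) = x"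
  "\<lbrakk>g \<in> carrier G; x \<in> topspace X\<rbrakk> \<Longrightarrow> \<alpha> g (\<alpha> (inv g) x) = x"
  using act_mult[of "inv g" g x] act_mult[of g "inv g" x] act_one by simp_all

lemma act_free_eq:
  assumes "g \<in> carrier G" "h \<in> carrier G" "x \<in> topspace X" "\<alpha> g x = \<alpha> h x"
  shows "g = h"
proof -
  have "\<alpha> (inv h \<otimes> g) x = x" using assms act_mult[of "inv h" g x] act_inv(1)[of h x] by simp
  then have "inv h \<otimes> g = \<one>" using free assms by simp
  then show ?thesis using assms by (metis inv_closed inv_inv l_inv_ex inv_equality inv_comm)
qed

lemma normal: "normal_space X"
  using compact Hausdorff by (simp add: compact_Hausdorff_or_regular_imp_normal_space)

lemma continuous_map_act:
  "\<lbrakk>g \<in> carrier G; continuous_map X Y f\<rbrakk> \<Longrightarrow> continuous_map X Y (\<lambda>x. f (\<alpha> g x))"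
  using continuous_map_compose[OF act_cont, of g Y f] by (simp add: o_def)

text \<open>Freeness makes the points \<open>\<alpha> g z\<close> with \<open>g \<in> T\<close>
  distinct, and the Hausdorff property separates them on a neighbourhood of \<open>z\<close>. The
  closed sets \<open>C z\<close> are kept beside the open ones because Urysohn's lemma will be
  applied to their translates.\<close>

lemma free_cover:
  assumes T: "finite T" "T \<subseteq> carrier G"
  shows "\<exists>I N C. finite I \<and> topspace X \<subseteq> (\<Union>z\<in>I. N z) \<and>
    (\<forall>z\<in>I::'x set. openin X (N z) \<and> closedin X (C z) \<and> N z \<subseteq> C z \<and>
       (\<forall>g\<in>T. \<forall>h\<in>T. g \<noteq> h \<longrightarrow> (\<forall>x\<in>C z. \<forall>y\<in>C z. \<alpha> g x \<noteq> \<alpha> h y)))"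
proof -
  have "\<exists>N C. openin X N \<and> closedin X C \<and> z \<in> N \<and> N \<subseteq> C \<and>
      (\<forall>g\<in>T. \<forall>h\<in>T. g \<noteq> h \<longrightarrow> (\<forall>x\<in>C. \<forall>y\<in>C. \<alpha> g x \<noteq> \<alpha> h y))" if z: "z \<in> topspace X" for z
  proof -
    define P where "P = {p \<in> T \<times> T. fst p \<noteq> snd p}"
    have "\<exists>W. openin X W \<and> z \<in> W \<and> (\<forall>x\<in>W. \<forall>y\<in>W. \<alpha> (fst p) x \<noteq> \<alpha> (snd p) y)" if p: "p \<in> P" for p
    proof -
      obtain g h where gh': "p = (g, h)" "g \<in> T" "h \<in> T" "g \<noteq> h"
        using p by (auto simp: P_def)
      then have gh: "p = (g, h)" "g \<in> carrier G" "h \<in> carrier G" "g \<noteq> h" using T(2) by auto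
      have "\<alpha> g z \<noteq> \<alpha> h z" using act_free_eq gh z by blast
      then obtain A B where AB: "openin X A" "openin X B" "\<alpha> g z \<in> A" "\<alpha> h z \<in> B" "disjnt A B"
        using Hausdorff act_closed[OF gh(2) z] act_closed[OF gh(3) z] unfolding Hausdorff_space_def by metis
      let ?W = "{x \<in> topspace X. \<alpha> g x \<in> A} \<inter> {x \<in> topspace X. \<alpha> h x \<in> B}"
      have "openin X ?W"
        using openin_continuous_map_preimage[OF act_cont[OF gh(2)] AB(1)]
          openin_continuous_map_preimage[OF act_cont[OF gh(3)] AB(2)] by blast
      moreover have "\<forall>x\<in>?W. \<forall>y\<in>?W. \<alpha> g x \<noteq> \<alpha> h y" using AB(5) by (auto simp: disjnt_iff)
      ultimately show ?thesis using AB z gh(1) by (intro exI[of _ ?W]) simp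
    qed
    then obtain W where W: "\<And>p. p \<in> P \<Longrightarrow> openin X (W p) \<and> z \<in> W p \<and>
        (\<forall>x\<in>W p. \<forall>y\<in>W p. \<alpha> (fst p) x \<noteq> \<alpha> (snd p) y)" by metis
    define V where "V = topspace X \<inter> (\<Inter>p\<in>P. W p)"
    have "finite P" using T(1) by (simp add: P_def)
    then have "openin X V"
      unfolding V_def using W by (induction P rule: finite_induct) (auto simp: Int_left_commute[of "topspace X"])
    moreover have "z \<in> V" using W z by (simp add: V_def)
    ultimately have V: "openin X V" "z \<in> V" .
    obtain N C where NC: "openin X N" "closedin X C" "z \<in> N" "N \<subseteq> C" "C \<subseteq> V"
      using compact_Hausdorff_imp_regular_space[OF compact Hausdorff] V
      unfolding neighbourhood_base_of_closedin[symmetric] neighbourhood_base_of by metis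
    have "\<alpha> g x \<noteq> \<alpha> h y" if "g \<in> T" "h \<in> T" "g \<noteq> h" "x \<in> C" "y \<in> C" for g h x y
    proof -
      have "(g, h) \<in> P" using that by (simp add: P_def)
      moreover from this have "x \<in> W (g, h)" "y \<in> W (g, h)" using that NC(5) by (auto simp: V_def)
      ultimately show ?thesis using W by fastforce
    qed
    then show ?thesis using NC by blast
  qed
  then obtain N C where NC: "\<And>z. z \<in> topspace X \<Longrightarrow> openin X (N z) \<and> closedin X (C z) \<and> z \<in> N z \<and> N z \<subseteq> C z \<and>
      (\<forall>g\<in>T. \<forall>h\<in>T. g \<noteq> h \<longrightarrow> (\<forall>x\<in>C z. \<forall>y\<in>C z. \<alpha> g x \<noteq> \<alpha> h y))" by metis
  have "\<exists>F. finite F \<and> F \<subseteq> topspace X \<and> topspace X \<subseteq> (\<Union>x\<in>F. N x)"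
    using NC by (intro compact_space_finite_subcover[OF compact]) auto
  then obtain I where "finite I" "I \<subseteq> topspace X" "topspace X \<subseteq> (\<Union>z\<in>I. N z)" by blast
  then show ?thesis using NC by (intro exI[of _ I] exI[of _ N] exI[of _ C]) auto
qed

definition perturbation :: "'a set \<Rightarrow> ('a \<Rightarrow> 'x \<Rightarrow> real) \<Rightarrow> real \<Rightarrow> ('a \<Rightarrow> 'x \<Rightarrow> real) \<Rightarrow> bool" where
  "perturbation A u \<delta> u' \<longleftrightarrow>
     (\<forall>a\<in>A. continuous_map X euclideanreal (u' a) \<and> (\<forall>x\<in>topspace X. \<bar>u' a x - u a x\<bar> \<le> \<delta>))"

lemma perturbationD:
  assumes "perturbation A u \<delta> u'" "a \<in> A"
  shows "continuous_map X euclideanreal (u' a)" "x \<in> topspace X \<Longrightarrow> \<bar>u' a x - u a x\<bar> \<le> \<delta>"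
  using assms by (auto simp: perturbation_def)

text \<open>For \<open>\<eta> > 0\<close>, a quantitative form of having no common zero on
  \<open>C\<close>; the margin makes it stable under small perturbations.\<close>

definition in_general_position ::
    "('a \<Rightarrow> 'x \<Rightarrow> real) \<Rightarrow> ('a \<times> 'g) set \<Rightarrow> 'x set \<Rightarrow> real \<Rightarrow> bool" where
  "in_general_position u S C \<eta> \<longleftrightarrow> (\<forall>x\<in>C. \<eta> \<le> (\<Sum>(a, g)\<in>S. \<bar>u a (\<alpha> (inv g) x)\<bar>))"

lemma in_general_position_perturb:
  fixes \<delta> \<eta> \<eta>' :: real
  assumes "in_general_position u S C \<eta>" "S \<subseteq> A \<times> carrier G" "C \<subseteq> topspace X"
    and "perturbation A u \<delta> u'" "\<eta>' \<le> \<eta> - real (card S) * \<delta>"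
  shows "in_general_position u' S C \<eta>'"
  unfolding in_general_position_def
proof
  fix x assume x: "x \<in> C"
  have "\<eta> \<le> (\<Sum>(a, g)\<in>S. \<bar>u a (\<alpha> (inv g) x)\<bar>)"
    using assms(1) x unfolding in_general_position_def by blast
  also have "\<dots> \<le> (\<Sum>(a, g)\<in>S. \<bar>u' a (\<alpha> (inv g) x)\<bar> + \<delta>)"
  proof (rule sum_mono, clarify)
    fix a g assume "(a, g) \<in> S"
    then have "a \<in> A" "g \<in> carrier G" "x \<in> topspace X" using assms(2,3) x by auto
    then have "a \<in> A" "\<alpha> (inv g) x \<in> topspace X" using act_closed by auto
    then show "\<bar>u a (\<alpha> (inv g) x)\<bar> \<le> \<bar>u' a (\<alpha> (inv g) x)\<bar> + \<delta>"
      using perturbationD(2)[OF assms(4), of a "\<alpha> (inv g) x"] by linarith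
  qed
  also have "\<dots> = (\<Sum>(a, g)\<in>S. \<bar>u' a (\<alpha> (inv g) x)\<bar>) + real (card S) * \<delta>"
    by (simp add: case_prod_unfold sum.distrib)
  finally show "\<eta>' \<le> (\<Sum>(a, g)\<in>S. \<bar>u' a (\<alpha> (inv g) x)\<bar>)" using assms(5) by linarith
qed

text \<open>The functions \<open>x \<mapsto> u a (g^-1 x)\<close> for different \<open>g\<close>
  come from one \<open>u a\<close>, so they cannot be perturbed independently on all of
  \<open>X\<close>. On \<open>C\<close> they can: the translates of \<open>C\<close> by the inverses
  of elements of \<open>T\<close> are disjoint, and \<open>u a\<close> is corrected on each of them
  separately.\<close>

lemma perturb_one_condition:
  assumes dim: "covering_dim_le X d" and T: "finite T" "T \<subseteq> carrier G"
    and u: "\<And>a. a \<in> A \<Longrightarrow> continuous_map X euclideanreal (u a)" and \<delta>: "\<delta> > 0"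
    and S: "S \<subseteq> A \<times> T" "card S = d + 1"
    and C: "closedin X C" "\<And>g h x y. \<lbrakk>g \<in> T; h \<in> T; g \<noteq> h; x \<in> C; y \<in> C\<rbrakk> \<Longrightarrow> \<alpha> (inv g) x \<noteq> \<alpha> (inv h) y"
  shows "\<exists>u'. perturbation A u \<delta> u' \<and> (\<exists>\<eta>>0. in_general_position u' S C \<eta>)"
proof -
  have CX: "C \<subseteq> topspace X" using C(1) closedin_subset by blast
  have Tc: "g \<in> carrier G" if "g \<in> T" for g using that T by blast
  have finS: "finite S" using S(2) by (metis add_is_0 card.infinite one_neq_zero)
  \<comment> \<open>Away from the translates of \<open>C\<close> the corrections for several
    \<open>g\<close> may overlap, at most \<open>card T\<close> of them; the 1 keeps the denominator
    positive.\<close>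
  define \<delta>' where "\<delta>' = \<delta> / (card T + 1)"
  have \<delta>': "\<delta>' > 0" "card T * \<delta>' \<le> \<delta>" using \<delta> by (auto simp: \<delta>'_def field_simps)
  have f: "continuous_map X euclideanreal (\<lambda>x. u (fst p) (\<alpha> (inv (snd p)) x))" if "p \<in> S" for p
    using continuous_map_act[of "inv (snd p)" euclideanreal "u (fst p)"] u that S(1) Tc by auto
  have "\<exists>f'. (\<forall>p\<in>S. continuous_map X euclideanreal (f' p) \<and>
      (\<forall>x\<in>topspace X. \<bar>f' p x - u (fst p) (\<alpha> (inv (snd p)) x)\<bar> < \<delta>')) \<and>
      (\<exists>\<eta>>0. \<forall>x\<in>topspace X. \<eta> \<le> (\<Sum>p\<in>S. \<bar>f' p x\<bar>))"
    by (rule covering_dim_perturb_no_common_zero[OF compact Hausdorff dim finS S(2) f \<delta>'(1)])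
  then obtain f' \<eta> where f': "\<And>p. p \<in> S \<Longrightarrow> continuous_map X euclideanreal (f' p)"
    "\<And>p x. \<lbrakk>p \<in> S; x \<in> topspace X\<rbrakk> \<Longrightarrow> \<bar>f' p x - u (fst p) (\<alpha> (inv (snd p)) x)\<bar> < \<delta>'"
    and \<eta>: "\<eta> > 0" "\<And>x. x \<in> topspace X \<Longrightarrow> \<eta> \<le> (\<Sum>p\<in>S. \<bar>f' p x\<bar>)"
    by metis
  define D where "D g = {x \<in> topspace X. \<alpha> g x \<in> C}" for g
  have D: "closedin X (D g)" if "g \<in> T" for g
    unfolding D_def using closedin_continuous_map_preimage[OF act_cont[OF Tc[OF that]] C(1)] .
  have disj: "disjnt (\<Union>h\<in>T - {g}. D h) (D g)" if g: "g \<in> T" for g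
  proof -
    have False if x: "x \<in> D g" "x \<in> D h" and h: "h \<in> T" "h \<noteq> g" for x h
      using C(2)[OF g h(1) h(2)[symmetric], of "\<alpha> g x" "\<alpha> h x"] x act_inv(1) Tc g h unfolding D_def by auto
    then show ?thesis by (auto simp: disjnt_iff)
  qed
  have "\<exists>\<beta>. continuous_map X euclideanreal \<beta> \<and> (\<forall>x\<in>topspace X. 0 \<le> \<beta> x \<and> \<beta> x \<le> (1::real)) \<and>
      (\<forall>x\<in>D g. \<beta> x = 1) \<and> (\<forall>h\<in>T - {g}. \<forall>x\<in>D h. \<beta> x = 0)" if g: "g \<in> T" for g
  proof -
    have "closedin X (\<Union>h\<in>T - {g}. D h)" using T(1) D by (intro closedin_Union) auto
      then obtain \<beta> where \<beta>: "continuous_map X (top_of_set {0..1::real}) \<beta>"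
      "\<beta> ` (\<Union>h\<in>T - {g}. D h) \<subseteq> {0}" "\<beta> ` D g \<subseteq> {1}"
      using Urysohn_lemma[OF normal _ D[OF g] disj[OF g], of 0 1] by auto
    then have "continuous_map X euclideanreal \<beta>" "\<forall>x\<in>topspace X. 0 \<le> \<beta> x \<and> \<beta> x \<le> 1"
      by (auto simp: continuous_map_in_subtopology)
    then show ?thesis using \<beta>(2,3) by (intro exI[of _ \<beta>]) auto
  qed
  then obtain \<beta> where \<beta>0: "\<And>g. g \<in> T \<Longrightarrow> continuous_map X euclideanreal (\<beta> g) \<and>
      (\<forall>x\<in>topspace X. 0 \<le> \<beta> g x \<and> \<beta> g x \<le> (1::real)) \<and>
      (\<forall>x\<in>D g. \<beta> g x = 1) \<and> (\<forall>h\<in>T - {g}. \<forall>x\<in>D h. \<beta> g x = 0)"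
    by metis
  have \<beta>: "\<And>g. g \<in> T \<Longrightarrow> continuous_map X euclideanreal (\<beta> g)"
    "\<And>g x. \<lbrakk>g \<in> T; x \<in> topspace X\<rbrakk> \<Longrightarrow> 0 \<le> \<beta> g x \<and> \<beta> g x \<le> (1::real)"
    "\<And>g x. \<lbrakk>g \<in> T; x \<in> D g\<rbrakk> \<Longrightarrow> \<beta> g x = 1"
    "\<And>g h x. \<lbrakk>g \<in> T; h \<in> T; h \<noteq> g; x \<in> D h\<rbrakk> \<Longrightarrow> \<beta> g x = 0"
    using \<beta>0 by simp_all
  define T' where "T' a = {g \<in> T. (a, g) \<in> S}" for a
  have T': "finite (T' a)" "card (T' a) \<le> card T" for a
    using T(1) by (auto simp: T'_def intro: card_mono)
  \<comment> \<open>At \<open>g^-1 x\<close> with \<open>x \<in> C\<close> the cut-off function of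
    \<open>g\<close> is 1 and those of the other elements of \<open>T\<close> vanish, so for
    \<open>(a, g) \<in> S\<close> the value becomes exactly \<open>f' (a, g) x\<close>.\<close>
  define u' where "u' a x = u a x + (\<Sum>g\<in>T' a. \<beta> g x * (f' (a, g) (\<alpha> g x) - u a x))" for a x
  have "continuous_map X euclideanreal (u' a)" if a: "a \<in> A" for a
  proof -
    have "continuous_map X euclideanreal (\<lambda>x. f' (a, g) (\<alpha> g x))" if "g \<in> T' a" for g
      using that f'(1)[of "(a, g)"] continuous_map_act Tc by (auto simp: T'_def)
    then show ?thesis
      unfolding u'_def using u[OF a] \<beta>(1) T'_def by (auto simp: continuous_map_atin intro!: tendsto_intros)
  qed
  moreover have "\<bar>u' a x - u a x\<bar> \<le> \<delta>" if x: "x \<in> topspace X" for a x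
  proof -
    have "\<bar>u' a x - u a x\<bar> \<le> (\<Sum>g\<in>T' a. \<bar>\<beta> g x * (f' (a, g) (\<alpha> g x) - u a x)\<bar>)"
      by (simp add: u'_def sum_abs)
    also have "\<dots> \<le> (\<Sum>g\<in>T' a. \<delta>')"
    proof (rule sum_mono)
      fix g assume g: "g \<in> T' a"
      then have g': "g \<in> T" "(a, g) \<in> S" by (auto simp: T'_def)
      have "\<bar>f' (a, g) (\<alpha> g x) - u a x\<bar> < \<delta>'"
        using f'(2)[OF g'(2) act_closed[OF Tc[OF g'(1)] x]] act_inv(1)[OF Tc[OF g'(1)] x] by simp
      then show "\<bar>\<beta> g x * (f' (a, g) (\<alpha> g x) - u a x)\<bar> \<le> \<delta>'"
        using \<beta>(2)[OF g'(1) x] mult_mono[of "\<bar>\<beta> g x\<bar>" 1 "\<bar>f' (a, g) (\<alpha> g x) - u a x\<bar>" \<delta>']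
        by (simp add: abs_mult)
    qed
    also have "\<dots> \<le> card T * \<delta>'" using T'(2)[of a] \<delta>'(1) by simp
    finally show ?thesis using \<delta>'(2) by linarith
  qed
  moreover have "in_general_position u' S C \<eta>"
    unfolding in_general_position_def
  proof
    fix x assume x: "x \<in> C"
    then have xX: "x \<in> topspace X" using CX by blast
    have "u' a (\<alpha> (inv g) x) = f' (a, g) x" if p: "(a, g) \<in> S" for a g
    proof -
      have g: "g \<in> T" "g \<in> T' a" using p S(1) by (auto simp: T'_def)
      let ?y = "\<alpha> (inv g) x"
      have y: "?y \<in> topspace X" "\<alpha> g ?y = x" using act_closed act_inv(2) Tc g(1) xX by auto
      then have yD: "?y \<in> D g" using x by (simp add: D_def)
      have "(\<Sum>h\<in>T' a. \<beta> h ?y * (f' (a, h) (\<alpha> h ?y) - u a ?y)) =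
          (\<Sum>h\<in>{g}. \<beta> h ?y * (f' (a, h) (\<alpha> h ?y) - u a ?y))"
        using g T' \<beta>(4)[OF _ g(1) _ yD] by (intro sum.mono_neutral_right) (auto simp: T'_def)
      then show ?thesis using \<beta>(3)[OF g(1) yD] y(2) by (simp add: u'_def)
    qed
    then have "(\<Sum>(a, g)\<in>S. \<bar>u' a (\<alpha> (inv g) x)\<bar>) = (\<Sum>p\<in>S. \<bar>f' p x\<bar>)"
      by (intro sum.cong) auto
    then show "\<eta> \<le> (\<Sum>(a, g)\<in>S. \<bar>u' a (\<alpha> (inv g) x)\<bar>)" using \<eta>(2)[OF xX] by simp
  qed
  ultimately show ?thesis using \<eta>(1) unfolding perturbation_def by blast
qed

text \<open>The conditions are met one by one; every new perturbation is so small that the margin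
  already obtained loses at most one half.\<close>

lemma perturb_finitely_many_conditions:
  assumes dim: "covering_dim_le X d" and T: "finite T" "T \<subseteq> carrier G"
    and Q: "finite Q" "\<And>S C. (S, C) \<in> Q \<Longrightarrow> S \<subseteq> A \<times> T \<and> card S = d + 1 \<and> closedin X C \<and>
      (\<forall>g\<in>T. \<forall>h\<in>T. g \<noteq> h \<longrightarrow> (\<forall>x\<in>C. \<forall>y\<in>C. \<alpha> (inv g) x \<noteq> \<alpha> (inv h) y))"
    and u: "\<And>a. a \<in> A \<Longrightarrow> continuous_map X euclideanreal (u a)" and \<delta>: "\<delta> > 0"
  shows "\<exists>u'. perturbation A u \<delta> u' \<and> (\<exists>\<eta>>0. \<forall>(S, C)\<in>Q. in_general_position u' S C \<eta>)"
  using Q \<delta>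
proof (induction arbitrary: \<delta> rule: finite_induct)
  case empty
  then show ?case using u by (intro exI[of _ u]) (auto simp: perturbation_def intro!: exI[of _ 1])
next
  case (insert q Q)
  obtain S C where q: "q = (S, C)" by fastforce
  have SC: "S \<subseteq> A \<times> T" "card S = d + 1" "closedin X C"
    "\<And>g h x y. \<lbrakk>g \<in> T; h \<in> T; g \<noteq> h; x \<in> C; y \<in> C\<rbrakk> \<Longrightarrow> \<alpha> (inv g) x \<noteq> \<alpha> (inv h) y"
    using insert.prems(1)[of S C] q by auto
  have "\<exists>u'. perturbation A u (\<delta> / 2) u' \<and> (\<exists>\<eta>>0. \<forall>(S, C)\<in>Q. in_general_position u' S C \<eta>)"
  proof (rule insert.IH)
    show "S \<subseteq> A \<times> T \<and> card S = d + 1 \<and> closedin X C \<and>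
      (\<forall>g\<in>T. \<forall>h\<in>T. g \<noteq> h \<longrightarrow> (\<forall>x\<in>C. \<forall>y\<in>C. \<alpha> (inv g) x \<noteq> \<alpha> (inv h) y))" if "(S, C) \<in> Q" for S C
      by (rule insert.prems(1)) (use that in simp)
  qed (use insert.prems in simp)
  then obtain u1 where "perturbation A u (\<delta> / 2) u1 \<and>
      (\<exists>\<eta>>0. \<forall>(S, C)\<in>Q. in_general_position u1 S C \<eta>)" ..
  then obtain \<eta>1 where u1: "perturbation A u (\<delta> / 2) u1"
    and \<eta>1: "\<eta>1 > 0" "\<forall>(S, C)\<in>Q. in_general_position u1 S C \<eta>1" by (elim conjE exE)
  define \<delta>2 where "\<delta>2 = min (\<delta> / 2) (\<eta>1 / (2 * real (d + 1)))"
  have \<delta>2: "\<delta>2 > 0" using insert.prems(2) \<eta>1(1) by (simp add: \<delta>2_def)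
  have "\<delta>2 \<le> \<eta>1 / (2 * real (d + 1))" by (simp add: \<delta>2_def)
  then have \<delta>2': "real (d + 1) * \<delta>2 \<le> \<eta>1 / 2" by (simp add: field_simps)
  have "\<exists>u'. perturbation A u1 \<delta>2 u' \<and> (\<exists>\<eta>>0. in_general_position u' S C \<eta>)"
    by (rule perturb_one_condition[OF dim T perturbationD(1)[OF u1] \<delta>2 SC])
  then obtain u2 \<eta>2 where u2: "perturbation A u1 \<delta>2 u2"
    and \<eta>2: "\<eta>2 > 0" "in_general_position u2 S C \<eta>2" by blast
  define \<eta> where "\<eta> = min (\<eta>1 / 2) \<eta>2"
  have "in_general_position u2 S' C' \<eta>" if SC': "(S', C') \<in> insert q Q" for S' C'
  proof (cases "(S', C') = q")
    case True
    then show ?thesis using \<eta>2(2) q by (auto simp: in_general_position_def \<eta>_def min_le_iff_disj)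
  next
    case False
    then have Q': "(S', C') \<in> Q" using SC' by blast
    have S': "S' \<subseteq> A \<times> carrier G" "card S' = d + 1" "C' \<subseteq> topspace X"
      using insert.prems(1)[OF SC'] T(2) closedin_subset by blast+
    have "in_general_position u1 S' C' \<eta>1" using \<eta>1(2) Q' by blast
    moreover have "\<eta> \<le> \<eta>1 - real (card S') * \<delta>2" using \<delta>2' unfolding S'(2) \<eta>_def by linarith
    ultimately show ?thesis using in_general_position_perturb S'(1,3) u2 by blast
  qed
  moreover have "perturbation A u \<delta> u2"
    unfolding perturbation_def
  proof (intro ballI conjI perturbationD(1)[OF u2])
    show "\<bar>u2 a x - u a x\<bar> \<le> \<delta>" if "a \<in> A" "x \<in> topspace X" for a x
      using perturbationD(2)[OF u1 that] perturbationD(2)[OF u2 that] unfolding \<delta>2_def by linarith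
  qed
  moreover have "\<eta> > 0" using \<eta>1 \<eta>2 by (simp add: \<eta>_def)
  ultimately show ?case by (intro exI[of _ u2]) (auto intro!: exI[of _ \<eta>])
qed

text \<open>There is one condition for each set of \<open>d + 1\<close> pairs and each closed piece
  of a free cover. A point with \<open>d + 1\<close> zeros would lie in some piece and violate the
  condition for these pairs. The cover is taken for the inverses, as the translates are by
  \<open>inv g\<close>.\<close>

lemma perturb_few_zeros:
  assumes dim: "covering_dim_le X d" and A: "finite A" and T: "finite T" "T \<subseteq> carrier G"
    and u: "\<And>a. a \<in> A \<Longrightarrow> continuous_map X euclideanreal (u a)" and \<delta>: "\<delta> > 0"
  shows "\<exists>u'. perturbation A u \<delta> u' \<and>
    (\<forall>x\<in>topspace X. card {(a, g) \<in> A \<times> T. u' a (\<alpha> (inv g) x) = 0} \<le> d)"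
proof -
  have "finite (m_inv G ` T)" "m_inv G ` T \<subseteq> carrier G" using T by auto
  from free_cover[OF this] obtain I N C where "finite (I :: 'x set) \<and> topspace X \<subseteq> (\<Union>z\<in>I. N z) \<and>
    (\<forall>z\<in>I. openin X (N z) \<and> closedin X (C z) \<and> N z \<subseteq> C z \<and>
       (\<forall>g\<in>m_inv G ` T. \<forall>h\<in>m_inv G ` T. g \<noteq> h \<longrightarrow> (\<forall>x\<in>C z. \<forall>y\<in>C z. \<alpha> g x \<noteq> \<alpha> h y)))"
    by (elim exE)
  then have IC: "finite I" "topspace X \<subseteq> (\<Union>z\<in>I. N z)"
    "\<And>z. z \<in> I \<Longrightarrow> closedin X (C z) \<and> N z \<subseteq> C z \<and>
       (\<forall>g\<in>m_inv G ` T. \<forall>h\<in>m_inv G ` T. g \<noteq> h \<longrightarrow> (\<forall>x\<in>C z. \<forall>y\<in>C z. \<alpha> g x \<noteq> \<alpha> h y))"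
    by simp_all
  define Q where "Q = {S. S \<subseteq> A \<times> T \<and> card S = d + 1} \<times> C ` I"
  have finQ: "finite Q" unfolding Q_def using A T(1) IC(1) by simp
  have Q: "S \<subseteq> A \<times> T \<and> card S = d + 1 \<and> closedin X C' \<and>
      (\<forall>g\<in>T. \<forall>h\<in>T. g \<noteq> h \<longrightarrow> (\<forall>x\<in>C'. \<forall>y\<in>C'. \<alpha> (inv g) x \<noteq> \<alpha> (inv h) y))" if SC: "(S, C') \<in> Q" for S C'
  proof -
    obtain z where z: "z \<in> I" "C' = C z" using SC unfolding Q_def by auto
    have "inv g \<noteq> inv h" if "g \<in> T" "h \<in> T" "g \<noteq> h" for g h
      using that T(2) by (metis inv_inv subsetD)
    then show ?thesis using IC(3)[OF z(1)] SC z(2) unfolding Q_def by simp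
  qed
  have "\<exists>u'. perturbation A u \<delta> u' \<and> (\<exists>\<eta>>0. \<forall>(S, C)\<in>Q. in_general_position u' S C \<eta>)"
    by (rule perturb_finitely_many_conditions[OF dim T finQ Q u \<delta>])
  then obtain u' \<eta> where u': "perturbation A u \<delta> u'"
    and \<eta>: "\<eta> > 0" "\<forall>(S, C)\<in>Q. in_general_position u' S C \<eta>"
    by blast
  have "card {(a, g) \<in> A \<times> T. u' a (\<alpha> (inv g) x) = 0} \<le> d" if x: "x \<in> topspace X" for x
  proof (rule ccontr)
    let ?Z = "{(a, g) \<in> A \<times> T. u' a (\<alpha> (inv g) x) = 0}"
    assume "\<not> card ?Z \<le> d"
    then have "d + 1 \<le> card ?Z" by simp
    then obtain S where S: "S \<subseteq> ?Z" "card S = d + 1"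
      by (rule obtain_subset_with_card_n) (rule that; assumption)
    obtain z where z: "z \<in> I" "x \<in> N z" using IC(2) x by auto
    then have xC: "x \<in> C z" using IC(3) by auto
    have "(S, C z) \<in> Q" using S z(1) by (auto simp: Q_def)
    then have "\<eta> \<le> (\<Sum>(a, g)\<in>S. \<bar>u' a (\<alpha> (inv g) x)\<bar>)"
      using \<eta>(2) xC unfolding in_general_position_def by auto
    also have "\<dots> = 0" using S(1) by (intro sum.neutral) auto
    finally show False using \<eta>(1) by simp
  qed
  then show ?thesis using u' by blast
qed

end

section \<open>Free open sets\<close>

context free_compact_action
begin

definition free_for :: "'g set \<Rightarrow> 'x set \<Rightarrow> bool" where
  "free_for E Z \<longleftrightarrow> (\<forall>g\<in>E. \<forall>x\<in>Z. \<alpha> g x \<in> Z \<longrightarrow> g = \<one>)"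

lemma free_forD: "\<lbrakk>free_for E Z; g \<in> E; x \<in> Z; \<alpha> g x \<in> Z\<rbrakk> \<Longrightarrow> g = \<one>"
  unfolding free_for_def by blast

text \<open>The clause on the frontier of \<open>Z\<close> keeps the induction going: failures at a
  later stage occur at the frontier of the set built so far and must be traced back to the given
  sets \<open>U i\<close>.\<close>

definition greedy_set :: "'g set \<Rightarrow> 'g set \<Rightarrow> nat \<Rightarrow> (nat \<Rightarrow> 'x set) \<Rightarrow> 'x set \<Rightarrow> bool" where
  "greedy_set E T k U Z \<longleftrightarrow> openin X Z \<and> free_for E Z \<and>
     (\<forall>x\<in>X frontier_of Z. \<exists>g\<in>T. \<exists>i<k. \<alpha> g x \<in> X frontier_of (U i)) \<and>
     (\<forall>x\<in>(\<Union>i<k. U i). (\<exists>g\<in>E. \<alpha> g x \<in> Z) \<or> (\<exists>g\<in>T. \<exists>i<k. \<alpha> g x \<in> X frontier_of (U i)))"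

text \<open>The sets \<open>U 0, \<dots>, U (k - 1)\<close> are added one after the other, as far as freeness permits. A
  point of their union is missed only if a translate of it lies on the frontier of some \<open>U i\<close>; the
  set \<open>T\<close> of translations depends on \<open>E\<close> and \<open>k\<close> only.\<close>

lemma greedy_free_set:
  fixes k :: nat
  assumes E: "finite E" "E \<subseteq> carrier G" "\<one> \<in> E" "\<And>g. g \<in> E \<Longrightarrow> inv g \<in> E"
  shows "\<exists>T. finite T \<and> T \<subseteq> carrier G \<and> (\<forall>U. (\<forall>i<k. openin X (U i) \<and> free_for E (U i)) \<longrightarrow>
     (\<exists>Z. greedy_set E T k U Z))"
proof (induction k)
  case 0
  then show ?case by (intro exI[of _ "{}"]) (auto simp: greedy_set_def free_for_def)
next
  case (Suc k)
  from Suc.IH obtain T where T0: "finite T \<and> T \<subseteq> carrier G \<and> (\<forall>U. (\<forall>i<k. openin X (U i) \<and> free_for E (U i)) \<longrightarrow>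
     (\<exists>Z. greedy_set E T k U Z))" ..
  then have T: "finite T" "T \<subseteq> carrier G" by simp_all
  \<comment> \<open>Failures of the new stage are seen after a translation in \<open>E\<close>
    followed by one in \<open>T\<close>; the neutral element records the frontier of
    \<open>U k\<close> itself.\<close>
  define T' where "T' = insert \<one> (T \<union> (\<lambda>(g, h). g \<otimes> h) ` (T \<times> E))"
  have T': "finite T'" "T' \<subseteq> carrier G" "T \<subseteq> T'" "\<one> \<in> T'"
    using T E(1,2) by (auto simp: T'_def)
  have T'_mult: "g \<otimes> h \<in> T'" if "g \<in> T" "h \<in> E" for g h using that by (force simp: T'_def)
  have "\<exists>Z. greedy_set E T' (Suc k) U Z"
    if U: "\<forall>i<Suc k. openin X (U i) \<and> free_for E (U i)" for U
  proof -
    have "\<forall>i<k. openin X (U i) \<and> free_for E (U i)" using U by simp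
    then obtain Z where Z0: "greedy_set E T k U Z" using T0 by blast
    then have Z: "openin X Z" "free_for E Z" by (simp_all add: greedy_set_def)
    have ZX: "Z \<subseteq> topspace X" using openin_subset Z(1) by blast
    define P where "P x \<longleftrightarrow> (\<exists>g\<in>T. \<exists>i<k. \<alpha> g x \<in> X frontier_of (U i))" for x
    define P' where "P' x \<longleftrightarrow> (\<exists>g\<in>T'. \<exists>i<Suc k. \<alpha> g x \<in> X frontier_of (U i))" for x
    have PP': "P' x" if "P x" for x using that T'(3) unfolding P_def P'_def by (meson less_SucI subsetD)
    have ZP: "P x" if "x \<in> X frontier_of Z" for x using Z0 that unfolding greedy_set_def P_def by blast
    have cover: "(\<exists>g\<in>E. \<alpha> g x \<in> Z) \<or> P x" if "x \<in> U i" "i < k" for x i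
      using Z0 that unfolding greedy_set_def P_def by blast
    have PE: "P' x" if x: "x \<in> topspace X" and g: "g \<in> E" and Pg: "P (\<alpha> g x)" for x g
    proof -
      obtain h i where h: "h \<in> T" "i < k" "\<alpha> h (\<alpha> g x) \<in> X frontier_of (U i)"
        using Pg unfolding P_def by blast
      then have "\<alpha> (h \<otimes> g) x \<in> X frontier_of (U i)"
        using act_mult[of h g x] x g T(2) E(2) by (simp add: subset_iff)
      then show ?thesis unfolding P'_def using T'_mult[OF h(1) g] h(2) by (meson less_SucI)
    qed
    \<comment> \<open>The points that \<open>E\<close> moves into the closure of \<open>Z\<close>.
      The closure makes \<open>W\<close> closed, so \<open>U k - W\<close> is open; freeness of its
      union with \<open>Z\<close> follows as \<open>E\<close> is closed under inverses.\<close>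
    define W where "W = (\<Union>g\<in>E. {x \<in> topspace X. \<alpha> g x \<in> X closure_of Z})"
    have W: "closedin X W" unfolding W_def
      using E(1,2) by (intro closedin_Union) (auto intro!: closedin_continuous_map_preimage[OF act_cont])
    have Z_closure: "Z \<subseteq> X closure_of Z" using closure_of_subset[OF ZX] .
    have WP: "(\<exists>g\<in>E. \<alpha> g x \<in> Z) \<or> P' x" if x: "x \<in> W" for x
    proof -
      obtain g where g: "g \<in> E" "x \<in> topspace X" "\<alpha> g x \<in> X closure_of Z" using x unfolding W_def by blast
      then have "\<alpha> g x \<in> Z \<or> \<alpha> g x \<in> X frontier_of Z" using frontier_of_openin[OF Z(1)] by blast
      then show ?thesis using g ZP PE by blast
    qed
    \<comment> \<open>A frontier point of \<open>W\<close> has no \<open>E\<close>-translate in the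
      open set \<open>Z\<close>, so the translate that puts it into \<open>W\<close> lies on the
      frontier of \<open>Z\<close>.\<close>
    have frW: "P' x" if x: "x \<in> X frontier_of W" for x
    proof -
      have xW: "x \<in> W" using x frontier_of_subset_closedin[OF W] by blast
      have "\<not> (\<exists>g\<in>E. \<alpha> g x \<in> Z)"
      proof
        assume "\<exists>g\<in>E. \<alpha> g x \<in> Z"
        then obtain g where g: "g \<in> E" "\<alpha> g x \<in> Z" by blast
        have "openin X {x \<in> topspace X. \<alpha> g x \<in> Z}"
          using openin_continuous_map_preimage[OF act_cont Z(1)] g(1) E(2) by blast
        moreover have "{x \<in> topspace X. \<alpha> g x \<in> Z} \<subseteq> W" using g(1) Z_closure by (auto simp: W_def)
        moreover have "x \<in> {x \<in> topspace X. \<alpha> g x \<in> Z}" using g(2) xW closedin_subset[OF W] by blast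
        ultimately have "x \<in> X interior_of W" by (meson interior_of_maximal subsetD)
        then show False using x by (simp add: frontier_of_def)
      qed
      then show ?thesis using WP[OF xW] by blast
    qed
    define Z' where "Z' = Z \<union> (U k - W)"
    have Uk: "openin X (U k)" "free_for E (U k)" using U by auto
    have open_diff: "openin X (U k - W)" using Uk(1) W by blast
    have 1: "openin X Z'" unfolding Z'_def using Z(1) open_diff by blast
    have 2: "free_for E Z'"
      unfolding free_for_def
    proof (intro ballI impI)
      fix g x assume g: "g \<in> E" and x: "x \<in> Z'" and gx: "\<alpha> g x \<in> Z'"
      have xX: "x \<in> topspace X" using x openin_subset[OF 1] by blast
      consider "x \<in> Z" "\<alpha> g x \<in> Z" | "x \<in> U k" "\<alpha> g x \<in> U k" | "x \<in> Z" "\<alpha> g x \<notin> W"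
        | "x \<notin> W" "\<alpha> g x \<in> Z" using x gx unfolding Z'_def by blast
      then show "g = \<one>"
      proof cases
        case 1 then show ?thesis using free_forD[OF Z(2) g] by blast
      next
        case 2 then show ?thesis using free_forD[OF Uk(2) g] by blast
      next
        case 3
        have gc: "g \<in> carrier G" using g E(2) by blast
        have "\<alpha> (inv g) (\<alpha> g x) \<in> X closure_of Z" using act_inv(1)[OF gc xX] 3 Z_closure by auto
        then have "\<alpha> g x \<in> W" unfolding W_def using E(4)[OF g] act_closed[OF gc xX] by blast
        then show ?thesis using 3 by blast
      next
        case 4
        then have "x \<in> W" unfolding W_def using g xX Z_closure by blast
        then show ?thesis using 4 by blast
      qed
    qed
    have 3: "P' x" if x: "x \<in> X frontier_of Z'" for x
    proof -
      have xX: "x \<in> topspace X" using x frontier_of_subset_topspace by fastforce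
      have "x \<in> X closure_of Z'" "x \<notin> Z'" using x frontier_of_openin[OF 1] by auto
      then have x': "x \<in> X closure_of Z \<or> x \<in> X closure_of (U k - W)" "x \<notin> Z" "x \<notin> U k - W"
        unfolding Z'_def by auto
      \<comment> \<open>The frontier of \<open>Z'\<close> arises from those of \<open>Z\<close>, of
        \<open>W\<close> and of \<open>U k\<close>.\<close>
      then consider "x \<in> X frontier_of Z" | "x \<in> X closure_of (U k - W)" "x \<in> W" | "x \<in> X closure_of (U k - W)" "x \<notin> U k"
        using frontier_of_openin[OF Z(1)] by blast
      then show ?thesis
      proof cases
        case 1 then show ?thesis using ZP PP' by blast
      next
        case 2
        have "x \<notin> X interior_of W"
        proof
          assume i: "x \<in> X interior_of W"
          have "(X interior_of W) \<inter> (U k - W) \<noteq> {}"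
            using 2(1) i openin_interior_of[of X W] unfolding in_closure_of by blast
          then show False using interior_of_subset[of X W] by blast
        qed
        then have "x \<in> X frontier_of W" using 2(2) closure_of_closedin[OF W] by (simp add: frontier_of_def)
        then show ?thesis by (rule frW)
      next
        case 3
        have "x \<in> X closure_of (U k)" using 3(1) closure_of_mono[of "U k - W" "U k" X] by blast
        then have "\<alpha> \<one> x \<in> X frontier_of (U k)" using 3(2) frontier_of_openin[OF Uk(1)] act_one[OF xX] by simp
        then show ?thesis unfolding P'_def using T'(4) by blast
      qed
    qed
    have 4: "(\<exists>g\<in>E. \<alpha> g x \<in> Z') \<or> P' x" if x: "x \<in> U i" "i < Suc k" for x i
    proof (cases "i < k")
      case True
      then show ?thesis using cover[OF x(1)] PP' unfolding Z'_def by blast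
    next
      case False
      then have xU: "x \<in> U k" using x by (simp add: less_Suc_eq)
      show ?thesis
      proof (cases "x \<in> W")
        case True
        then show ?thesis using WP unfolding Z'_def by blast
      next
        case False
        have "x \<in> topspace X" using xU openin_subset[OF Uk(1)] by blast
        then have "\<alpha> \<one> x \<in> Z'" using False xU act_one by (simp add: Z'_def)
        then show ?thesis using E(3) by blast
      qed
    qed
    show ?thesis using 1 2 3 4 unfolding greedy_set_def P'_def by (intro exI[of _ Z']) blast
  qed
  then show ?case using T'(1,2) by blast
qed

text \<open>Run the greedy construction \<open>d + 1\<close> times, on independent perturbations of one free cover. A
  point missed every time would be a zero of \<open>d + 1\<close> of the translated functions.\<close>

lemma free_markers:
  assumes dim: "covering_dim_le X d"
    and E: "finite E" "E \<subseteq> carrier G" "\<one> \<in> E" "\<And>g. g \<in> E \<Longrightarrow> inv g \<in> E"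
  shows "\<exists>Z. (\<forall>l\<le>d. openin X (Z l) \<and> free_for E (Z l)) \<and>
    (\<forall>x\<in>topspace X. \<exists>l\<le>d. \<exists>g\<in>E. \<alpha> g x \<in> Z l)"
proof -
  from free_cover[OF E(1,2)] obtain I N C where "finite (I :: 'x set) \<and> topspace X \<subseteq> (\<Union>z\<in>I. N z) \<and>
    (\<forall>z\<in>I. openin X (N z) \<and> closedin X (C z) \<and> N z \<subseteq> C z \<and>
       (\<forall>g\<in>E. \<forall>h\<in>E. g \<noteq> h \<longrightarrow> (\<forall>x\<in>C z. \<forall>y\<in>C z. \<alpha> g x \<noteq> \<alpha> h y)))"
    by (elim exE)
  then have I: "finite I" "topspace X \<subseteq> (\<Union>z\<in>I. N z)" and N: "\<And>z. z \<in> I \<Longrightarrow> openin X (N z)"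
    and NC: "\<And>z. z \<in> I \<Longrightarrow> N z \<subseteq> C z"
    and C: "\<And>z g h x y. \<lbrakk>z \<in> I; g \<in> E; h \<in> E; g \<noteq> h; x \<in> C z; y \<in> C z\<rbrakk> \<Longrightarrow> \<alpha> g x \<noteq> \<alpha> h y"
    by simp_all
  have N_free: "free_for E (N z)" if z: "z \<in> I" for z
    unfolding free_for_def
  proof (intro ballI impI)
    fix g x assume g: "g \<in> E" "x \<in> N z" "\<alpha> g x \<in> N z"
    have "\<alpha> g x \<in> topspace X" using g(3) openin_subset[OF N[OF z]] by blast
    then have "\<alpha> g x = \<alpha> \<one> (\<alpha> g x)" using act_one by simp
    then show "g = \<one>" using C[OF z g(1) E(3), of x "\<alpha> g x"] g NC[OF z] by blast
  qed
  obtain v :: "'x \<Rightarrow> 'x \<Rightarrow> real" where v: "\<And>z. z \<in> I \<Longrightarrow> continuous_map X euclideanreal (v z)"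
    "\<And>z x. \<lbrakk>z \<in> I; x \<in> topspace X; v z x \<noteq> 0\<rbrakk> \<Longrightarrow> x \<in> N z"
    "\<And>x. x \<in> topspace X \<Longrightarrow> \<exists>z\<in>I. v z x = 1"
    using finite_open_cover_functions[OF compact Hausdorff I(1) N I(2)] by metis
  obtain e n where e: "bij_betw e {..<n::nat} I"
    using I(1) by (metis ex_bij_betw_nat_finite lessThan_atLeast0)
  have eI: "e i \<in> I" if "i < n" for i using e that bij_betwE by blast
  from greedy_free_set[OF E, of n] obtain T where T': "finite T \<and> T \<subseteq> carrier G \<and> (\<forall>U. (\<forall>i<n. openin X (U i) \<and> free_for E (U i)) \<longrightarrow>
     (\<exists>Z. greedy_set E T n U Z))" ..
  then have T: "finite T" "T \<subseteq> carrier G" by simp_all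
  \<comment> \<open>The first component of \<open>p\<close> indexes \<open>d + 1\<close> copies of
    one family, which the perturbation makes independent. The threshold 1/2 with error 1/4 leaves
    room on both sides: the perturbed function is positive where \<open>v\<close> is 1 and negative
    where \<open>v\<close> is 0.\<close>
  define u where "u p x = v (e (snd p)) x - 1/2" for p :: "nat \<times> nat" and x
  have u: "continuous_map X euclideanreal (u p)" if "p \<in> {..d} \<times> {..<n}" for p
    using v(1)[OF eI, of "snd p"] that unfolding u_def by (auto simp: continuous_map_atin intro!: tendsto_intros)
  have invT: "finite (m_inv G ` T)" "m_inv G ` T \<subseteq> carrier G" using T by auto
  have "\<exists>u'. perturbation ({..d} \<times> {..<n}) u (1/4) u' \<and>
      (\<forall>x\<in>topspace X. card {(a, g) \<in> ({..d} \<times> {..<n}) \<times> m_inv G ` T. u' a (\<alpha> (inv g) x) = 0} \<le> d)"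
    by (rule perturb_few_zeros[OF dim _ invT u]) auto
  then obtain u' where u': "perturbation ({..d} \<times> {..<n}) u (1/4) u'"
    and zeros: "\<And>x. x \<in> topspace X \<Longrightarrow>
      card {(a, g) \<in> ({..d} \<times> {..<n}) \<times> m_inv G ` T. u' a (\<alpha> (inv g) x) = 0} \<le> d" by blast
  define U where "U l i = {x \<in> topspace X. u' (l, i) x \<in> {0<..}}" for l i
  have u'_close: "\<bar>u' (l, i) x - (v (e i) x - 1/2)\<bar> \<le> 1/4" if "l \<le> d" "i < n" "x \<in> topspace X" for l i x
    using perturbationD(2)[OF u', of "(l, i)" x] that by (simp add: u_def)
  have u'_cont: "continuous_map X euclideanreal (u' (l, i))" if "l \<le> d" "i < n" for l i
    using perturbationD(1)[OF u', of "(l, i)"] that by simp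
  have U_open: "openin X (U l i)" if "l \<le> d" "i < n" for l i
    unfolding U_def by (rule openin_continuous_map_preimage[OF u'_cont[OF that]]) simp
  have U_sub: "U l i \<subseteq> N (e i)" if "l \<le> d" "i < n" for l i
    using u'_close[OF that] v(2)[OF eI[OF that(2)]] unfolding U_def by fastforce
  have U_free: "free_for E (U l i)" if "l \<le> d" "i < n" for l i
    using N_free[OF eI[OF that(2)]] U_sub[OF that] unfolding free_for_def by blast
  have U_cover: "x \<in> (\<Union>i<n. U l i)" if "l \<le> d" "x \<in> topspace X" for l x
  proof -
    obtain z where z: "z \<in> I" "v z x = 1" using v(3) \<open>x \<in> topspace X\<close> by blast
    then obtain i where i: "i < n" "z = e i" using e by (auto simp: bij_betw_def)
    then have "\<bar>u' (l, i) x - (1 - 1/2)\<bar> \<le> 1/4" using u'_close[OF that(1) i(1) that(2)] z(2) by simp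
    then have "u' (l, i) x > 0" by linarith
    then show ?thesis using i(1) that(2) by (auto simp: U_def)
  qed
  have U_frontier: "u' (l, i) x = 0" if "l \<le> d" "i < n" "x \<in> X frontier_of (U l i)" for l i x
  proof -
    have "U l i \<subseteq> {x \<in> topspace X. u' (l, i) x \<in> {0..}}" by (auto simp: U_def)
    moreover have "closedin X {x \<in> topspace X. u' (l, i) x \<in> {0..}}"
      by (rule closedin_continuous_map_preimage[OF u'_cont[OF that(1,2)]]) simp
    ultimately have "X closure_of (U l i) \<subseteq> {x \<in> topspace X. u' (l, i) x \<in> {0..}}"
      by (rule closure_of_minimal)
    moreover have "x \<in> X closure_of (U l i)" "x \<notin> U l i"
      using that(3) frontier_of_openin[OF U_open[OF that(1,2)]] by auto
    ultimately show ?thesis by (auto simp: U_def)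
  qed
  have "\<exists>Z. openin X Z \<and> free_for E Z \<and>
      (\<forall>x\<in>topspace X. (\<exists>g\<in>E. \<alpha> g x \<in> Z) \<or> (\<exists>g\<in>T. \<exists>i<n. \<alpha> g x \<in> X frontier_of (U l i)))" if l: "l \<le> d" for l
  proof -
    have "\<forall>i<n. openin X (U l i) \<and> free_for E (U l i)" using U_open[OF l] U_free[OF l] by blast
    then obtain Z where greedy: "greedy_set E T n (U l) Z" using T' by blast
    then have Z: "openin X Z" "free_for E Z" by (simp_all add: greedy_set_def)
    have Z0: "\<forall>x\<in>(\<Union>i<n. U l i). (\<exists>g\<in>E. \<alpha> g x \<in> Z) \<or> (\<exists>g\<in>T. \<exists>i<n. \<alpha> g x \<in> X frontier_of (U l i))"
      using greedy unfolding greedy_set_def by (elim conjE)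
    note Z' = bspec[OF Z0]
    show ?thesis using Z Z'[OF U_cover[OF l]] by (intro exI[of _ Z]) blast
  qed
  then obtain Z where Z: "\<And>l. l \<le> d \<Longrightarrow> openin X (Z l) \<and> free_for E (Z l) \<and>
      (\<forall>x\<in>topspace X. (\<exists>g\<in>E. \<alpha> g x \<in> Z l) \<or> (\<exists>g\<in>T. \<exists>i<n. \<alpha> g x \<in> X frontier_of (U l i)))" by metis
  have "\<exists>l\<le>d. \<exists>g\<in>E. \<alpha> g x \<in> Z l" if x: "x \<in> topspace X" for x
  proof (rule ccontr)
    assume none: "\<not> (\<exists>l\<le>d. \<exists>g\<in>E. \<alpha> g x \<in> Z l)"
    have "\<forall>l\<in>{..d}. \<exists>p. fst p \<in> T \<and> snd p < n \<and> \<alpha> (fst p) x \<in> X frontier_of (U l (snd p))"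
    proof
      fix l assume "l \<in> {..d}"
      then obtain g i where "g \<in> T" "i < n" "\<alpha> g x \<in> X frontier_of (U l i)" using Z none x by blast
      then show "\<exists>p. fst p \<in> T \<and> snd p < n \<and> \<alpha> (fst p) x \<in> X frontier_of (U l (snd p))"
        by (intro exI[of _ "(g, i)"]) simp
    qed
    then obtain p where p: "\<And>l. l \<le> d \<Longrightarrow> fst (p l) \<in> T \<and> snd (p l) < n \<and>
        \<alpha> (fst (p l)) x \<in> X frontier_of (U l (snd (p l)))" by (metis atMost_iff)
    \<comment> \<open>A missed point supplies, for each \<open>l\<close>, a zero with first index
      \<open>l\<close>; these \<open>d + 1\<close> zeros are distinct whatever the translations
      are.\<close>
    let ?Z = "{(a, g) \<in> ({..d} \<times> {..<n}) \<times> m_inv G ` T. u' a (\<alpha> (inv g) x) = 0}"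
    let ?f = "\<lambda>l. ((l, snd (p l)), inv (fst (p l)))"
    have "?f ` {..d} \<subseteq> ?Z"
    proof (rule image_subsetI)
      fix l assume "l \<in> {..d}"
      then have "l \<le> d" by simp
      have pl: "fst (p l) \<in> T" "snd (p l) < n" "u' (l, snd (p l)) (\<alpha> (fst (p l)) x) = 0"
        using p[OF \<open>l \<le> d\<close>] U_frontier[OF \<open>l \<le> d\<close>] by auto
      then have "inv (inv (fst (p l))) = fst (p l)" using T(2) by auto
      then show "((l, snd (p l)), inv (fst (p l))) \<in> ?Z" using pl \<open>l \<le> d\<close> by simp
    qed
    moreover have "finite (({..d} \<times> {..<n}) \<times> m_inv G ` T)" using T(1) by simp
    then have "finite ?Z" by (rule rev_finite_subset) auto
    ultimately have "card (?f ` {..d}) \<le> card ?Z" by (intro card_mono)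
    moreover have "card (?f ` {..d}) = d + 1" by (subst card_image) (auto simp: inj_on_def)
    ultimately show False using zeros[OF x] by linarith
  qed
  then show ?thesis using Z by blast
qed

end

section \<open>Rokhlin functions\<close>

context group
begin

lemma lcosets_eq_l_coset:
  assumes H: "subgroup H G" and c: "c \<in> lcosets H" "g \<in> c"
  shows "g \<in> carrier G" "c = g <# H"
proof -
  obtain a where a: "a \<in> carrier G" "c = a <# H" using c(1) by (auto simp: LCOSETS_def)
  show "g \<in> carrier G" using c(2) a H subgroup.subset by (fastforce simp: l_coset_def)
  show "c = g <# H" using l_repr_independence[OF _ a(1) H, of g] c(2) a(2) by simp
qed

lemma bij_betw_lcosets:
  assumes H: "subgroup H G" and k: "k \<in> carrier G"
  shows "bij_betw (\<lambda>c. k <# c) (lcosets H) (lcosets H)"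
proof (rule bij_betw_byWitness[where f' = "\<lambda>c. inv k <# c"])
  have Hc: "H \<subseteq> carrier G" using H subgroup.subset by blast
  have *: "g <# (a <# H) = (g \<otimes> a) <# H" if "g \<in> carrier G" "a \<in> carrier G" for g a
    using lcos_m_assoc[OF Hc that] .
  have inv: "g <# (inv g <# c) = c" if g: "g \<in> carrier G" and c: "c \<in> lcosets H" for g c
  proof -
    obtain a where a: "a \<in> carrier G" "c = a <# H" using c by (auto simp: LCOSETS_def)
    then have "g <# (inv g <# c) = (g \<otimes> (inv g \<otimes> a)) <# H" using g * by simp
    then show ?thesis using a g by (simp add: cancel_left)
  qed
  show "\<forall>c\<in>lcosets H. inv k <# (k <# c) = c" "\<forall>c\<in>lcosets H. k <# (inv k <# c) = c"
    using inv[of "inv k"] inv[of k] k by simp_all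
  show "(\<lambda>c. k <# c) ` (lcosets H) \<subseteq> lcosets H" "(\<lambda>c. inv k <# c) ` (lcosets H) \<subseteq> lcosets H"
    using k by (force simp: LCOSETS_def *)+
qed

lemma mem_l_coset_lcosets: "k \<in> carrier G \<Longrightarrow> g \<in> c \<Longrightarrow> k \<otimes> g \<in> k <# c"
  by (auto simp: l_coset_def)

end

context free_compact_action
begin

text \<open>\<open>V (l, g)\<close> is the preimage of \<open>Z l\<close> under
  \<open>\<alpha> g\<close>. Cover functions for these sets, transported by \<open>g\<close> and
  added up over \<open>g\<close>, live on \<open>Z l\<close>; cutting off at 1 preserves the value 1
  at some translate of each point.\<close>

lemma shrink_markers:
  assumes Z: "\<And>l. l \<le> (d::nat) \<Longrightarrow> openin X (Z l)" and E: "finite E" "E \<subseteq> carrier G"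
    and cover: "\<And>x. x \<in> topspace X \<Longrightarrow> \<exists>l\<le>d. \<exists>g\<in>E. \<alpha> g x \<in> Z l"
  shows "\<exists>\<psi>. \<forall>l\<le>d. continuous_map X euclideanreal (\<psi> l) \<and>
      (\<forall>x\<in>topspace X. 0 \<le> \<psi> l x \<and> \<psi> l x \<le> 1 \<and> (\<psi> l x \<noteq> 0 \<longrightarrow> x \<in> Z l)) \<and>
      (\<forall>x\<in>topspace X. \<exists>l\<le>d. \<exists>g\<in>E. \<psi> l (\<alpha> g x) = (1::real))"
proof -
  define V where "V p = {x \<in> topspace X. \<alpha> (snd p) x \<in> Z (fst p)}" for p
  have Ec: "g \<in> carrier G" if "g \<in> E" for g using that E by blast
  have fin: "finite ({..d} \<times> E)" using E by simp
  have op: "openin X (V p)" if "p \<in> {..d} \<times> E" for p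
    unfolding V_def using that Z Ec by (auto intro!: openin_continuous_map_preimage[OF act_cont])
  have cov: "topspace X \<subseteq> (\<Union>p\<in>{..d} \<times> E. V p)" using cover by (force simp: V_def)
  obtain v :: "nat \<times> 'g \<Rightarrow> 'x \<Rightarrow> real" where v: "\<And>p. p \<in> {..d} \<times> E \<Longrightarrow> continuous_map X euclideanreal (v p)"
    "\<And>p x. \<lbrakk>p \<in> {..d} \<times> E; x \<in> topspace X\<rbrakk> \<Longrightarrow> 0 \<le> v p x \<and> v p x \<le> 1"
    "\<And>p x. \<lbrakk>p \<in> {..d} \<times> E; x \<in> topspace X; v p x \<noteq> 0\<rbrakk> \<Longrightarrow> x \<in> V p"
    "\<And>x. x \<in> topspace X \<Longrightarrow> \<exists>p\<in>{..d} \<times> E. v p x = 1"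
    by (rule finite_open_cover_functions[OF compact Hausdorff fin _ cov], erule op) (rule that; assumption)
  define \<psi> where "\<psi> l x = min 1 (\<Sum>g\<in>E. v (l, g) (\<alpha> (inv g) x))" for l x
  have nonneg: "0 \<le> v (l, g) (\<alpha> (inv g) x)" if "l \<le> d" "g \<in> E" "x \<in> topspace X" for l g x
    using v(2)[of "(l, g)"] act_closed Ec that by simp
  have "continuous_map X euclideanreal (\<psi> l)" if "l \<le> d" for l
  proof -
    have "continuous_map X euclideanreal (\<lambda>x. v (l, g) (\<alpha> (inv g) x))" if "g \<in> E" for g
      using v(1)[of "(l, g)"] \<open>l \<le> d\<close> that Ec continuous_map_act[of "inv g"] by simp
    then show ?thesis unfolding \<psi>_def by (auto simp: continuous_map_atin intro!: tendsto_intros tendsto_min)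
  qed
  moreover have "0 \<le> \<psi> l x \<and> \<psi> l x \<le> 1" if "l \<le> d" "x \<in> topspace X" for l x
    unfolding \<psi>_def using nonneg[OF that(1) _ that(2)] by (simp add: sum_nonneg)
  moreover have "x \<in> Z l" if "l \<le> d" "x \<in> topspace X" "\<psi> l x \<noteq> 0" for l x
  proof -
    have "(\<Sum>g\<in>E. v (l, g) (\<alpha> (inv g) x)) \<noteq> 0" using that(3) by (auto simp: \<psi>_def)
    then obtain g where g: "g \<in> E" "v (l, g) (\<alpha> (inv g) x) \<noteq> 0"
      by (auto elim: sum.not_neutral_contains_not_neutral)
    then have "\<alpha> (inv g) x \<in> V (l, g)" using v(3)[of "(l, g)" "\<alpha> (inv g) x"] act_closed Ec that by simp
    then show ?thesis using act_inv(2)[OF Ec[OF g(1)] that(2)] by (simp add: V_def)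
  qed
  moreover have "\<exists>l\<le>d. \<exists>g\<in>E. \<psi> l (\<alpha> g x) = 1" if x: "x \<in> topspace X" for x
  proof -
    obtain l g where p: "l \<le> d" "g \<in> E" "v (l, g) x = 1" using v(4)[OF x] by auto
    have gx: "\<alpha> g x \<in> topspace X" "\<alpha> (inv g) (\<alpha> g x) = x" using act_closed act_inv(1) Ec p(2) x by auto
    have "v (l, g) (\<alpha> (inv g) (\<alpha> g x)) \<le> (\<Sum>h\<in>E. v (l, h) (\<alpha> (inv h) (\<alpha> g x)))"
      using nonneg[OF p(1) _ gx(1)] p(2) E(1) by (intro member_le_sum) auto
    then have "\<psi> l (\<alpha> g x) = 1" using p(3) gx(2) by (simp add: \<psi>_def)
    then show ?thesis using p by blast
  qed
  ultimately show ?thesis by (intro exI[of _ \<psi>]) simp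
qed

text \<open>Colour \<open>l\<close> combines the marker \<open>l div m\<close> with the tower
  function \<open>l mod m\<close>. At each point a colour has at most one non-zero term, across all
  cosets; this gives orthogonality, and an equivariance error that does not see the size of the
  support.\<close>

lemma rokhlin_functions:
  fixes \<epsilon> :: real
  assumes dim: "covering_dim_le X d" and towers: "has_towers {\<one>} m"
    and K: "finite K" "K \<subseteq> carrier G" and H: "subgroup H G" "finite (lcosets H)" and \<epsilon>: "\<epsilon> > 0"
  shows "\<exists>f. (\<forall>l<(d + 1) * m. \<forall>c\<in>lcosets H. continuous_map X euclideanreal (f l c)) \<and>
    (\<forall>l<(d + 1) * m. \<forall>c\<in>lcosets H. \<forall>x\<in>topspace X. 0 \<le> f l c x) \<and>
    (\<forall>l<(d + 1) * m. \<forall>c\<in>lcosets H. \<forall>c'\<in>lcosets H. \<forall>x\<in>topspace X. c \<noteq> c' \<longrightarrow> f l c x * f l c' x = 0) \<and>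
    (\<forall>x\<in>topspace X. (\<Sum>l<(d + 1) * m. \<Sum>c\<in>lcosets H. f l c x) = 1) \<and>
    (\<forall>l<(d + 1) * m. \<forall>c\<in>lcosets H. \<forall>x\<in>topspace X. \<forall>k\<in>K. \<bar>f l (k <# c) (\<alpha> k x) - f l c x\<bar> \<le> \<epsilon>)"
proof -
  define D where "D = (d + 1) * m"
  define L where "L = lcosets H"
  have L: "finite L" using H(2) by (simp add: L_def)
  \<comment> \<open>Each \<open>F l c\<close> is equivariant up to \<open>2 \<epsilon>'\<close>, and
    their sum over all colours and cosets is invariant up to \<open>D * card L\<close> times that;
    division by the sum adds both errors, which makes \<open>\<epsilon>\<close>.\<close>
  define \<epsilon>' where "\<epsilon>' = \<epsilon> / (2 * (1 + real D * real (card L)))"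
  have pos: "0 < 2 * (1 + real D * real (card L))" by (simp add: add_pos_nonneg)
  have \<epsilon>': "\<epsilon>' > 0" using \<epsilon> pos by (simp add: \<epsilon>'_def)
  have \<epsilon>'_eq: "2 * \<epsilon>' + real D * real (card L) * (2 * \<epsilon>') = \<epsilon>"
  proof -
    have "2 * \<epsilon>' + real D * real (card L) * (2 * \<epsilon>') = \<epsilon>' * (2 * (1 + real D * real (card L)))"
      by (simp add: algebra_simps)
    then show ?thesis using pos by (simp add: \<epsilon>'_def)
  qed
  obtain \<phi> where \<phi>: "tower_family {\<one>} m K \<epsilon>' \<phi>" using towers K \<epsilon>' unfolding has_towers_def by blast
  obtain R where R: "finite R" "R \<subseteq> carrier G"
    and R0: "\<And>j g. \<lbrakk>j < m; g \<in> carrier G; \<phi> j g \<noteq> 0\<rbrakk> \<Longrightarrow> \<exists>r\<in>R. inv r \<otimes> g \<in> {\<one>}"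
    by (rule tower_family_finite_support[OF \<phi>]) (rule that; assumption)
  have supp: "g \<in> R" if g: "j < m" "g \<in> carrier G" "\<phi> j g \<noteq> 0" for j g
  proof -
    obtain r where r: "r \<in> R" "inv r \<otimes> g = \<one>" using R0[OF g] by blast
    have "g = r \<otimes> (inv r \<otimes> g)" using r(1) R(2) g(2) by (simp add: cancel_left subset_iff)
    then show ?thesis using r R(2) by (simp add: subset_iff)
  qed
  have \<phi>01: "\<And>j g. \<lbrakk>j < m; g \<in> carrier G\<rbrakk> \<Longrightarrow> 0 \<le> \<phi> j g \<and> \<phi> j g \<le> 1"
    and \<phi>K: "\<And>j k g. \<lbrakk>j < m; k \<in> K; g \<in> carrier G\<rbrakk> \<Longrightarrow> \<bar>\<phi> j (k \<otimes> g) - \<phi> j g\<bar> \<le> \<epsilon>'"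
    and \<phi>1: "1 \<le> (\<Sum>j<m. \<phi> j \<one>)"
    and \<phi>S: "\<And>j g h. \<lbrakk>j < m; g \<in> carrier G; h \<in> carrier G; \<phi> j g \<noteq> 0; \<phi> j h \<noteq> 0\<rbrakk> \<Longrightarrow>
        1 \<le> (\<Sum>i<m. \<phi> i (inv g \<otimes> h))"
    using \<phi> unfolding tower_family_def by simp_all
  define E where "E = insert \<one> ((\<lambda>(g, h). inv g \<otimes> h) ` {(g, h) \<in> R \<times> R. \<exists>j<m. \<phi> j g \<noteq> 0 \<and> \<phi> j h \<noteq> 0})"
  have "finite {(g, h) \<in> R \<times> R. \<exists>j<m. \<phi> j g \<noteq> 0 \<and> \<phi> j h \<noteq> 0}"
    by (rule finite_subset[of _ "R \<times> R"]) (use R(1) in auto)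
  then have E: "finite E" "E \<subseteq> carrier G" "\<one> \<in> E" using R(2) by (auto simp: E_def)
  have E_mem: "inv g \<otimes> h \<in> E" if "j < m" "g \<in> carrier G" "h \<in> carrier G" "\<phi> j g \<noteq> 0" "\<phi> j h \<noteq> 0" for j g h
    unfolding E_def using that supp by (intro insertI2 rev_image_eqI[of "(g, h)"]) auto
  have E_sum: "1 \<le> (\<Sum>j<m. \<phi> j e)" if "e \<in> E" for e
    using that \<phi>1 \<phi>S R(2) unfolding E_def by auto
  have E_inv: "inv e \<in> E" if e: "e \<in> E" for e
  proof (cases "e = \<one>")
    case False
    then obtain g h j where "e = inv g \<otimes> h" "g \<in> R" "h \<in> R" "j < m" "\<phi> j g \<noteq> 0" "\<phi> j h \<noteq> 0"
      using e by (auto simp: E_def)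
    then show ?thesis using E_mem[of j h g] R(2) by (simp add: inv_mult_group subset_iff)
  qed (simp add: E(3))
  have "\<exists>Z. (\<forall>l\<le>d. openin X (Z l) \<and> free_for E (Z l)) \<and>
    (\<forall>x\<in>topspace X. \<exists>l\<le>d. \<exists>g\<in>E. \<alpha> g x \<in> Z l)"
    by (rule free_markers[OF dim E E_inv])
  then obtain Z where Z: "\<And>l. l \<le> d \<Longrightarrow> openin X (Z l)" "\<And>l. l \<le> d \<Longrightarrow> free_for E (Z l)"
    "\<And>x. x \<in> topspace X \<Longrightarrow> \<exists>l\<le>d. \<exists>g\<in>E. \<alpha> g x \<in> Z l" by blast
  obtain \<psi> where \<psi>0: "\<forall>l\<le>d. continuous_map X euclideanreal (\<psi> l) \<and>
      (\<forall>x\<in>topspace X. 0 \<le> \<psi> l x \<and> \<psi> l x \<le> 1 \<and> (\<psi> l x \<noteq> 0 \<longrightarrow> x \<in> Z l)) \<and>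
      (\<forall>x\<in>topspace X. \<exists>l\<le>d. \<exists>g\<in>E. \<psi> l (\<alpha> g x) = (1::real))"
    using shrink_markers[OF Z(1) E(1,2) Z(3)] by blast
  have \<psi>: "\<And>l. l \<le> d \<Longrightarrow> continuous_map X euclideanreal (\<psi> l)"
    "\<And>l x. \<lbrakk>l \<le> d; x \<in> topspace X\<rbrakk> \<Longrightarrow> 0 \<le> \<psi> l x \<and> \<psi> l x \<le> 1"
    "\<And>l x. \<lbrakk>l \<le> d; x \<in> topspace X; \<psi> l x \<noteq> 0\<rbrakk> \<Longrightarrow> x \<in> Z l"
    "\<And>x. x \<in> topspace X \<Longrightarrow> \<exists>l\<le>d. \<exists>g\<in>E. \<psi> l (\<alpha> g x) = 1"
    using \<psi>0 by blast+
  \<comment> \<open>Both translates of \<open>x\<close> lie in the marker set, and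
    \<open>g^-1 h \<in> E\<close> moves one to the other, so freeness forces
    \<open>g = h\<close>.\<close>
  have unique: "g = h"
    if "i \<le> d" "g \<in> carrier G" "h \<in> carrier G" "x \<in> topspace X" "inv g \<otimes> h \<in> E"
      "\<psi> i (\<alpha> (inv g) x) \<noteq> 0" "\<psi> i (\<alpha> (inv h) x) \<noteq> 0" for i g h x
  proof -
    have 1: "\<alpha> (inv g) x \<in> Z i" "\<alpha> (inv h) x \<in> Z i" using \<psi>(3)[OF that(1)] act_closed that by simp_all
    have "\<alpha> (inv g \<otimes> h) (\<alpha> (inv h) x) = \<alpha> (inv g) x"
      using act_mult[of "inv g" h "\<alpha> (inv h) x"] act_inv(2) act_closed that by simp
    then have "inv g \<otimes> h = \<one>" using free_forD[OF Z(2)[OF that(1)] that(5) 1(2)] 1(1) by simp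
    then show ?thesis using that by (metis inv_closed inv_equality inv_inv)
  qed
  define F where "F l c x = (\<Sum>g\<in>R \<inter> c. \<phi> (l mod m) g * \<psi> (l div m) (\<alpha> (inv g) x))" for l c x
  have m0: "m > 0" using \<phi>1 by (cases m) auto
  have l_div: "l div m \<le> d" "l mod m < m" if "l < D" for l
    using that m0 less_mult_imp_div_less[of l "d + 1" m] unfolding D_def by auto
  have term_nonneg: "0 \<le> \<phi> (l mod m) g * \<psi> (l div m) (\<alpha> (inv g) x)"
    if "l < D" "g \<in> carrier G" "x \<in> topspace X" for l g x
    using \<phi>01 \<psi>(2) l_div[OF that(1)] act_closed that by (simp add: mult_nonneg_nonneg)
  have F_nonneg: "0 \<le> F l c x" if "l < D" "x \<in> topspace X" for l c x
    unfolding F_def using term_nonneg[OF that(1) _ that(2)] R(2) by (intro sum_nonneg) blast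
  have F_cont: "continuous_map X euclideanreal (F l c)" if "l < D" for l c
  proof -
    have "continuous_map X euclideanreal (\<lambda>x. \<psi> (l div m) (\<alpha> (inv g) x))" if "g \<in> R" for g
      using continuous_map_act[of "inv g" euclideanreal "\<psi> (l div m)"] \<psi>(1) l_div[OF \<open>l < D\<close>] that R(2) by (simp add: subset_iff)
    then show ?thesis unfolding F_def by (auto simp: continuous_map_atin intro!: tendsto_intros)
  qed
  have F_orth: "F l c x * F l c' x = 0"
    if l: "l < D" and c: "c \<in> L" "c' \<in> L" "c \<noteq> c'" and x: "x \<in> topspace X" for l c c' x
  proof (rule ccontr)
    assume "F l c x * F l c' x \<noteq> 0"
    then have "F l c x \<noteq> 0" "F l c' x \<noteq> 0" by auto
    then obtain g h where "g \<in> R \<inter> c" "\<phi> (l mod m) g * \<psi> (l div m) (\<alpha> (inv g) x) \<noteq> 0"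
      "h \<in> R \<inter> c'" "\<phi> (l mod m) h * \<psi> (l div m) (\<alpha> (inv h) x) \<noteq> 0"
      unfolding F_def by (elim sum.not_neutral_contains_not_neutral)
    then have g: "g \<in> R \<inter> c" "\<phi> (l mod m) g \<noteq> 0" "\<psi> (l div m) (\<alpha> (inv g) x) \<noteq> 0"
      and h: "h \<in> R \<inter> c'" "\<phi> (l mod m) h \<noteq> 0" "\<psi> (l div m) (\<alpha> (inv h) x) \<noteq> 0" by auto
    have "g = h" using unique[of "l div m" g h x] E_mem[of "l mod m" g h] l_div[OF l] g h x R(2) by blast
    then show False using lcosets_eq_l_coset(2)[OF H(1)] g(1) h(1) c unfolding L_def by (metis IntD2)
  qed
  define s where "s x = (\<Sum>l<D. \<Sum>c\<in>L. F l c x)" for x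
  have s_ge: "1 \<le> s x" if x: "x \<in> topspace X" for x
  proof -
    obtain i g where ig: "i \<le> d" "g \<in> E" "\<psi> i (\<alpha> g x) = 1" using \<psi>(4)[OF x] by blast
    \<comment> \<open>The term at \<open>e = g^-1\<close> has \<open>\<psi>\<close> equal to 1, and
      \<open>e \<in> E\<close> by symmetry. Hence the colours with marker \<open>i\<close>
      contribute at least the tower sum at \<open>e\<close>, which is at least 1.\<close>
    define e where "e = inv g"
    have e: "e \<in> E" "e \<in> carrier G" "inv e = g" using ig(2) E_inv E(2) by (auto simp: e_def)
    have eL: "e <# H \<in> L" using e(2) by (auto simp: L_def LCOSETS_def)
    have eH: "e \<in> e <# H" using e(2) subgroup.one_closed[OF H(1)] by (force simp: l_coset_def)
    have lt: "i * m + j < D" if "j < m" for j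
    proof -
      have "i * m + j < i * m + m" using that by simp
      also have "\<dots> = (i + 1) * m" by simp
      also have "\<dots> \<le> D" unfolding D_def using ig(1) by (intro mult_right_mono) auto
      finally show ?thesis .
    qed
    have "\<phi> j e \<le> (\<Sum>c\<in>L. F (i * m + j) c x)" if j: "j < m" for j
    proof (cases "\<phi> j e = 0")
      case True
      then show ?thesis using F_nonneg[OF lt[OF j] x] by (simp add: sum_nonneg)
    next
      case False
      have "\<phi> j e = \<phi> ((i * m + j) mod m) e * \<psi> ((i * m + j) div m) (\<alpha> (inv e) x)"
        using j ig(3) e(3) by simp
      also have "\<dots> \<le> F (i * m + j) (e <# H) x"
        unfolding F_def using supp[OF j e(2) False] eH R term_nonneg[OF lt[OF j] _ x]
        by (intro member_le_sum) auto
      also have "\<dots> \<le> (\<Sum>c\<in>L. F (i * m + j) c x)"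
        using eL L F_nonneg[OF lt[OF j] x] by (intro member_le_sum) auto
      finally show ?thesis .
    qed
    then have "(\<Sum>j<m. \<phi> j e) \<le> (\<Sum>j<m. \<Sum>c\<in>L. F (i * m + j) c x)" by (intro sum_mono) auto
    also have "\<dots> = (\<Sum>l\<in>(\<lambda>j. i * m + j) ` {..<m}. \<Sum>c\<in>L. F l c x)"
      by (subst sum.reindex) (auto simp: inj_on_def)
    also have "\<dots> \<le> s x"
      unfolding s_def using lt F_nonneg[OF _ x] by (intro sum_mono2) (auto intro!: sum_nonneg)
    finally show ?thesis using E_sum[OF e(1)] by linarith
  qed
  have F_le_s: "F l c x \<le> s x" if "l < D" "c \<in> L" "x \<in> topspace X" for l c x
  proof -
    have "F l c x \<le> (\<Sum>c\<in>L. F l c x)" using that L F_nonneg by (intro member_le_sum) auto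
    also have "\<dots> \<le> s x" unfolding s_def using that F_nonneg
      by (intro member_le_sum[where f = "\<lambda>l. \<Sum>c\<in>L. F l c x"]) (auto intro!: sum_nonneg)
    finally show ?thesis .
  qed
  have F_equiv: "\<bar>F l (k <# c) (\<alpha> k x) - F l c x\<bar> \<le> 2 * \<epsilon>'"
    if l: "l < D" and k: "k \<in> K" and c: "c \<in> L" and x: "x \<in> topspace X" for l k c x
  proof -
    let ?\<phi> = "\<phi> (l mod m)" and ?\<psi> = "\<lambda>g. \<psi> (l div m) (\<alpha> (inv g) x)"
    have kc: "k \<in> carrier G" using k K by blast
    have cc: "c \<subseteq> carrier G" using lcosets_eq_l_coset(1)[OF H(1)] c unfolding L_def by blast
    \<comment> \<open>After the substitution of \<open>k g\<close> for \<open>g\<close> in the first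
      sum, this set contains the relevant indices of both sums.\<close>
    define R2 where "R2 = (R \<union> (\<lambda>g. inv k \<otimes> g) ` R) \<inter> c"
    have R2: "finite R2" "R2 \<subseteq> c" "R2 \<subseteq> carrier G" using R(1) cc by (auto simp: R2_def)
    \<comment> \<open>Uniqueness leaves at most one element in each of \<open>B1\<close> and
      \<open>B2\<close>, so at most two terms of the difference survive; this is the origin of
      \<open>2 \<epsilon>'\<close>.\<close>
    define B1 where "B1 = {g \<in> R2. ?\<psi> g \<noteq> 0 \<and> ?\<phi> g \<noteq> 0}"
    define B2 where "B2 = {g \<in> R2. ?\<psi> g \<noteq> 0 \<and> ?\<phi> (k \<otimes> g) \<noteq> 0}"
    have 1: "F l c x = (\<Sum>g\<in>R2. ?\<phi> g * ?\<psi> g)"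
      unfolding F_def
    proof (rule sum.mono_neutral_left)
      show "\<forall>g\<in>R2 - R \<inter> c. ?\<phi> g * ?\<psi> g = 0" using supp[OF l_div(2)[OF l]] R2 by auto
    qed (use R2 in \<open>auto simp: R2_def\<close>)
    have "F l (k <# c) (\<alpha> k x) = (\<Sum>g\<in>(\<lambda>g. k \<otimes> g) ` R2. ?\<phi> g * \<psi> (l div m) (\<alpha> (inv g) (\<alpha> k x)))"
      unfolding F_def
    proof (rule sum.mono_neutral_left)
      show "R \<inter> (k <# c) \<subseteq> (\<lambda>g. k \<otimes> g) ` R2"
      proof
        fix g assume g: "g \<in> R \<inter> (k <# c)"
        then obtain h where h: "h \<in> c" "g = k \<otimes> h" by (auto simp: l_coset_def)
        then have "inv k \<otimes> g = h" using kc cc by (simp add: cancel_left subset_iff)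
        then have "h \<in> (\<lambda>g. inv k \<otimes> g) ` R" using g by (intro image_eqI[of _ _ g]) auto
        then have "h \<in> R2" using h by (simp add: R2_def)
        then show "g \<in> (\<lambda>g. k \<otimes> g) ` R2" using h by blast
      qed
      show "\<forall>g\<in>(\<lambda>g. k \<otimes> g) ` R2 - R \<inter> (k <# c). ?\<phi> g * \<psi> (l div m) (\<alpha> (inv g) (\<alpha> k x)) = 0"
      proof
        fix g assume g: "g \<in> (\<lambda>g. k \<otimes> g) ` R2 - R \<inter> (k <# c)"
        then have "g \<in> k <# c" "g \<in> carrier G" using R2 kc mem_l_coset_lcosets by auto
        then have "g \<notin> R" using g by blast
        then have "?\<phi> g = 0" using supp[OF l_div(2)[OF l]] \<open>g \<in> carrier G\<close> by blast
        then show "?\<phi> g * \<psi> (l div m) (\<alpha> (inv g) (\<alpha> k x)) = 0" by simp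
      qed
    qed (use R2 in simp)
    also have "\<dots> = (\<Sum>g\<in>R2. ?\<phi> (k \<otimes> g) * \<psi> (l div m) (\<alpha> (inv (k \<otimes> g)) (\<alpha> k x)))"
      using R2(3) kc by (subst sum.reindex) (auto simp: inj_on_def subset_iff)
    also have "\<dots> = (\<Sum>g\<in>R2. ?\<phi> (k \<otimes> g) * ?\<psi> g)"
    proof (rule sum.cong)
      fix g assume "g \<in> R2"
      then have g: "g \<in> carrier G" using R2 by blast
      have "\<alpha> (inv (k \<otimes> g)) (\<alpha> k x) = \<alpha> (inv (k \<otimes> g) \<otimes> k) x" using act_mult g kc x by simp
      also have "inv (k \<otimes> g) \<otimes> k = inv g" using g kc by (simp add: inv_mult_group m_assoc)
      finally show "?\<phi> (k \<otimes> g) * \<psi> (l div m) (\<alpha> (inv (k \<otimes> g)) (\<alpha> k x)) = ?\<phi> (k \<otimes> g) * ?\<psi> g" by simp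
    qed simp
    finally have "F l (k <# c) (\<alpha> k x) - F l c x = (\<Sum>g\<in>R2. (?\<phi> (k \<otimes> g) - ?\<phi> g) * ?\<psi> g)"
      unfolding 1 by (simp add: sum_subtractf left_diff_distrib)
    also have "\<dots> = (\<Sum>g\<in>B1 \<union> B2. (?\<phi> (k \<otimes> g) - ?\<phi> g) * ?\<psi> g)"
      using R2(1) by (intro sum.mono_neutral_right) (auto simp: B1_def B2_def)
    finally have eq: "F l (k <# c) (\<alpha> k x) - F l c x = (\<Sum>g\<in>B1 \<union> B2. (?\<phi> (k \<otimes> g) - ?\<phi> g) * ?\<psi> g)" .
    have "\<bar>(?\<phi> (k \<otimes> g) - ?\<phi> g) * ?\<psi> g\<bar> \<le> \<epsilon>'" if "g \<in> B1 \<union> B2" for g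
    proof -
      have g: "g \<in> carrier G" using that R2 by (auto simp: B1_def B2_def)
      have "0 \<le> ?\<psi> g \<and> ?\<psi> g \<le> 1" using \<psi>(2)[OF l_div(1)[OF l]] act_closed g x by simp
      moreover have "\<bar>?\<phi> (k \<otimes> g) - ?\<phi> g\<bar> \<le> \<epsilon>'" using \<phi>K[OF l_div(2)[OF l] k g] .
      ultimately show ?thesis
        using mult_mono[of "\<bar>?\<phi> (k \<otimes> g) - ?\<phi> g\<bar>" \<epsilon>' "?\<psi> g" 1] \<epsilon>' by (simp add: abs_mult)
    qed
    then have "\<bar>\<Sum>g\<in>B1 \<union> B2. (?\<phi> (k \<otimes> g) - ?\<phi> g) * ?\<psi> g\<bar> \<le> real (card (B1 \<union> B2)) * \<epsilon>'"
      by (intro order_trans[OF sum_abs sum_bounded_above])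
    also have "\<dots> \<le> 2 * \<epsilon>'"
    proof (intro mult_right_mono)
      have B: "finite B1" "finite B2" using R2(1) by (auto simp: B1_def B2_def)
      have "g = h" if "g \<in> B1" "h \<in> B1" for g h
      proof -
        have gh: "g \<in> carrier G" "h \<in> carrier G" using that R2 by (auto simp: B1_def)
        then have "inv g \<otimes> h \<in> E" using E_mem[OF l_div(2)[OF l]] that by (auto simp: B1_def)
        then show ?thesis using unique[OF l_div(1)[OF l] gh x] that by (auto simp: B1_def)
      qed
      then have "card B1 \<le> Suc 0" using card_le_Suc0_iff_eq[OF B(1)] by blast
      moreover have "g = h" if "g \<in> B2" "h \<in> B2" for g h
      proof -
        have gh: "g \<in> carrier G" "h \<in> carrier G" using that R2 by (auto simp: B2_def)
        have "inv (k \<otimes> g) \<otimes> (k \<otimes> h) \<in> E"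
          using E_mem[OF l_div(2)[OF l], of "k \<otimes> g" "k \<otimes> h"] that gh kc by (simp add: B2_def)
        moreover have "inv (k \<otimes> g) \<otimes> (k \<otimes> h) = inv g \<otimes> h" using gh kc by (simp add: group_word)
        ultimately show ?thesis using unique[OF l_div(1)[OF l] gh x] that by (simp add: B2_def)
      qed
      then have "card B2 \<le> Suc 0" using card_le_Suc0_iff_eq[OF B(2)] by blast
      ultimately show "real (card (B1 \<union> B2)) \<le> 2" using card_Un_le[of B1 B2] by linarith
    qed (use \<epsilon>' in simp)
    finally show ?thesis unfolding eq .
  qed
  \<comment> \<open>Left translation by \<open>k\<close> permutes the cosets, so the sum over all of
    them is almost invariant.\<close>
  have s_equiv: "\<bar>s (\<alpha> k x) - s x\<bar> \<le> real D * real (card L) * (2 * \<epsilon>')"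
    if k: "k \<in> K" and x: "x \<in> topspace X" for k x
  proof -
    have kc: "k \<in> carrier G" using k K by blast
    have "(\<Sum>c\<in>L. F l c (\<alpha> k x)) = (\<Sum>c\<in>L. F l (k <# c) (\<alpha> k x))" for l
      using sum.reindex_bij_betw[OF bij_betw_lcosets[OF H(1) kc], of "\<lambda>c. F l c (\<alpha> k x)"] by (simp add: L_def)
    then have "s (\<alpha> k x) - s x = (\<Sum>l<D. \<Sum>c\<in>L. F l (k <# c) (\<alpha> k x) - F l c x)"
      unfolding s_def by (simp add: sum_subtractf)
    also have "\<bar>\<dots>\<bar> \<le> (\<Sum>l<D. \<bar>\<Sum>c\<in>L. F l (k <# c) (\<alpha> k x) - F l c x\<bar>)" by (rule sum_abs)
    also have "\<dots> \<le> (\<Sum>l<D. \<Sum>c\<in>L. \<bar>F l (k <# c) (\<alpha> k x) - F l c x\<bar>)" by (intro sum_mono sum_abs)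
    also have "\<dots> \<le> (\<Sum>l<D. \<Sum>c\<in>L. 2 * \<epsilon>')" using F_equiv k x by (intro sum_mono) auto
    finally show ?thesis by simp
  qed
  define f where "f l c x = F l c x / s x" for l c x
  have s_cont: "continuous_map X euclideanreal s"
    unfolding s_def using F_cont by (auto simp: continuous_map_atin intro!: tendsto_intros)
  have "continuous_map X euclideanreal (f l c)" if "l < D" for l c
    unfolding continuous_map_atin f_def
  proof (intro ballI)
    fix x assume x: "x \<in> topspace X"
    then have "s x \<noteq> 0" using s_ge[OF x] by auto
    then have "((\<lambda>x. F l c x / s x) \<longlongrightarrow> F l c x / s x) (atin X x)"
      using F_cont[OF that, of c] s_cont x by (intro tendsto_divide) (simp_all add: continuous_map_atin)
    then show "limitin euclideanreal (\<lambda>x. F l c x / s x) (F l c x / s x) (atin X x)" by simp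
  qed
  moreover have "0 \<le> f l c x" if "l < D" "x \<in> topspace X" for l c x
    using F_nonneg[OF that] s_ge[OF that(2)] by (simp add: f_def)
  moreover have "f l c x * f l c' x = 0" if "l < D" "c \<in> L" "c' \<in> L" "x \<in> topspace X" "c \<noteq> c'" for l c c' x
    using F_orth[of l c c' x] that by (simp add: f_def)
  moreover have "(\<Sum>l<D. \<Sum>c\<in>L. f l c x) = 1" if "x \<in> topspace X" for x
    using s_ge[OF that] unfolding f_def sum_divide_distrib[symmetric] s_def[symmetric] by simp
  moreover have "\<bar>f l (k <# c) (\<alpha> k x) - f l c x\<bar> \<le> \<epsilon>"
    if l: "l < D" and c: "c \<in> L" and x: "x \<in> topspace X" and k: "k \<in> K" for l c x k
  proof -
    let ?a = "F l (k <# c) (\<alpha> k x)" and ?b = "F l c x" and ?s = "s (\<alpha> k x)" and ?t = "s x"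
    have kc: "k \<in> carrier G" using k K by blast
    have s1: "?s \<ge> 1" "?t \<ge> 1" using s_ge act_closed kc x by auto
    \<comment> \<open>The splitting exploits \<open>s \<ge> 1\<close> and \<open>F \<le> s\<close>:
      division by \<open>?s\<close> only decreases the errors, and the factor \<open>?b / ?t\<close>
      is at most 1.\<close>
    have "?a / ?s - ?b / ?t = (?a - ?b) / ?s + (?b / ?t) * ((?t - ?s) / ?s)"
      using s1 by (simp add: field_simps)
    also have "\<bar>\<dots>\<bar> \<le> \<bar>?a - ?b\<bar> / ?s + (?b / ?t) * (\<bar>?t - ?s\<bar> / ?s)"
      using s1 F_nonneg[OF l x, of c]
      by (intro order_trans[OF abs_triangle_ineq] add_mono) (simp_all add: abs_mult)
    also have "\<dots> \<le> \<bar>?a - ?b\<bar> + 1 * \<bar>?t - ?s\<bar>"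
    proof (intro add_mono mult_mono)
      show "\<bar>?a - ?b\<bar> / ?s \<le> \<bar>?a - ?b\<bar>" "\<bar>?t - ?s\<bar> / ?s \<le> \<bar>?t - ?s\<bar>"
        using s1 mult_left_mono[OF s1(1), of "\<bar>?a - ?b\<bar>"] mult_left_mono[OF s1(1), of "\<bar>?t - ?s\<bar>"]
        by (simp_all add: divide_le_eq)
      show "?b / ?t \<le> 1" using F_le_s[OF l c x] s1 by simp
    qed (use s1 in auto)
    also have "\<dots> \<le> \<epsilon>" using F_equiv[OF l k c x] s_equiv[OF k x] \<epsilon>'_eq by (simp add: abs_minus_commute)
    finally show ?thesis by (simp add: f_def)
  qed
  ultimately show ?thesis
    unfolding D_def[symmetric] L_def[symmetric] by (intro exI[of _ f] conjI allI ballI impI; simp)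
qed

end

section \<open>Central sequences of function algebras\<close>

lemma C_alg_sel:
  "carrier (C_alg X) = {f \<in> extensional (topspace X). continuous_map X euclidean f}"
  "f \<otimes>\<^bsub>C_alg X\<^esub> g = (\<lambda>x\<in>topspace X. f x * g x)"
  "\<one>\<^bsub>C_alg X\<^esub> = (\<lambda>x\<in>topspace X. 1)"
  "\<zero>\<^bsub>C_alg X\<^esub> = (\<lambda>x\<in>topspace X. 0)"
  "f \<oplus>\<^bsub>C_alg X\<^esub> g = (\<lambda>x\<in>topspace X. f x + g x)"
  "csmult (C_alg X) c f = (\<lambda>x\<in>topspace X. c * f x)"
  "star (C_alg X) f = (\<lambda>x\<in>topspace X. cnj (f x))"
  "anorm (C_alg X) f = Sup (insert 0 ((\<lambda>x. cmod (f x)) ` topspace X))"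
  by (simp_all add: C_alg_def)

lemma continuous_map_complex_iff:
  fixes f :: "'x \<Rightarrow> complex"
  shows "continuous_map X euclidean f \<longleftrightarrow> (\<forall>x\<in>topspace X. (f \<longlongrightarrow> f x) (atin X x))"
  by (simp add: continuous_map_atin)

lemma restrict_mem_C_alg:
  "continuous_map X euclidean f \<Longrightarrow> (\<lambda>x\<in>topspace X. f x) \<in> carrier (C_alg X)"
  unfolding C_alg_sel by (auto intro: continuous_map_eq)

lemma C_alg_ext:
  "\<lbrakk>f \<in> carrier (C_alg X); g \<in> carrier (C_alg X); \<And>x. x \<in> topspace X \<Longrightarrow> f x = g x\<rbrakk> \<Longrightarrow> f = g"
  unfolding C_alg_sel(1) by (rule extensionalityI[of f "topspace X"]) auto

lemma C_alg_closed:
  "f \<in> carrier (C_alg X) \<Longrightarrow> g \<in> carrier (C_alg X) \<Longrightarrow> f \<otimes>\<^bsub>C_alg X\<^esub> g \<in> carrier (C_alg X)"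
  "f \<in> carrier (C_alg X) \<Longrightarrow> g \<in> carrier (C_alg X) \<Longrightarrow> f \<oplus>\<^bsub>C_alg X\<^esub> g \<in> carrier (C_alg X)"
  "\<one>\<^bsub>C_alg X\<^esub> \<in> carrier (C_alg X)" "\<zero>\<^bsub>C_alg X\<^esub> \<in> carrier (C_alg X)"
  "f \<in> carrier (C_alg X) \<Longrightarrow> csmult (C_alg X) c f \<in> carrier (C_alg X)"
  "f \<in> carrier (C_alg X) \<Longrightarrow> star (C_alg X) f \<in> carrier (C_alg X)"
  unfolding C_alg_sel(2-7)
  by (intro restrict_mem_C_alg; auto simp: C_alg_sel(1) continuous_map_complex_iff intro!: tendsto_intros)+

lemma abelian_monoid_C_alg: "abelian_monoid (C_alg X)"
proof (rule abelian_monoidI)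
  show "f \<oplus>\<^bsub>C_alg X\<^esub> g \<oplus>\<^bsub>C_alg X\<^esub> h = f \<oplus>\<^bsub>C_alg X\<^esub> (g \<oplus>\<^bsub>C_alg X\<^esub> h)" for f g h
    by (auto simp: C_alg_sel add.assoc restrict_def)
  show "f \<oplus>\<^bsub>C_alg X\<^esub> g = g \<oplus>\<^bsub>C_alg X\<^esub> f" for f g
    by (auto simp: C_alg_sel add.commute)
  show "\<zero>\<^bsub>C_alg X\<^esub> \<oplus>\<^bsub>C_alg X\<^esub> f = f" if "f \<in> carrier (C_alg X)" for f
    using that by (intro C_alg_ext[of _ X] C_alg_closed) (auto simp: C_alg_sel(4,5))
qed (rule C_alg_closed; assumption?)+

lemma C_alg_finsum:
  assumes "finite I" "\<And>i. i \<in> I \<Longrightarrow> f i \<in> carrier (C_alg X)" "x \<in> topspace X"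
  shows "(\<Oplus>\<^bsub>C_alg X\<^esub>i\<in>I. f i) x = (\<Sum>i\<in>I. f i x)"
proof -
  interpret abelian_monoid "C_alg X" by (rule abelian_monoid_C_alg)
  show ?thesis using assms
  proof (induction I rule: finite_induct)
    case empty
    then show ?case by (simp add: C_alg_sel)
  next
    case (insert i I)
    then have "(\<Oplus>\<^bsub>C_alg X\<^esub>i\<in>insert i I. f i) = f i \<oplus>\<^bsub>C_alg X\<^esub> (\<Oplus>\<^bsub>C_alg X\<^esub>i\<in>I. f i)"
      by (intro finsum_insert) auto
    then show ?case using insert by (simp add: C_alg_sel(5))
  qed
qed

locale compact_function_algebra =
  fixes X :: "'x topology"
  assumes compact: "compact_space X"
begin

abbreviation "A \<equiv> C_alg X"

lemma C_alg_bounded: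
  assumes f: "f \<in> carrier A"
  shows "bdd_above (insert 0 ((\<lambda>x. cmod (f x)) ` topspace X))"
proof -
  have "compactin euclidean (f ` topspace X)"
    using image_compactin[of X "topspace X" euclidean f] compact f by (simp add: compact_space_def C_alg_sel)
  then have "bounded (f ` topspace X)" by (simp add: compact_imp_bounded)
  then obtain B where "\<forall>x\<in>topspace X. cmod (f x) \<le> B" by (auto simp: bounded_iff)
  then show ?thesis by (auto intro!: bdd_aboveI2)
qed

lemma cmod_le_anorm: "\<lbrakk>f \<in> carrier A; x \<in> topspace X\<rbrakk> \<Longrightarrow> cmod (f x) \<le> anorm A f"
  unfolding C_alg_sel(8) by (rule cSup_upper[OF _ C_alg_bounded]) auto

lemma anorm_nonneg: "f \<in> carrier A \<Longrightarrow> 0 \<le> anorm A f"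
  unfolding C_alg_sel(8) by (rule cSup_upper[OF _ C_alg_bounded]) auto

lemma anorm_le: "\<lbrakk>0 \<le> B; \<And>x. x \<in> topspace X \<Longrightarrow> cmod (f x) \<le> B\<rbrakk> \<Longrightarrow> anorm A f \<le> B"
  unfolding C_alg_sel by (rule cSup_least) auto

text \<open>The elements of \<open>ell_infty A\<close>, described by values instead of norms so that
  suprema stay out of the estimates.\<close>

definition bounded_seq :: "(nat \<Rightarrow> 'x \<Rightarrow> complex) \<Rightarrow> bool" where
  "bounded_seq s \<longleftrightarrow> (\<forall>n. s n \<in> carrier A) \<and> (\<exists>B. \<forall>n. \<forall>x\<in>topspace X. cmod (s n x) \<le> B)"

text \<open>Uniform convergence of the difference to 0, stated for values because the algebra record
  carries no subtraction.\<close>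

definition asymp_eq :: "(nat \<Rightarrow> 'x \<Rightarrow> complex) \<Rightarrow> (nat \<Rightarrow> 'x \<Rightarrow> complex) \<Rightarrow> bool" where
  "asymp_eq s t \<longleftrightarrow> (\<forall>\<epsilon>>0. \<exists>N. \<forall>n\<ge>N. \<forall>x\<in>topspace X. cmod (s n x - t n x) \<le> \<epsilon>)"

text \<open>For bounded \<open>s\<close>, the coset of \<open>s\<close> modulo
  \<open>c_zero A\<close>, as \<open>c_zero_coset\<close> will show.\<close>

definition seq_class :: "(nat \<Rightarrow> 'x \<Rightarrow> complex) \<Rightarrow> (nat \<Rightarrow> 'x \<Rightarrow> complex) set" where
  "seq_class s = {t. bounded_seq t \<and> asymp_eq s t}"

lemma ell_infty_sel:
  "carrier (ell_infty A) = Collect bounded_seq"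
  "(s \<otimes>\<^bsub>ell_infty A\<^esub> t) = (\<lambda>n. s n \<otimes>\<^bsub>A\<^esub> t n)"
  "\<one>\<^bsub>ell_infty A\<^esub> = (\<lambda>n. \<one>\<^bsub>A\<^esub>)"
  "\<zero>\<^bsub>ell_infty A\<^esub> = (\<lambda>n. \<zero>\<^bsub>A\<^esub>)"
  "(s \<oplus>\<^bsub>ell_infty A\<^esub> t) = (\<lambda>n. s n \<oplus>\<^bsub>A\<^esub> t n)"
  "csmult (ell_infty A) c s = (\<lambda>n. csmult A c (s n))"
  "star (ell_infty A) s = (\<lambda>n. star A (s n))"
  "anorm (ell_infty A) s = (SUP n. anorm A (s n))"
proof -
  have bdd: "bdd_above (range (\<lambda>n. anorm A (s n))) \<longleftrightarrow> (\<exists>B. \<forall>n. \<forall>x\<in>topspace X. cmod (s n x) \<le> B)"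
    if s: "\<forall>n. s n \<in> carrier A" for s
  proof
    assume "bdd_above (range (\<lambda>n. anorm A (s n)))"
    then obtain B where B: "\<And>n. anorm A (s n) \<le> B" by (auto simp: bdd_above_def)
    have "cmod (s n x) \<le> B" if "x \<in> topspace X" for n x
      using cmod_le_anorm[OF _ that, of "s n"] s B[of n] by force
    then show "\<exists>B. \<forall>n. \<forall>x\<in>topspace X. cmod (s n x) \<le> B" by blast
  next
    assume "\<exists>B. \<forall>n. \<forall>x\<in>topspace X. cmod (s n x) \<le> B"
    then obtain B where "\<And>n x. x \<in> topspace X \<Longrightarrow> cmod (s n x) \<le> B" by blast
    then have "anorm A (s n) \<le> max B 0" for n by (intro anorm_le) (auto simp: le_max_iff_disj)
    then show "bdd_above (range (\<lambda>n. anorm A (s n)))" by (intro bdd_aboveI2)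
  qed
  have carr: "carrier (ell_infty A) = {s. (\<forall>n. s n \<in> carrier A) \<and> bdd_above (range (\<lambda>n. anorm A (s n)))}"
    by (simp add: ell_infty_def)
  show "carrier (ell_infty A) = Collect bounded_seq"
    unfolding carr bounded_seq_def by (intro Collect_cong conj_cong refl bdd)
qed (simp_all add: ell_infty_def)

lemma bounded_seqI_carrier:
  "\<lbrakk>\<And>n. s n \<in> carrier A; \<And>n x. x \<in> topspace X \<Longrightarrow> cmod (s n x) \<le> B\<rbrakk> \<Longrightarrow> bounded_seq s"
  unfolding bounded_seq_def by blast

lemma bounded_seqI:
  "\<lbrakk>\<And>n. continuous_map X euclidean (s n); \<And>n x. x \<in> topspace X \<Longrightarrow> cmod (s n x) \<le> B\<rbrakk>
    \<Longrightarrow> bounded_seq (\<lambda>n. \<lambda>x\<in>topspace X. s n x)"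
  by (rule bounded_seqI_carrier[where B = B]) (simp_all add: restrict_mem_C_alg)

lemma bounded_seq_closed:
  "bounded_seq s \<Longrightarrow> bounded_seq t \<Longrightarrow> bounded_seq (\<lambda>n. s n \<otimes>\<^bsub>A\<^esub> t n)"
  "bounded_seq s \<Longrightarrow> bounded_seq t \<Longrightarrow> bounded_seq (\<lambda>n. s n \<oplus>\<^bsub>A\<^esub> t n)"
  "f \<in> carrier A \<Longrightarrow> bounded_seq (\<lambda>n. f)"
  "bounded_seq s \<Longrightarrow> bounded_seq (\<lambda>n. csmult A c (s n))"
  "bounded_seq s \<Longrightarrow> bounded_seq (\<lambda>n. star A (s n))"
proof -
  assume s: "bounded_seq s"
  then obtain B where B: "\<And>n x. x \<in> topspace X \<Longrightarrow> cmod (s n x) \<le> B" by (auto simp: bounded_seq_def)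
  have sc: "s n \<in> carrier A" for n using s by (simp add: bounded_seq_def)
  show "bounded_seq (\<lambda>n. csmult A c (s n))"
    by (rule bounded_seqI_carrier[where B = "cmod c * B"])
      (auto simp: C_alg_sel(6) norm_mult intro: mult_left_mono B C_alg_closed(5)[OF sc, unfolded C_alg_sel(6)])
  show "bounded_seq (\<lambda>n. star A (s n))"
    by (rule bounded_seqI_carrier[where B = B])
      (auto simp: C_alg_sel(7) intro: B C_alg_closed(6)[OF sc, unfolded C_alg_sel(7)])
  assume t: "bounded_seq t"
  then obtain B' where B': "\<And>n x. x \<in> topspace X \<Longrightarrow> cmod (t n x) \<le> B'" by (auto simp: bounded_seq_def)
  have tc: "t n \<in> carrier A" for n using t by (simp add: bounded_seq_def)
  show "bounded_seq (\<lambda>n. s n \<oplus>\<^bsub>A\<^esub> t n)"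
  proof (rule bounded_seqI_carrier[where B = "B + B'"])
    show "s n \<oplus>\<^bsub>A\<^esub> t n \<in> carrier A" for n by (rule C_alg_closed(2)[OF sc tc])
    show "cmod ((s n \<oplus>\<^bsub>A\<^esub> t n) x) \<le> B + B'" if "x \<in> topspace X" for n x
      using norm_triangle_mono[OF B B'] that by (simp add: C_alg_sel(5))
  qed
  have "cmod (s n x * t n x) \<le> B * B'" if x: "x \<in> topspace X" for n x
    unfolding norm_mult using B[OF x] B'[OF x] by (intro mult_mono) (auto intro: order_trans[OF norm_ge_zero])
  then show "bounded_seq (\<lambda>n. s n \<otimes>\<^bsub>A\<^esub> t n)"
    by (intro bounded_seqI_carrier[where B = "B * B'"] C_alg_closed(1)[OF sc tc]) (simp add: C_alg_sel(2))
next
  assume "f \<in> carrier A"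
  then show "bounded_seq (\<lambda>n. f)" unfolding bounded_seq_def using cmod_le_anorm by blast
qed

lemma asymp_eq_refl: "asymp_eq s s"
  by (auto simp: asymp_eq_def)

lemma asymp_eq_sym: "asymp_eq s t \<Longrightarrow> asymp_eq t s"
  by (auto simp: asymp_eq_def norm_minus_commute)

text \<open>The common epsilon argument: transitivity and the continuity of each operation reduce to
  a pointwise estimate by two differences.\<close>

lemma asymp_eq_combine:
  assumes "asymp_eq s t" "asymp_eq s' t'" "0 \<le> B" "0 \<le> B'"
    and "\<And>n x. x \<in> topspace X \<Longrightarrow>
      cmod (u n x - v n x) \<le> B * cmod (s n x - t n x) + B' * cmod (s' n x - t' n x)"
  shows "asymp_eq u v"
  unfolding asymp_eq_def
proof (intro allI impI)
  fix \<epsilon> :: real assume \<epsilon>: "\<epsilon> > 0"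
  define \<delta> where "\<delta> = \<epsilon> / (B + B' + 1)"
  have \<delta>: "\<delta> > 0" using \<epsilon> assms(3,4) by (simp add: \<delta>_def)
  obtain N where N: "\<And>n x. n \<ge> N \<Longrightarrow> x \<in> topspace X \<Longrightarrow> cmod (s n x - t n x) \<le> \<delta>"
    using assms(1) \<delta> unfolding asymp_eq_def by blast
  obtain N' where N': "\<And>n x. n \<ge> N' \<Longrightarrow> x \<in> topspace X \<Longrightarrow> cmod (s' n x - t' n x) \<le> \<delta>"
    using assms(2) \<delta> unfolding asymp_eq_def by blast
  have "cmod (u n x - v n x) \<le> \<epsilon>" if "n \<ge> max N N'" "x \<in> topspace X" for n x
  proof -
    have "cmod (u n x - v n x) \<le> B * \<delta> + B' * \<delta>"
      using assms(5)[OF that(2), of n] mult_left_mono[OF N[of n x] assms(3)] mult_left_mono[OF N'[of n x] assms(4)] that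
      by fastforce
    also have "\<dots> \<le> (B + B' + 1) * \<delta>" using \<delta> by (simp add: algebra_simps)
    also have "\<dots> = \<epsilon>" using assms(3,4) by (simp add: \<delta>_def)
    finally show ?thesis .
  qed
  then show "\<exists>N. \<forall>n\<ge>N. \<forall>x\<in>topspace X. cmod (u n x - v n x) \<le> \<epsilon>" by blast
qed

lemma asymp_eq_trans: "\<lbrakk>asymp_eq s t; asymp_eq t u\<rbrakk> \<Longrightarrow> asymp_eq s u"
  by (rule asymp_eq_combine[of s t t u 1 1]) (auto simp: dist_norm[symmetric] dist_triangle)

lemma asymp_eq_add:
  "\<lbrakk>asymp_eq s t; asymp_eq s' t'\<rbrakk> \<Longrightarrow> asymp_eq (\<lambda>n. s n \<oplus>\<^bsub>A\<^esub> s' n) (\<lambda>n. t n \<oplus>\<^bsub>A\<^esub> t' n)"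
  by (rule asymp_eq_combine[of s t s' t' 1 1]) (auto simp: C_alg_sel(5) intro: norm_diff_triangle_ineq)

lemma asymp_eq_csmult:
  "asymp_eq s t \<Longrightarrow> asymp_eq (\<lambda>n. csmult A c (s n)) (\<lambda>n. csmult A c (t n))"
  by (rule asymp_eq_combine[of s t s t "cmod c" 0])
    (auto simp: C_alg_sel(6) norm_mult[symmetric] right_diff_distrib)

lemma asymp_eq_star:
  "asymp_eq s t \<Longrightarrow> asymp_eq (\<lambda>n. star A (s n)) (\<lambda>n. star A (t n))"
  by (rule asymp_eq_combine[of s t s t 1 0])
    (auto simp: C_alg_sel(7) complex_cnj_diff[symmetric] simp del: complex_cnj_diff)

lemma asymp_eq_mult:
  assumes st: "asymp_eq s t" "asymp_eq s' t'" and b: "bounded_seq s" "bounded_seq t'"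
  shows "asymp_eq (\<lambda>n. s n \<otimes>\<^bsub>A\<^esub> s' n) (\<lambda>n. t n \<otimes>\<^bsub>A\<^esub> t' n)"
proof -
  obtain B where B1: "\<And>n x. x \<in> topspace X \<Longrightarrow> cmod (s n x) \<le> B"
    using b(1) by (auto simp: bounded_seq_def)
  obtain B' where B2: "\<And>n x. x \<in> topspace X \<Longrightarrow> cmod (t' n x) \<le> B'"
    using b(2) by (auto simp: bounded_seq_def)
  show ?thesis
  proof (rule asymp_eq_combine[OF st, of "\<bar>B'\<bar>" "\<bar>B\<bar>"])
    fix n x assume x: "x \<in> topspace X"
    have "s n x * s' n x - t n x * t' n x = t' n x * (s n x - t n x) + s n x * (s' n x - t' n x)"
      by (simp add: algebra_simps)
    also have "cmod \<dots> \<le> cmod (t' n x) * cmod (s n x - t n x) + cmod (s n x) * cmod (s' n x - t' n x)"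
      by (metis norm_mult norm_triangle_ineq)
    also have "\<dots> \<le> \<bar>B'\<bar> * cmod (s n x - t n x) + \<bar>B\<bar> * cmod (s' n x - t' n x)"
      using B1[OF x, of n] B2[OF x, of n] by (intro add_mono mult_right_mono) auto
    finally show "cmod ((s n \<otimes>\<^bsub>A\<^esub> s' n) x - (t n \<otimes>\<^bsub>A\<^esub> t' n) x) \<le>
        \<bar>B'\<bar> * cmod (s n x - t n x) + \<bar>B\<bar> * cmod (s' n x - t' n x)"
      using x by (simp add: C_alg_sel(2))
  qed auto
qed

lemma seq_class_eq_iff:
  "\<lbrakk>bounded_seq s; bounded_seq t\<rbrakk> \<Longrightarrow> seq_class s = seq_class t \<longleftrightarrow> asymp_eq s t"
  unfolding seq_class_def using asymp_eq_refl asymp_eq_sym asymp_eq_trans by blast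

lemma seq_class_self: "bounded_seq s \<Longrightarrow> s \<in> seq_class s"
  by (simp add: seq_class_def asymp_eq_refl)

lemma c_zero_eq: "c_zero A = seq_class (\<lambda>n. \<zero>\<^bsub>A\<^esub>)"
proof -
  have "(\<lambda>n. anorm A (s n)) \<longlonglongrightarrow> 0 \<longleftrightarrow> asymp_eq (\<lambda>n. \<zero>\<^bsub>A\<^esub>) s" if s: "bounded_seq s" for s
  proof
    have sc: "s n \<in> carrier A" for n using s by (simp add: bounded_seq_def)
    { assume lim: "(\<lambda>n. anorm A (s n)) \<longlonglongrightarrow> 0"
      show "asymp_eq (\<lambda>n. \<zero>\<^bsub>A\<^esub>) s" unfolding asymp_eq_def
      proof (intro allI impI)
        fix \<epsilon> :: real assume "\<epsilon> > 0"
        then obtain N where N: "\<And>n. n \<ge> N \<Longrightarrow> \<bar>anorm A (s n)\<bar> < \<epsilon>"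
          using LIMSEQ_D[OF lim] by auto
        have "cmod (\<zero>\<^bsub>A\<^esub> x - s n x) \<le> \<epsilon>" if "n \<ge> N" "x \<in> topspace X" for n x
          using cmod_le_anorm[OF sc that(2), of n] N[OF that(1)] that(2) by (simp add: C_alg_sel(4))
        then show "\<exists>N. \<forall>n\<ge>N. \<forall>x\<in>topspace X. cmod (\<zero>\<^bsub>A\<^esub> x - s n x) \<le> \<epsilon>" by blast
      qed }
    { assume eq: "asymp_eq (\<lambda>n. \<zero>\<^bsub>A\<^esub>) s"
      show "(\<lambda>n. anorm A (s n)) \<longlonglongrightarrow> 0"
      proof (rule LIMSEQ_I)
        fix r :: real assume r: "r > 0"
        then obtain N where N: "\<And>n x. \<lbrakk>n \<ge> N; x \<in> topspace X\<rbrakk> \<Longrightarrow> cmod (\<zero>\<^bsub>A\<^esub> x - s n x) \<le> r / 2"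
          using eq unfolding asymp_eq_def by (meson half_gt_zero)
        have "norm (anorm A (s n) - 0) < r" if "n \<ge> N" for n
        proof -
          have "cmod (s n x) \<le> r / 2" if "x \<in> topspace X" for x
            using N[OF \<open>n \<ge> N\<close> that] that by (simp add: C_alg_sel(4))
          then have "anorm A (s n) \<le> r / 2" using r by (intro anorm_le) auto
          then show ?thesis using anorm_nonneg[OF sc, of n] r by simp
        qed
        then show "\<exists>no. \<forall>n\<ge>no. norm (anorm A (s n) - 0) < r" by blast
      qed }
  qed
  then show ?thesis by (auto simp: c_zero_def seq_class_def ell_infty_sel)
qed

lemma bounded_seq_zero: "bounded_seq (\<lambda>n. \<zero>\<^bsub>A\<^esub>)"
  by (rule bounded_seq_closed(3)) (rule C_alg_closed)

text \<open>Subtraction of sequences. The equation for \<open>t\<close> is one between normalised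
  functions, as membership in a coset requires.\<close>

lemma bounded_seq_shift:
  assumes "bounded_seq s" "bounded_seq t"
  obtains z where "bounded_seq z" "t = (\<lambda>n. z n \<oplus>\<^bsub>A\<^esub> s n)"
    "\<And>n x. x \<in> topspace X \<Longrightarrow> z n x = t n x - s n x"
proof
  let ?z = "\<lambda>n. t n \<oplus>\<^bsub>A\<^esub> csmult A (- 1) (s n)"
  show z: "bounded_seq ?z" using assms by (intro bounded_seq_closed)
  show "?z n x = t n x - s n x" if "x \<in> topspace X" for n x using that by (simp add: C_alg_sel(5,6))
  show "t = (\<lambda>n. ?z n \<oplus>\<^bsub>A\<^esub> s n)"
  proof
    show "t n = ?z n \<oplus>\<^bsub>A\<^esub> s n" for n
      using assms z by (intro C_alg_ext[of _ X] C_alg_closed) (auto simp: bounded_seq_def C_alg_sel(5,6))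
  qed
qed

lemma c_zero_coset:
  assumes s: "bounded_seq s"
  shows "c_zero A +>\<^bsub>ell_infty A\<^esub> s = seq_class s"
proof
  have def: "c_zero A +>\<^bsub>ell_infty A\<^esub> s = {\<lambda>n. z n \<oplus>\<^bsub>A\<^esub> s n | z. bounded_seq z \<and> asymp_eq (\<lambda>n. \<zero>\<^bsub>A\<^esub>) z}"
    unfolding c_zero_eq seq_class_def a_r_coset_def r_coset_def by (auto simp: ell_infty_sel)
  show "c_zero A +>\<^bsub>ell_infty A\<^esub> s \<subseteq> seq_class s"
  proof
    fix t assume "t \<in> c_zero A +>\<^bsub>ell_infty A\<^esub> s"
    then obtain z where z: "bounded_seq z" "asymp_eq (\<lambda>n. \<zero>\<^bsub>A\<^esub>) z" "t = (\<lambda>n. z n \<oplus>\<^bsub>A\<^esub> s n)"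
      using def by blast
    have "asymp_eq s t"
      by (rule asymp_eq_combine[OF z(2,2), of 1 0]) (auto simp: z(3) C_alg_sel(4,5))
    then show "t \<in> seq_class s" using z s bounded_seq_closed(2) by (simp add: seq_class_def)
  qed
  show "seq_class s \<subseteq> c_zero A +>\<^bsub>ell_infty A\<^esub> s"
  proof
    fix t assume "t \<in> seq_class s"
    then have t: "bounded_seq t" "asymp_eq s t" by (auto simp: seq_class_def)
    obtain z where z: "bounded_seq z" "t = (\<lambda>n. z n \<oplus>\<^bsub>A\<^esub> s n)"
      "\<And>n x. x \<in> topspace X \<Longrightarrow> z n x = t n x - s n x" by (rule bounded_seq_shift[OF s t(1)]) (rule that; assumption)
    have "asymp_eq (\<lambda>n. \<zero>\<^bsub>A\<^esub>) z"
      by (rule asymp_eq_combine[OF t(2,2), of 1 0]) (auto simp: z(3) C_alg_sel(4) norm_minus_commute)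
    then show "t \<in> c_zero A +>\<^bsub>ell_infty A\<^esub> s" using def z by blast
  qed
qed

text \<open>The operations of the quotient are unions or set sums over all representatives;
  compatibility with \<open>asymp_eq\<close> collapses them to the class of one
  representative.\<close>

lemma A_infty_sel:
  "carrier (A_infty A) = seq_class ` Collect bounded_seq"
  "\<zero>\<^bsub>A_infty A\<^esub> = seq_class (\<lambda>n. \<zero>\<^bsub>A\<^esub>)"
  "\<lbrakk>bounded_seq s; bounded_seq t\<rbrakk> \<Longrightarrow>
     seq_class s \<otimes>\<^bsub>A_infty A\<^esub> seq_class t = seq_class (\<lambda>n. s n \<otimes>\<^bsub>A\<^esub> t n)"
  "\<lbrakk>bounded_seq s; bounded_seq t\<rbrakk> \<Longrightarrow>
     seq_class s \<oplus>\<^bsub>A_infty A\<^esub> seq_class t = seq_class (\<lambda>n. s n \<oplus>\<^bsub>A\<^esub> t n)"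
  "bounded_seq s \<Longrightarrow> csmult (A_infty A) c (seq_class s) = seq_class (\<lambda>n. csmult A c (s n))"
  "bounded_seq s \<Longrightarrow> star (A_infty A) (seq_class s) = seq_class (\<lambda>n. star A (s n))"
proof -
  show "carrier (A_infty A) = seq_class ` Collect bounded_seq"
    using c_zero_coset by (force simp: A_infty_def quotient_alg_def A_RCOSETS_def' ell_infty_sel)
  show "\<zero>\<^bsub>A_infty A\<^esub> = seq_class (\<lambda>n. \<zero>\<^bsub>A\<^esub>)"
    by (simp add: A_infty_def quotient_alg_def c_zero_eq)
  have union: "(\<Union>s'\<in>seq_class s. c_zero A +>\<^bsub>ell_infty A\<^esub> h s') = seq_class (h s)"
    if s: "bounded_seq s" and h: "\<And>s'. bounded_seq s' \<Longrightarrow> bounded_seq (h s')"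
      "\<And>s'. \<lbrakk>bounded_seq s'; asymp_eq s s'\<rbrakk> \<Longrightarrow> asymp_eq (h s) (h s')" for s h
  proof -
    have "c_zero A +>\<^bsub>ell_infty A\<^esub> h s' = seq_class (h s)" if "s' \<in> seq_class s" for s'
    proof -
      have s': "bounded_seq s'" "asymp_eq s s'" using that by (auto simp: seq_class_def)
      have "seq_class (h s) = seq_class (h s')" using seq_class_eq_iff[OF h(1)[OF s] h(1)[OF s'(1)]] h(2)[OF s'] by simp
      then show ?thesis using c_zero_coset[OF h(1)[OF s'(1)]] by simp
    qed
    then show ?thesis using seq_class_self[OF s] by auto
  qed
  { assume s: "bounded_seq s"
    show "csmult (A_infty A) c (seq_class s) = seq_class (\<lambda>n. csmult A c (s n))"
      using union[OF s, of "\<lambda>s n. csmult A c (s n)"] asymp_eq_csmult bounded_seq_closed(4)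
      by (simp add: A_infty_def quotient_alg_def ell_infty_sel(6))
    show "star (A_infty A) (seq_class s) = seq_class (\<lambda>n. star A (s n))"
      using union[OF s, of "\<lambda>s n. star A (s n)"] asymp_eq_star bounded_seq_closed(5)
      by (simp add: A_infty_def quotient_alg_def ell_infty_sel(7)) }
  assume s: "bounded_seq s" and t: "bounded_seq t"
  have "(\<Union>t'\<in>seq_class t. c_zero A +>\<^bsub>ell_infty A\<^esub> (\<lambda>n. s' n \<otimes>\<^bsub>A\<^esub> t' n)) = seq_class (\<lambda>n. s n \<otimes>\<^bsub>A\<^esub> t n)"
    if s': "s' \<in> seq_class s" for s'
  proof -
    have bs': "bounded_seq s'" "asymp_eq s s'" using s' by (auto simp: seq_class_def)
    have "asymp_eq (\<lambda>n. s n \<otimes>\<^bsub>A\<^esub> t n) (\<lambda>n. s' n \<otimes>\<^bsub>A\<^esub> t n)"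
      using asymp_eq_mult[OF bs'(2) asymp_eq_refl s t] .
    then have "seq_class (\<lambda>n. s n \<otimes>\<^bsub>A\<^esub> t n) = seq_class (\<lambda>n. s' n \<otimes>\<^bsub>A\<^esub> t n)"
      using seq_class_eq_iff bounded_seq_closed(1) s t bs'(1) by simp
    then show ?thesis
      using union[OF t, of "\<lambda>t n. s' n \<otimes>\<^bsub>A\<^esub> t n"] asymp_eq_mult[OF asymp_eq_refl _ bs'(1)]
        bounded_seq_closed(1)[OF bs'(1)] by simp
  qed
  then show "seq_class s \<otimes>\<^bsub>A_infty A\<^esub> seq_class t = seq_class (\<lambda>n. s n \<otimes>\<^bsub>A\<^esub> t n)"
    using seq_class_self[OF s]
    by (auto simp: A_infty_def quotient_alg_def rcoset_mult_def ell_infty_sel(2))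
  have "seq_class s \<oplus>\<^bsub>A_infty A\<^esub> seq_class t = {\<lambda>n. s' n \<oplus>\<^bsub>A\<^esub> t' n | s' t'. s' \<in> seq_class s \<and> t' \<in> seq_class t}"
    by (auto simp: A_infty_def quotient_alg_def set_add_def set_mult_def ell_infty_sel(5))
  also have "\<dots> = seq_class (\<lambda>n. s n \<oplus>\<^bsub>A\<^esub> t n)"
  proof (intro equalityI subsetI)
    fix u assume "u \<in> {\<lambda>n. s' n \<oplus>\<^bsub>A\<^esub> t' n | s' t'. s' \<in> seq_class s \<and> t' \<in> seq_class t}"
    then show "u \<in> seq_class (\<lambda>n. s n \<oplus>\<^bsub>A\<^esub> t n)"
      using asymp_eq_add bounded_seq_closed(2) by (auto simp: seq_class_def)
  next
    fix u assume u: "u \<in> seq_class (\<lambda>n. s n \<oplus>\<^bsub>A\<^esub> t n)"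
    then have u': "bounded_seq u" "asymp_eq (\<lambda>n. s n \<oplus>\<^bsub>A\<^esub> t n) u" by (auto simp: seq_class_def)
    obtain z where z: "bounded_seq z" "u = (\<lambda>n. z n \<oplus>\<^bsub>A\<^esub> t n)"
      "\<And>n x. x \<in> topspace X \<Longrightarrow> z n x = u n x - t n x" by (rule bounded_seq_shift[OF t u'(1)]) (rule that; assumption)
    have "asymp_eq s z"
      by (rule asymp_eq_combine[OF u'(2,2), of 1 0]) (auto simp: z(3) C_alg_sel(5) algebra_simps)
    then show "u \<in> {\<lambda>n. s' n \<oplus>\<^bsub>A\<^esub> t' n | s' t'. s' \<in> seq_class s \<and> t' \<in> seq_class t}"
      using z seq_class_self[OF t] by (auto simp: seq_class_def)
  qed
  finally show "seq_class s \<oplus>\<^bsub>A_infty A\<^esub> seq_class t = seq_class (\<lambda>n. s n \<oplus>\<^bsub>A\<^esub> t n)" .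
qed

text \<open>The quotient norm is an infimum, so any representative bounds it from above once the
  norms are known to be bounded below by 0.\<close>

lemma anorm_A_infty_le:
  assumes s: "bounded_seq s" and B: "\<And>n. anorm A (s n) \<le> B"
  shows "anorm (A_infty A) (seq_class s) \<le> B"
proof -
  have "anorm (A_infty A) (seq_class s) = Inf (anorm (ell_infty A) ` seq_class s)"
    by (simp add: A_infty_def quotient_alg_def)
  also have "\<dots> \<le> anorm (ell_infty A) s"
  proof (rule cInf_lower)
    show "bdd_below (anorm (ell_infty A) ` seq_class s)"
    proof (rule bdd_belowI2)
      fix t assume "t \<in> seq_class s"
      then have t: "bounded_seq t" by (simp add: seq_class_def)
      then have bdd: "bdd_above (range (\<lambda>n. anorm A (t n)))"
        using ell_infty_sel(1) by (auto simp: ell_infty_def)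
      have "0 \<le> anorm A (t 0)" using t by (intro anorm_nonneg) (simp add: bounded_seq_def)
      also have "\<dots> \<le> anorm (ell_infty A) t" unfolding ell_infty_sel(8) by (rule cSUP_upper[OF UNIV_I bdd])
      finally show "0 \<le> anorm (ell_infty A) t" .
    qed
  qed (use seq_class_self[OF s] in simp)
  also have "\<dots> \<le> B" unfolding ell_infty_sel(8) by (rule cSUP_least) (auto intro: B)
  finally show ?thesis .
qed

lemma const_embed_eq: "a \<in> carrier A \<Longrightarrow> const_embed A a = seq_class (\<lambda>n. a)"
  unfolding const_embed_def by (intro c_zero_coset bounded_seq_closed(3))

text \<open>The algebra \<open>C(X)\<close> is commutative, so constant sequences commute with
  everything.\<close>

lemma rel_commutant_eq: "rel_commutant A = carrier (A_infty A)"
proof -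
  have comm: "f \<otimes>\<^bsub>A\<^esub> a = a \<otimes>\<^bsub>A\<^esub> f" for f a by (simp add: C_alg_sel(2) mult.commute)
  have "x \<otimes>\<^bsub>A_infty A\<^esub> const_embed A a = const_embed A a \<otimes>\<^bsub>A_infty A\<^esub> x"
    if x: "x \<in> carrier (A_infty A)" and a: "a \<in> carrier A" for x a
  proof -
    obtain s where s: "bounded_seq s" "x = seq_class s" using x by (auto simp: A_infty_sel(1))
    show ?thesis
      unfolding s(2) const_embed_eq[OF a] A_infty_sel(3)[OF s(1) bounded_seq_closed(3)[OF a]]
        A_infty_sel(3)[OF bounded_seq_closed(3)[OF a] s(1)] by (simp only: comm)
  qed
  then show ?thesis unfolding rel_commutant_def by blast
qed

text \<open>Testing against the constant sequence 1 forces an annihilating class to be zero.\<close>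

lemma annihilator_eq: "annihilator A = {seq_class (\<lambda>n. \<zero>\<^bsub>A\<^esub>)}"
proof (intro equalityI subsetI)
  fix x assume x: "x \<in> annihilator A"
  then obtain s where s: "bounded_seq s" "x = seq_class s" by (auto simp: annihilator_def A_infty_sel(1))
  have "x \<otimes>\<^bsub>A_infty A\<^esub> const_embed A \<one>\<^bsub>A\<^esub> = \<zero>\<^bsub>A_infty A\<^esub>"
    using x C_alg_closed(3) by (auto simp: annihilator_def)
  moreover have "(\<lambda>n. s n \<otimes>\<^bsub>A\<^esub> \<one>\<^bsub>A\<^esub>) = s"
  proof
    show "s n \<otimes>\<^bsub>A\<^esub> \<one>\<^bsub>A\<^esub> = s n" for n
      using s(1) by (intro C_alg_ext[of _ X] C_alg_closed) (auto simp: bounded_seq_def C_alg_sel(2,3))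
  qed
  ultimately show "x \<in> {seq_class (\<lambda>n. \<zero>\<^bsub>A\<^esub>)}"
    using s by (simp add: const_embed_eq C_alg_closed(3) A_infty_sel bounded_seq_closed(3))
next
  fix x assume x: "x \<in> {seq_class (\<lambda>n. \<zero>\<^bsub>A\<^esub>)}"
  have "\<zero>\<^bsub>A\<^esub> \<otimes>\<^bsub>A\<^esub> a = \<zero>\<^bsub>A\<^esub>" "a \<otimes>\<^bsub>A\<^esub> \<zero>\<^bsub>A\<^esub> = \<zero>\<^bsub>A\<^esub>" for a by (auto simp: C_alg_sel(2,4))
  then show "x \<in> annihilator A"
    using x bounded_seq_zero by (auto simp: annihilator_def A_infty_sel const_embed_eq bounded_seq_closed(3))
qed

text \<open>As \<open>A\<close> is commutative and unital, \<open>F_infty A\<close> is \<open>A_infty A\<close> with every element \<open>x\<close> replaced by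
  the coset \<open>{x}\<close>.\<close>

definition F_class :: "(nat \<Rightarrow> 'x \<Rightarrow> complex) \<Rightarrow> (nat \<Rightarrow> 'x \<Rightarrow> complex) set set" where
  "F_class s = {seq_class s}"

lemma F_class_eqI: "\<lbrakk>bounded_seq s; bounded_seq t; asymp_eq s t\<rbrakk> \<Longrightarrow> F_class s = F_class t"
  by (simp add: F_class_def seq_class_eq_iff)

text \<open>The ideal is zero, so its cosets are singletons and the operations carry over. The unit
  is given by a definite description and has to be identified through the uniqueness of
  units.\<close>

lemma F_infty_sel:
  "carrier (F_infty A) = F_class ` Collect bounded_seq"
  "\<zero>\<^bsub>F_infty A\<^esub> = F_class (\<lambda>n. \<zero>\<^bsub>A\<^esub>)"
  "\<lbrakk>bounded_seq s; bounded_seq t\<rbrakk> \<Longrightarrow> F_class s \<otimes>\<^bsub>F_infty A\<^esub> F_class t = F_class (\<lambda>n. s n \<otimes>\<^bsub>A\<^esub> t n)"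
  "\<lbrakk>bounded_seq s; bounded_seq t\<rbrakk> \<Longrightarrow> F_class s \<oplus>\<^bsub>F_infty A\<^esub> F_class t = F_class (\<lambda>n. s n \<oplus>\<^bsub>A\<^esub> t n)"
  "bounded_seq s \<Longrightarrow> csmult (F_infty A) c (F_class s) = F_class (\<lambda>n. csmult A c (s n))"
  "bounded_seq s \<Longrightarrow> star (F_infty A) (F_class s) = F_class (\<lambda>n. star A (s n))"
  "bounded_seq s \<Longrightarrow> anorm (F_infty A) (F_class s) = anorm (A_infty A) (seq_class s)"
  "\<one>\<^bsub>F_infty A\<^esub> = F_class (\<lambda>n. \<one>\<^bsub>A\<^esub>)"
proof -
  define I where "I = {seq_class (\<lambda>n. \<zero>\<^bsub>A\<^esub>)}"
  define Q where "Q = quotient_alg (A_infty A) I"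
  have upd: "(A_infty A)\<lparr>carrier := carrier (A_infty A)\<rparr> = A_infty A" by simp
  have F: "F_infty A = Q\<lparr>one := (THE e. e \<in> carrier Q \<and> (\<forall>x\<in>carrier Q. e \<otimes>\<^bsub>Q\<^esub> x = x \<and> x \<otimes>\<^bsub>Q\<^esub> e = x))\<rparr>"
    unfolding F_infty_def rel_commutant_eq annihilator_eq upd Q_def I_def by (simp add: Let_def)
  have zero_add: "(\<lambda>n. \<zero>\<^bsub>A\<^esub> \<oplus>\<^bsub>A\<^esub> s n) = s" if "bounded_seq s" for s
    using that abelian_monoid.l_zero[OF abelian_monoid_C_alg] by (auto simp: bounded_seq_def)
  have coset: "I +>\<^bsub>A_infty A\<^esub> seq_class s = {seq_class s}" if "bounded_seq s" for s
    using that A_infty_sel(4)[OF bounded_seq_zero that] zero_add[OF that]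
    by (simp add: I_def a_r_coset_def r_coset_def)
  show carrier: "carrier (F_infty A) = F_class ` Collect bounded_seq"
    using coset by (force simp: F Q_def quotient_alg_def A_RCOSETS_def' A_infty_sel(1) F_class_def)
  show "\<zero>\<^bsub>F_infty A\<^esub> = F_class (\<lambda>n. \<zero>\<^bsub>A\<^esub>)"
    by (simp add: F Q_def quotient_alg_def I_def F_class_def)
  have mult: "F_class s \<otimes>\<^bsub>Q\<^esub> F_class t = F_class (\<lambda>n. s n \<otimes>\<^bsub>A\<^esub> t n)" if "bounded_seq s" "bounded_seq t" for s t
    using that by (simp add: Q_def quotient_alg_def rcoset_mult_def F_class_def A_infty_sel(3) coset bounded_seq_closed(1))
  show "F_class s \<otimes>\<^bsub>F_infty A\<^esub> F_class t = F_class (\<lambda>n. s n \<otimes>\<^bsub>A\<^esub> t n)" if "bounded_seq s" "bounded_seq t"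
    using mult[OF that] by (simp add: F)
  show "F_class s \<oplus>\<^bsub>F_infty A\<^esub> F_class t = F_class (\<lambda>n. s n \<oplus>\<^bsub>A\<^esub> t n)" if "bounded_seq s" "bounded_seq t"
    using A_infty_sel(4)[OF that] by (simp add: F Q_def quotient_alg_def set_add_def set_mult_def F_class_def)
  { assume s: "bounded_seq s"
    show "csmult (F_infty A) c (F_class s) = F_class (\<lambda>n. csmult A c (s n))"
      using coset[OF bounded_seq_closed(4)[OF s]] A_infty_sel(5)[OF s]
      by (simp add: F Q_def quotient_alg_def F_class_def)
    show "star (F_infty A) (F_class s) = F_class (\<lambda>n. star A (s n))"
      using coset[OF bounded_seq_closed(5)[OF s]] A_infty_sel(6)[OF s]
      by (simp add: F Q_def quotient_alg_def F_class_def)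
    show "anorm (F_infty A) (F_class s) = anorm (A_infty A) (seq_class s)"
      by (simp add: F Q_def quotient_alg_def F_class_def) }
  have carrierQ: "carrier Q = F_class ` Collect bounded_seq" using carrier by (simp add: F)
  have one: "bounded_seq (\<lambda>n. \<one>\<^bsub>A\<^esub>)" by (rule bounded_seq_closed(3)) (rule C_alg_closed)
  have unit: "F_class (\<lambda>n. \<one>\<^bsub>A\<^esub>) \<otimes>\<^bsub>Q\<^esub> F_class s = F_class s" "F_class s \<otimes>\<^bsub>Q\<^esub> F_class (\<lambda>n. \<one>\<^bsub>A\<^esub>) = F_class s"
    if s: "bounded_seq s" for s
  proof -
    have "\<one>\<^bsub>A\<^esub> \<otimes>\<^bsub>A\<^esub> s n = s n" "s n \<otimes>\<^bsub>A\<^esub> \<one>\<^bsub>A\<^esub> = s n" for n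
      using s by (intro C_alg_ext[of _ X] C_alg_closed; simp add: bounded_seq_def C_alg_sel(2,3))+
    then show "F_class (\<lambda>n. \<one>\<^bsub>A\<^esub>) \<otimes>\<^bsub>Q\<^esub> F_class s = F_class s" "F_class s \<otimes>\<^bsub>Q\<^esub> F_class (\<lambda>n. \<one>\<^bsub>A\<^esub>) = F_class s"
      using mult[OF one s] mult[OF s one] by simp_all
  qed
  have "(THE e. e \<in> carrier Q \<and> (\<forall>x\<in>carrier Q. e \<otimes>\<^bsub>Q\<^esub> x = x \<and> x \<otimes>\<^bsub>Q\<^esub> e = x)) = F_class (\<lambda>n. \<one>\<^bsub>A\<^esub>)"
  proof (rule the_equality)
    show "F_class (\<lambda>n. \<one>\<^bsub>A\<^esub>) \<in> carrier Q \<and>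
        (\<forall>x\<in>carrier Q. F_class (\<lambda>n. \<one>\<^bsub>A\<^esub>) \<otimes>\<^bsub>Q\<^esub> x = x \<and> x \<otimes>\<^bsub>Q\<^esub> F_class (\<lambda>n. \<one>\<^bsub>A\<^esub>) = x)"
      using one unit by (auto simp: carrierQ)
    fix e assume e: "e \<in> carrier Q \<and> (\<forall>x\<in>carrier Q. e \<otimes>\<^bsub>Q\<^esub> x = x \<and> x \<otimes>\<^bsub>Q\<^esub> e = x)"
    then obtain s where s: "bounded_seq s" "e = F_class s" by (auto simp: carrierQ)
    have "F_class (\<lambda>n. \<one>\<^bsub>A\<^esub>) \<in> carrier Q" using one by (auto simp: carrierQ)
    then have "e \<otimes>\<^bsub>Q\<^esub> F_class (\<lambda>n. \<one>\<^bsub>A\<^esub>) = F_class (\<lambda>n. \<one>\<^bsub>A\<^esub>)" using e by blast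
    then show "e = F_class (\<lambda>n. \<one>\<^bsub>A\<^esub>)" using unit(2)[OF s(1)] s(2) by simp
  qed
  then show "\<one>\<^bsub>F_infty A\<^esub> = F_class (\<lambda>n. \<one>\<^bsub>A\<^esub>)" by (simp add: F)
qed

lemma abelian_monoid_F_infty: "abelian_monoid (F_infty A)"
proof (rule abelian_monoidI)
  interpret A: abelian_monoid A by (rule abelian_monoid_C_alg)
  have car: "s n \<in> carrier A" if "bounded_seq s" for s n using that by (simp add: bounded_seq_def)
  show "x \<oplus>\<^bsub>F_infty A\<^esub> y \<in> carrier (F_infty A)" if "x \<in> carrier (F_infty A)" "y \<in> carrier (F_infty A)" for x y
    using that by (auto simp: F_infty_sel bounded_seq_closed(2))
  show "\<zero>\<^bsub>F_infty A\<^esub> \<in> carrier (F_infty A)" by (auto simp: F_infty_sel bounded_seq_zero)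
  show "x \<oplus>\<^bsub>F_infty A\<^esub> y \<oplus>\<^bsub>F_infty A\<^esub> z = x \<oplus>\<^bsub>F_infty A\<^esub> (y \<oplus>\<^bsub>F_infty A\<^esub> z)"
    if "x \<in> carrier (F_infty A)" "y \<in> carrier (F_infty A)" "z \<in> carrier (F_infty A)" for x y z
    using that by (auto simp: F_infty_sel bounded_seq_closed(2) A.a_assoc car)
  show "\<zero>\<^bsub>F_infty A\<^esub> \<oplus>\<^bsub>F_infty A\<^esub> x = x" if "x \<in> carrier (F_infty A)" for x
    using that by (auto simp: F_infty_sel bounded_seq_zero car)
  show "x \<oplus>\<^bsub>F_infty A\<^esub> y = y \<oplus>\<^bsub>F_infty A\<^esub> x" if "x \<in> carrier (F_infty A)" "y \<in> carrier (F_infty A)" for x y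
    using that by (auto simp: F_infty_sel A.a_comm car)
qed

lemma F_infty_finsum:
  assumes "finite J" "\<And>j. j \<in> J \<Longrightarrow> bounded_seq (s j)" "bounded_seq t"
    and "\<And>n x. x \<in> topspace X \<Longrightarrow> t n x = (\<Sum>j\<in>J. s j n x)"
  shows "(\<Oplus>\<^bsub>F_infty A\<^esub>j\<in>J. F_class (s j)) = F_class t"
  using assms
proof (induction arbitrary: t rule: finite_induct)
  case empty
  have "asymp_eq (\<lambda>n. \<zero>\<^bsub>A\<^esub>) t" using empty by (simp add: asymp_eq_def C_alg_sel(4))
  moreover have "(\<Oplus>\<^bsub>F_infty A\<^esub>j\<in>{}. F_class (s j)) = \<zero>\<^bsub>F_infty A\<^esub>"
    by (rule abelian_monoid.finsum_empty[OF abelian_monoid_F_infty])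
  ultimately show ?case using F_class_eqI[OF bounded_seq_zero empty(2)] by (simp add: F_infty_sel(2))
next
  case (insert i J)
  \<comment> \<open>\<open>z\<close> represents the sum over the remaining indices.\<close>
  obtain z where z: "bounded_seq z" "t = (\<lambda>n. z n \<oplus>\<^bsub>A\<^esub> s i n)"
    "\<And>n x. x \<in> topspace X \<Longrightarrow> z n x = t n x - s i n x"
    by (rule bounded_seq_shift[of "s i" t]) (use insert.prems in \<open>auto intro: that\<close>)
  have "(\<Oplus>\<^bsub>F_infty A\<^esub>j\<in>insert i J. F_class (s j)) = F_class (s i) \<oplus>\<^bsub>F_infty A\<^esub> (\<Oplus>\<^bsub>F_infty A\<^esub>j\<in>J. F_class (s j))"
    using insert by (intro abelian_monoid.finsum_insert[OF abelian_monoid_F_infty]) (auto simp: F_infty_sel(1))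
  also have "(\<Oplus>\<^bsub>F_infty A\<^esub>j\<in>J. F_class (s j)) = F_class z"
    using insert z(3) by (intro insert.IH z(1)) auto
  also have "F_class (s i) \<oplus>\<^bsub>F_infty A\<^esub> F_class z = F_class (\<lambda>n. s i n \<oplus>\<^bsub>A\<^esub> z n)"
    using insert.prems z(1) by (intro F_infty_sel(4)) auto
  also have "(\<lambda>n. s i n \<oplus>\<^bsub>A\<^esub> z n) = t" unfolding z(2) by (simp add: C_alg_sel(5) add.commute)
  finally show ?case .
qed

end

section \<open>Order zero maps from functions\<close>

context compact_function_algebra
begin

lemma F_class_cong:
  "\<lbrakk>bounded_seq s; bounded_seq t; \<And>n x. x \<in> topspace X \<Longrightarrow> s n x = t n x\<rbrakk> \<Longrightarrow> F_class s = F_class t"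
  by (rule F_class_eqI) (simp_all add: asymp_eq_def)

definition weighted_seq :: "'c set \<Rightarrow> (nat \<Rightarrow> 'c \<Rightarrow> 'x \<Rightarrow> real) \<Rightarrow> ('c \<Rightarrow> complex) \<Rightarrow> nat \<Rightarrow> 'x \<Rightarrow> complex" where
  "weighted_seq L p h n = (\<lambda>x\<in>topspace X. \<Sum>c\<in>L. h c * of_real (p n c x))"

lemma weighted_seq_eq: "x \<in> topspace X \<Longrightarrow> weighted_seq L p h n x = (\<Sum>c\<in>L. h c * of_real (p n c x))"
  by (simp add: weighted_seq_def)

lemma bounded_weighted_seq:
  assumes p: "\<And>n c. c \<in> L \<Longrightarrow> continuous_map X euclideanreal (p n c)"
    "\<And>n c x. \<lbrakk>c \<in> L; x \<in> topspace X\<rbrakk> \<Longrightarrow> 0 \<le> p n c x \<and> p n c x \<le> 1"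
  shows "bounded_seq (weighted_seq L p h)"
  unfolding weighted_seq_def
proof (rule bounded_seqI[where B = "\<Sum>c\<in>L. cmod (h c)"])
  show "continuous_map X euclidean (\<lambda>x. \<Sum>c\<in>L. h c * of_real (p n c x))" for n
    using p(1) by (auto simp: continuous_map_atin intro!: tendsto_intros)
  show "cmod (\<Sum>c\<in>L. h c * of_real (p n c x)) \<le> (\<Sum>c\<in>L. cmod (h c))" if "x \<in> topspace X" for n x
    using p(2)[OF _ that, of _ n] by (intro sum_norm_le) (simp add: norm_mult mult_left_le)
qed

text \<open>Orthogonality of the weights removes all mixed terms.\<close>

lemma weighted_product:
  fixes w :: "'c \<Rightarrow> real"
  assumes "finite L" "\<And>c c'. \<lbrakk>c \<in> L; c' \<in> L; c \<noteq> c'\<rbrakk> \<Longrightarrow> w c * w c' = 0"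
  shows "(\<Sum>c\<in>L. a c * complex_of_real (w c)) * (\<Sum>c\<in>L. b c * of_real (w c)) =
    (\<Sum>c\<in>L. a c * b c * of_real (w c * w c))"
proof -
  have "(\<Sum>c\<in>L. a c * complex_of_real (w c)) * (\<Sum>c\<in>L. b c * of_real (w c)) =
      (\<Sum>c\<in>L. \<Sum>c'\<in>L. a c * b c' * of_real (w c * w c'))"
    unfolding sum_product by (simp add: mult_ac)
  also have "\<dots> = (\<Sum>c\<in>L. \<Sum>c'\<in>{c}. a c * b c' * of_real (w c * w c'))"
  proof (rule sum.cong[OF refl])
    fix c assume c: "c \<in> L"
    show "(\<Sum>c'\<in>L. a c * b c' * of_real (w c * w c')) = (\<Sum>c'\<in>{c}. a c * b c' * of_real (w c * w c'))"
      using assms(1) c assms(2)[OF c] by (intro sum.mono_neutral_right) auto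
  qed
  finally show ?thesis by simp
qed

text \<open>With a prime for the adjoint, orthogonality of the weights gives
  \<open>\<theta>(a' b) = \<sigma>(a)' \<sigma>(b)\<close>, where \<open>\<sigma>\<close> carries
  the square roots of the weights. So a matrix \<open>y' y\<close> goes to
  \<open>\<sigma>(y)' \<sigma>(y)\<close>, which is complete positivity. Contractivity comes from
  the bound on the sum of the weights, order zero from their orthogonality.\<close>

lemma cpc_order_zero_weighted_seq:
  assumes L: "finite L"
    and p: "\<And>n c. c \<in> L \<Longrightarrow> continuous_map X euclideanreal (p n c)"
    "\<And>n c x. \<lbrakk>c \<in> L; x \<in> topspace X\<rbrakk> \<Longrightarrow> 0 \<le> p n c x"
    and orth: "\<And>n c c' x. \<lbrakk>c \<in> L; c' \<in> L; c \<noteq> c'; x \<in> topspace X\<rbrakk> \<Longrightarrow> p n c x * p n c' x = 0"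
    and sum: "\<And>n x. x \<in> topspace X \<Longrightarrow> (\<Sum>c\<in>L. p n c x) \<le> 1"
  shows "cpc_order_zero (C_alg (discrete_topology L)) (F_infty A) (\<lambda>h. F_class (weighted_seq L p h))"
proof -
  let ?Y = "discrete_topology L"
  let ?B = "C_alg ?Y"
  interpret Y: compact_function_algebra ?Y
    using L by unfold_locales (simp add: compact_space_discrete_topology)
  define \<theta> where "\<theta> h = weighted_seq L p h" for h
  define q where "q n c x = sqrt (p n c x)" for n c x
  define \<sigma> where "\<sigma> h = weighted_seq L q h" for h
  have p1: "0 \<le> p n c x \<and> p n c x \<le> 1" if "c \<in> L" "x \<in> topspace X" for n c x
    using p(2)[OF that] sum[OF that(2), of n] member_le_sum[of c L "\<lambda>c. p n c x"] L that p(2) by force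
  have \<theta>_bounded: "bounded_seq (\<theta> h)" for h
    unfolding \<theta>_def by (rule bounded_weighted_seq) (use p p1 in auto)
  have q: "continuous_map X euclideanreal (q n c)" if "c \<in> L" for n c
    using p(1)[OF that, of n] unfolding q_def by (auto simp: continuous_map_atin intro!: tendsto_real_sqrt)
  have \<sigma>_bounded: "bounded_seq (\<sigma> h)" for h
    unfolding \<sigma>_def by (rule bounded_weighted_seq) (use q p1 in \<open>auto simp: q_def\<close>)
  note \<theta>_eq = weighted_seq_eq[of _ L p, folded \<theta>_def] and \<sigma>_eq = weighted_seq_eq[of _ L q, folded \<sigma>_def]
  have \<theta>_product: "\<theta> a n x * \<theta> b n x = (\<Sum>c\<in>L. a c * b c * of_real (p n c x * p n c x))" if "x \<in> topspace X" for a b n x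
    unfolding \<theta>_eq[OF that] using orth that by (intro weighted_product L) auto
  have \<sigma>_product: "cnj (\<sigma> a n x) * \<sigma> b n x = (\<Sum>c\<in>L. cnj (a c) * b c * of_real (p n c x))"
    if x: "x \<in> topspace X" for a b n x
  proof -
    have "q n c x * q n c' x = 0" if "c \<in> L" "c' \<in> L" "c \<noteq> c'" for c c'
      unfolding q_def real_sqrt_mult[symmetric] orth[OF that x] by simp
    moreover have "cnj (\<sigma> a n x) = (\<Sum>c\<in>L. cnj (a c) * of_real (q n c x))" by (simp add: \<sigma>_eq[OF x])
    ultimately have "cnj (\<sigma> a n x) * \<sigma> b n x = (\<Sum>c\<in>L. cnj (a c) * b c * of_real (q n c x * q n c x))"
      unfolding \<sigma>_eq[OF x] by (simp only:) (rule weighted_product[OF L])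
    also have "\<dots> = (\<Sum>c\<in>L. cnj (a c) * b c * of_real (p n c x))"
      using p(2)[OF _ x] by (intro sum.cong) (auto simp: q_def)
    finally show ?thesis .
  qed
  have linear: "linear_between ?B (F_infty A) (\<lambda>h. F_class (\<theta> h))"
    unfolding linear_between_def
  proof (intro conjI ballI allI)
    show "(\<lambda>h. F_class (\<theta> h)) \<in> carrier ?B \<rightarrow> carrier (F_infty A)"
      using \<theta>_bounded by (auto simp: F_infty_sel(1))
    fix a assume "a \<in> carrier ?B"
    show "F_class (\<theta> (csmult ?B z a)) = csmult (F_infty A) z (F_class (\<theta> a))" for z
      unfolding F_infty_sel(5)[OF \<theta>_bounded]
      by (intro F_class_cong \<theta>_bounded bounded_seq_closed(4))
        (auto simp: C_alg_sel(6) \<theta>_eq sum_distrib_left mult.assoc intro!: sum.cong)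
    fix b assume "b \<in> carrier ?B"
    show "F_class (\<theta> (a \<oplus>\<^bsub>?B\<^esub> b)) = F_class (\<theta> a) \<oplus>\<^bsub>F_infty A\<^esub> F_class (\<theta> b)"
      unfolding F_infty_sel(4)[OF \<theta>_bounded \<theta>_bounded]
      by (intro F_class_cong \<theta>_bounded bounded_seq_closed(2))
        (auto simp: C_alg_sel(5) \<theta>_eq sum.distrib[symmetric] distrib_right intro!: sum.cong)
  qed
  have positive: "positive_matrix (F_infty A) n (\<lambda>i j. F_class (\<theta> (x i j)))"
    if pos: "positive_matrix ?B n x" for n x
  proof -
    obtain y where y: "\<And>i j. \<lbrakk>i < n; j < n\<rbrakk> \<Longrightarrow> y i j \<in> carrier ?B"
      "\<And>i j. \<lbrakk>i < n; j < n\<rbrakk> \<Longrightarrow> x i j = (\<Oplus>\<^bsub>?B\<^esub>k\<in>{..<n}. star ?B (y k i) \<otimes>\<^bsub>?B\<^esub> y k j)"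
      using pos unfolding positive_matrix_def by blast
    have x_eq: "x i j c = (\<Sum>k<n. cnj (y k i c) * y k j c)" if "i < n" "j < n" "c \<in> L" for i j c
    proof -
      have "x i j c = (\<Sum>k<n. (star ?B (y k i) \<otimes>\<^bsub>?B\<^esub> y k j) c)"
        unfolding y(2)[OF that(1,2)] using y(1) that
        by (intro C_alg_finsum) (auto intro!: C_alg_closed)
      then show ?thesis using that(3) by (simp add: C_alg_sel(2,7))
    qed
    have "F_class (\<theta> (x i j)) =
        (\<Oplus>\<^bsub>F_infty A\<^esub>k\<in>{..<n}. star (F_infty A) (F_class (\<sigma> (y k i))) \<otimes>\<^bsub>F_infty A\<^esub> F_class (\<sigma> (y k j)))"
      if ij: "i < n" "j < n" for i j
    proof -
      let ?s = "\<lambda>k m. star A (\<sigma> (y k i) m) \<otimes>\<^bsub>A\<^esub> \<sigma> (y k j) m"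
      have s: "bounded_seq (?s k)" for k by (intro bounded_seq_closed(1,5) \<sigma>_bounded)
      have "star (F_infty A) (F_class (\<sigma> (y k i))) \<otimes>\<^bsub>F_infty A\<^esub> F_class (\<sigma> (y k j)) = F_class (?s k)" for k
        using F_infty_sel(3)[OF bounded_seq_closed(5) \<sigma>_bounded] F_infty_sel(6)[OF \<sigma>_bounded] \<sigma>_bounded by simp
      moreover have "(\<Oplus>\<^bsub>F_infty A\<^esub>k\<in>{..<n}. F_class (?s k)) = F_class (\<theta> (x i j))"
      proof (rule F_infty_finsum)
        fix m z assume z: "z \<in> topspace X"
        have "\<theta> (x i j) m z = (\<Sum>c\<in>L. (\<Sum>k<n. cnj (y k i c) * y k j c) * of_real (p m c z))"
          unfolding \<theta>_eq[OF z] using x_eq[OF ij] by (intro sum.cong) auto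
        also have "\<dots> = (\<Sum>k<n. \<Sum>c\<in>L. cnj (y k i c) * y k j c * of_real (p m c z))"
          unfolding sum_distrib_right by (rule sum.swap)
        also have "\<dots> = (\<Sum>k<n. ?s k m z)"
          using z by (intro sum.cong) (simp_all add: C_alg_sel(2,7) \<sigma>_product)
        finally show "\<theta> (x i j) m z = (\<Sum>k<n. ?s k m z)" .
      qed (use s \<theta>_bounded in auto)
      ultimately show ?thesis by simp
    qed
    then show ?thesis unfolding positive_matrix_def
      using \<sigma>_bounded by (intro exI[of _ "\<lambda>k i. F_class (\<sigma> (y k i))"]) (auto simp: F_infty_sel(1))
  qed
  have norm: "anorm (F_infty A) (F_class (\<theta> h)) \<le> anorm ?B h" if h: "h \<in> carrier ?B" for h
    unfolding F_infty_sel(7)[OF \<theta>_bounded]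
  proof (intro anorm_A_infty_le \<theta>_bounded anorm_le Y.anorm_nonneg h)
    fix n x assume x: "x \<in> topspace X"
    have hB: "cmod (h c) \<le> anorm ?B h" if "c \<in> L" for c using Y.cmod_le_anorm[OF h, of c] that by simp
    have "cmod (\<theta> h n x) \<le> (\<Sum>c\<in>L. anorm ?B h * p n c x)"
      unfolding \<theta>_eq[OF x] using hB p(2)[OF _ x]
      by (intro sum_norm_le) (simp add: norm_mult mult_right_mono)
    also have "\<dots> \<le> anorm ?B h * 1"
      unfolding sum_distrib_left[symmetric] using sum[OF x] Y.anorm_nonneg[OF h] by (intro mult_left_mono)
    finally show "cmod (\<theta> h n x) \<le> anorm ?B h" by simp
  qed
  have orthogonal: "orthogonal_in (F_infty A) (F_class (\<theta> a)) (F_class (\<theta> b))"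
    if ab: "orthogonal_in ?B a b" for a b
  proof -
    have ab0: "a c * b c = 0" if "c \<in> L" for c
    proof -
      have "(a \<otimes>\<^bsub>?B\<^esub> b) c = \<zero>\<^bsub>?B\<^esub> c" using ab by (simp add: orthogonal_in_def)
      then show ?thesis using that by (simp add: C_alg_sel(2,4))
    qed
    then have ab0': "a c = 0 \<or> b c = 0" if "c \<in> L" for c using that by simp
    have zero: "F_class (\<lambda>n. s n \<otimes>\<^bsub>A\<^esub> t n) = \<zero>\<^bsub>F_infty A\<^esub>"
      if "bounded_seq s" "bounded_seq t" "\<And>n x. x \<in> topspace X \<Longrightarrow> s n x * t n x = 0" for s t
      unfolding F_infty_sel(2) using that
      by (intro F_class_cong bounded_seq_closed(1) bounded_seq_zero) (auto simp: C_alg_sel(2,4))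
    have prod0: "\<theta> a n x * \<theta> b n x = 0" if "x \<in> topspace X" for n x
      unfolding \<theta>_product[OF that] using ab0 by (intro sum.neutral) auto
    note st = F_infty_sel(6)[OF \<theta>_bounded] and m = F_infty_sel(3) and b = bounded_seq_closed(5)[OF \<theta>_bounded]
    show ?thesis
      unfolding orthogonal_in_def st m[OF \<theta>_bounded \<theta>_bounded] m[OF b \<theta>_bounded] m[OF \<theta>_bounded b]
      using prod0 by (intro conjI zero \<theta>_bounded b) (auto simp: C_alg_sel(7) mult.commute)
  qed
  show ?thesis
    unfolding cpc_order_zero_def completely_positive_def
    using linear positive norm orthogonal by (simp add: \<theta>_def)
qed

end

section \<open>The induced action on central sequences and the equivariant order zero maps\<close>

context free_compact_action
begin

sublocale C: compact_function_algebra X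
  by unfold_locales (rule compact)

abbreviation "\<beta> \<equiv> induced_action G X \<alpha>"

lemma induced_action_closed:
  assumes g: "g \<in> carrier G" and f: "f \<in> carrier (C_alg X)"
  shows "\<beta> g f \<in> carrier (C_alg X)"
  unfolding induced_action_def
  using f continuous_map_act[of "inv g" euclidean f] g by (intro restrict_mem_C_alg) (simp add: C_alg_sel(1))

lemma bounded_seq_induced_action:
  assumes g: "g \<in> carrier G" and s: "C.bounded_seq s"
  shows "C.bounded_seq (\<lambda>n. \<beta> g (s n))"
proof -
  obtain B where B: "\<And>n x. x \<in> topspace X \<Longrightarrow> cmod (s n x) \<le> B" using s by (auto simp: C.bounded_seq_def)
  have "s n \<in> carrier (C_alg X)" for n using s by (simp add: C.bounded_seq_def)
  then show ?thesis
    using induced_action_closed[OF g] B act_closed g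
    by (intro C.bounded_seqI_carrier[where B = B]) (auto simp: induced_action_def)
qed

lemma asymp_eq_induced_action:
  assumes g: "g \<in> carrier G" and st: "C.asymp_eq s t"
  shows "C.asymp_eq (\<lambda>n. \<beta> g (s n)) (\<lambda>n. \<beta> g (t n))"
  unfolding C.asymp_eq_def
proof (intro allI impI)
  fix \<epsilon> :: real assume "\<epsilon> > 0"
  then obtain N where "\<And>n x. n \<ge> N \<Longrightarrow> x \<in> topspace X \<Longrightarrow> cmod (s n x - t n x) \<le> \<epsilon>"
    using st unfolding C.asymp_eq_def by blast
  then show "\<exists>N. \<forall>n\<ge>N. \<forall>x\<in>topspace X. cmod (\<beta> g (s n) x - \<beta> g (t n) x) \<le> \<epsilon>"
    using act_closed g by (intro exI[of _ N]) (simp add: induced_action_def)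
qed

text \<open>An invertible map that respects \<open>asymp_eq\<close> sends a coset onto a full coset;
  preimages are found by applying \<open>\<beta> (inv g)\<close>.\<close>

lemma F_infty_action_F_class:
  assumes g: "g \<in> carrier G" and s: "C.bounded_seq s"
  shows "F_infty_action \<beta> g (C.F_class s) = C.F_class (\<lambda>n. \<beta> g (s n))"
proof -
  have "(\<lambda>s n. \<beta> g (s n)) ` C.seq_class s = C.seq_class (\<lambda>n. \<beta> g (s n))"
  proof (intro equalityI subsetI)
    fix t assume "t \<in> (\<lambda>s n. \<beta> g (s n)) ` C.seq_class s"
    then show "t \<in> C.seq_class (\<lambda>n. \<beta> g (s n))"
      using bounded_seq_induced_action[OF g] asymp_eq_induced_action[OF g] by (auto simp: C.seq_class_def)
  next
    have inv: "\<beta> h (\<beta> (inv h) f) = f" if "f \<in> carrier (C_alg X)" "h \<in> carrier G" for f h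
    proof (rule C_alg_ext[of _ X])
      show "\<beta> h (\<beta> (inv h) f) \<in> carrier (C_alg X)" using that induced_action_closed by simp
      show "\<beta> h (\<beta> (inv h) f) x = f x" if "x \<in> topspace X" for x
        using that \<open>h \<in> carrier G\<close> act_closed act_inv by (simp add: induced_action_def)
    qed (rule that)
    fix t assume "t \<in> C.seq_class (\<lambda>n. \<beta> g (s n))"
    then have t: "C.bounded_seq t" "C.asymp_eq (\<lambda>n. \<beta> g (s n)) t" by (auto simp: C.seq_class_def)
    have ig: "inv g \<in> carrier G" using g by simp
    have car: "s n \<in> carrier (C_alg X)" "t n \<in> carrier (C_alg X)" for n
      using s t(1) by (auto simp: C.bounded_seq_def)
    have "C.asymp_eq (\<lambda>n. \<beta> (inv g) (\<beta> g (s n))) (\<lambda>n. \<beta> (inv g) (t n))"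
      by (rule asymp_eq_induced_action[OF ig t(2)])
    then have "C.asymp_eq s (\<lambda>n. \<beta> (inv g) (t n))" using inv[OF car(1) ig] g by simp
    then have "(\<lambda>n. \<beta> (inv g) (t n)) \<in> C.seq_class s"
      using bounded_seq_induced_action[OF ig t(1)] by (simp add: C.seq_class_def)
    moreover have "t = (\<lambda>n. \<beta> g (\<beta> (inv g) (t n)))" using inv[OF car(2) g] by simp
    ultimately show "t \<in> (\<lambda>s n. \<beta> g (s n)) ` C.seq_class s"
      by (intro image_eqI[of t _ "\<lambda>n. \<beta> (inv g) (t n)"])
  qed
  then show ?thesis by (simp add: F_infty_action_def C.F_class_def)
qed

text \<open>Asymptotic equivariance is a condition on a subgroup of \<open>G\<close>, so generators suffice.\<close>

lemma asymp_equivariant_generate: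
  fixes p :: "nat \<Rightarrow> 'g set \<Rightarrow> 'x \<Rightarrow> real"
  assumes H: "subgroup H G" and S: "S \<subseteq> carrier G" "generate G S = carrier G"
    and p: "\<And>g \<epsilon>. \<lbrakk>g \<in> S; \<epsilon> > 0\<rbrakk> \<Longrightarrow>
      \<exists>N. \<forall>n\<ge>N. \<forall>c\<in>lcosets H. \<forall>x\<in>topspace X. \<bar>p n (g <# c) (\<alpha> g x) - p n c x\<bar> \<le> \<epsilon>"
    and g: "g \<in> carrier G" and \<epsilon>: "\<epsilon> > 0"
  shows "\<exists>N. \<forall>n\<ge>N. \<forall>c\<in>lcosets H. \<forall>x\<in>topspace X. \<bar>p n (g <# c) (\<alpha> g x) - p n c x\<bar> \<le> \<epsilon>"
proof -
  define P where "P g \<longleftrightarrow> (\<forall>\<epsilon>>0. \<exists>N. \<forall>n\<ge>N. \<forall>c\<in>lcosets H. \<forall>x\<in>topspace X.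
      \<bar>p n (g <# c) (\<alpha> g x) - p n c x\<bar> \<le> \<epsilon>)" for g
  have Hc: "H \<subseteq> carrier G" using H subgroup.subset by blast
  have cc: "c \<subseteq> carrier G" if "c \<in> lcosets H" for c using lcosets_eq_l_coset(1)[OF H that] by blast
  have closed: "g <# c \<in> lcosets H" if "g \<in> carrier G" "c \<in> lcosets H" for g c
    using bij_betwE[OF bij_betw_lcosets[OF H that(1)]] that(2) by blast
  have inv_coset: "g <# (inv g <# c) = c" if "g \<in> carrier G" "c \<in> lcosets H" for g c
    using lcos_m_assoc[OF cc[OF that(2)] that(1), of "inv g"] that lcos_mult_one[OF cc[OF that(2)]] by simp
  have P_inv: "P (inv g)" if g: "g \<in> carrier G" "P g" for g
    unfolding P_def
  proof (intro allI impI)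
    fix \<epsilon> :: real assume "\<epsilon> > 0"
    then obtain N where N: "\<And>n c x. \<lbrakk>n \<ge> N; c \<in> lcosets H; x \<in> topspace X\<rbrakk> \<Longrightarrow>
        \<bar>p n (g <# c) (\<alpha> g x) - p n c x\<bar> \<le> \<epsilon>" using g(2) unfolding P_def by blast
    have "\<bar>p n (inv g <# c) (\<alpha> (inv g) x) - p n c x\<bar> \<le> \<epsilon>"
      if "n \<ge> N" "c \<in> lcosets H" "x \<in> topspace X" for n c x
      using N[OF that(1) closed[of "inv g" c] act_closed[of "inv g" x]] that g(1)
      by (simp add: inv_coset act_inv abs_minus_commute)
    then show "\<exists>N. \<forall>n\<ge>N. \<forall>c\<in>lcosets H. \<forall>x\<in>topspace X.
        \<bar>p n (inv g <# c) (\<alpha> (inv g) x) - p n c x\<bar> \<le> \<epsilon>" by blast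
  qed
  have P_mult: "P (g \<otimes> h)" if g: "g \<in> carrier G" "P g" and h: "h \<in> carrier G" "P h" for g h
    unfolding P_def
  proof (intro allI impI)
    fix \<epsilon> :: real assume "\<epsilon> > 0"
    then have \<epsilon>: "\<epsilon> / 2 > 0" by simp
    obtain N where N: "\<And>n c x. \<lbrakk>n \<ge> N; c \<in> lcosets H; x \<in> topspace X\<rbrakk> \<Longrightarrow>
        \<bar>p n (g <# c) (\<alpha> g x) - p n c x\<bar> \<le> \<epsilon> / 2" using g(2) \<epsilon> unfolding P_def by blast
    obtain N' where N': "\<And>n c x. \<lbrakk>n \<ge> N'; c \<in> lcosets H; x \<in> topspace X\<rbrakk> \<Longrightarrow>
        \<bar>p n (h <# c) (\<alpha> h x) - p n c x\<bar> \<le> \<epsilon> / 2" using h(2) \<epsilon> unfolding P_def by blast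
    have "\<bar>p n ((g \<otimes> h) <# c) (\<alpha> (g \<otimes> h) x) - p n c x\<bar> \<le> \<epsilon>"
      if n: "n \<ge> max N N'" and c: "c \<in> lcosets H" and x: "x \<in> topspace X" for n c x
    proof -
      have eq: "(g \<otimes> h) <# c = g <# (h <# c)" using lcos_m_assoc[OF cc[OF c] g(1) h(1)] by simp
      have "\<bar>p n (g <# (h <# c)) (\<alpha> g (\<alpha> h x)) - p n (h <# c) (\<alpha> h x)\<bar> \<le> \<epsilon> / 2"
        using n by (intro N closed act_closed h(1) c x) simp
      moreover have "\<bar>p n (h <# c) (\<alpha> h x) - p n c x\<bar> \<le> \<epsilon> / 2" using n by (intro N' c x) simp
      ultimately show ?thesis unfolding act_mult[OF g(1) h(1) x] eq by linarith
    qed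
    then show "\<exists>N. \<forall>n\<ge>N. \<forall>c\<in>lcosets H. \<forall>x\<in>topspace X.
        \<bar>p n ((g \<otimes> h) <# c) (\<alpha> (g \<otimes> h) x) - p n c x\<bar> \<le> \<epsilon>" by blast
  qed
  have P_one: "P \<one>" unfolding P_def using act_one lcos_mult_one[OF cc] by simp
  have PS: "P g" if "g \<in> S" for g using p[OF that] unfolding P_def by blast
  have "P g" if "g \<in> generate G S" for g
    using that
  proof (induction rule: generate.induct)
    case one show ?case by (rule P_one)
  next
    case (incl h) then show ?case by (rule PS)
  next
    case (inv h) then show ?case using P_inv PS S(1) by blast
  next
    case (eng h1 h2)
    then show ?case using P_mult generate_in_carrier[OF S(1)] by blast
  qed
  then show ?thesis using g S(2) \<epsilon> unfolding P_def by blast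
qed

text \<open>Functions with error \<open>1 / (n + 1)\<close> on the finite generating set are
  assembled into sequences; in \<open>F_infty\<close> the errors vanish and equivariance becomes
  exact. The \<open>(d + 1) * m\<close> colours are numbered from 0, hence the dimension
  \<open>(d + 1) * m - 1\<close>.\<close>

lemma rokhlin_dim_sub_le_of_towers:
  assumes dim: "covering_dim_le X d" and towers: "has_towers {\<one>} m"
    and S: "finite S" "S \<subseteq> carrier G" "generate G S = carrier G"
    and H: "subgroup H G" "finite (lcosets H)"
  shows "(d + 1) * m \<ge> 1" "rokhlin_dim_sub_le G (C_alg X) \<beta> H ((d + 1) * m - 1)"
proof -
  define D where "D = (d + 1) * m"
  define L where "L = lcosets H"
  \<comment> \<open>With no functions at all, the empty sum would have to be at least 1.\<close>
  have "m \<noteq> 0"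
  proof
    assume "m = 0"
    moreover obtain \<phi> where "tower_family {\<one>} m {} 1 \<phi>" using towers unfolding has_towers_def by fastforce
    ultimately show False by (simp add: tower_family_def)
  qed
  then show D1: "(d + 1) * m \<ge> 1" by simp
  define Q where "Q n f \<longleftrightarrow> (\<forall>l<D. \<forall>c\<in>L. continuous_map X euclideanreal (f l c)) \<and>
    (\<forall>l<D. \<forall>c\<in>L. \<forall>x\<in>topspace X. 0 \<le> f l c x) \<and>
    (\<forall>l<D. \<forall>c\<in>L. \<forall>c'\<in>L. \<forall>x\<in>topspace X. c \<noteq> c' \<longrightarrow> f l c x * f l c' x = 0) \<and>
    (\<forall>x\<in>topspace X. (\<Sum>l<D. \<Sum>c\<in>L. f l c x) = 1) \<and>
    (\<forall>l<D. \<forall>c\<in>L. \<forall>x\<in>topspace X. \<forall>k\<in>S. \<bar>f l (k <# c) (\<alpha> k x) - f l c x\<bar> \<le> 1 / real (Suc n))" for n f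
  have "\<exists>f. Q n f" for n
    unfolding D_def L_def Q_def by (rule rokhlin_functions[OF dim towers S(1,2) H]) simp
  then obtain f where "\<And>n. Q n (f n)" by metis
  note f = this[unfolded Q_def]
  define p where "p l n c x = f n l c x" for l n c x
  have p_cont: "continuous_map X euclideanreal (p l n c)" if "l < D" "c \<in> L" for l n c
    unfolding p_def using f[of n] that by simp
  have p_nonneg: "0 \<le> p l n c x" if "l < D" "c \<in> L" "x \<in> topspace X" for l n c x
    unfolding p_def using f[of n] that by simp
  have p_orth: "p l n c x * p l n c' x = 0" if "l < D" "c \<in> L" "c' \<in> L" "c \<noteq> c'" "x \<in> topspace X" for l n c c' x
    unfolding p_def using f[of n] that by blast
  have p_sum: "(\<Sum>l<D. \<Sum>c\<in>L. p l n c x) = 1" if "x \<in> topspace X" for n x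
    unfolding p_def using f[of n] that by simp
  have p_equiv: "\<bar>p l n (k <# c) (\<alpha> k x) - p l n c x\<bar> \<le> 1 / real (Suc n)"
    if "l < D" "c \<in> L" "x \<in> topspace X" "k \<in> S" for l n c x k
    unfolding p_def using f[of n] that by blast
  have p_sum_le: "(\<Sum>c\<in>L. p l n c x) \<le> 1" if "l < D" "x \<in> topspace X" for l n x
  proof -
    have "(\<Sum>c\<in>L. p l n c x) \<le> (\<Sum>l<D. \<Sum>c\<in>L. p l n c x)"
      using that p_nonneg by (intro member_le_sum[where f = "\<lambda>l. \<Sum>c\<in>L. p l n c x"]) (auto intro!: sum_nonneg)
    then show ?thesis using p_sum[OF that(2)] by simp
  qed
  have equiv: "\<exists>N. \<forall>n\<ge>N. \<forall>c\<in>L. \<forall>x\<in>topspace X. \<bar>p l n (g <# c) (\<alpha> g x) - p l n c x\<bar> \<le> \<epsilon>"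
    if l: "l < D" and g: "g \<in> carrier G" and \<epsilon>: "\<epsilon> > 0" for l g \<epsilon>
    unfolding L_def
  proof (rule asymp_equivariant_generate[OF H(1) S(2,3) _ g \<epsilon>])
    fix k and \<epsilon> :: real assume k: "k \<in> S" and "\<epsilon> > 0"
    then obtain N where N: "1 / real (Suc N) < \<epsilon>" using nat_approx_posE by blast
    have "\<bar>p l n (k <# c) (\<alpha> k x) - p l n c x\<bar> \<le> \<epsilon>" if "n \<ge> N" "c \<in> L" "x \<in> topspace X" for n c x
    proof -
      have "1 / real (Suc n) \<le> 1 / real (Suc N)" using that(1) by (intro divide_left_mono) auto
      then show ?thesis using p_equiv[OF l that(2,3) k, of n] N by linarith
    qed
    then show "\<exists>N. \<forall>n\<ge>N. \<forall>c\<in>lcosets H. \<forall>x\<in>topspace X. \<bar>p l n (k <# c) (\<alpha> k x) - p l n c x\<bar> \<le> \<epsilon>"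
      unfolding L_def by blast
  qed
  have finL: "finite L" using H(2) by (simp add: L_def)
  have p1: "0 \<le> p l n c x \<and> p l n c x \<le> 1" if "l < D" "c \<in> L" "x \<in> topspace X" for l n c x
    using p_nonneg that p_sum_le[OF that(1,3), of n] member_le_sum[of c L "\<lambda>c. p l n c x"] finL by force
  have bounded: "C.bounded_seq (C.weighted_seq L (p l) h)" if "l < D" for l h
    by (rule C.bounded_weighted_seq) (use p_cont p1 that in auto)
  define \<phi> where "\<phi> l h = C.F_class (C.weighted_seq L (p l) h)" for l h
  have cpc: "cpc_order_zero (C_alg (coset_space G H)) (F_infty (C_alg X)) (\<phi> l)" if l: "l < D" for l
    unfolding \<phi>_def L_def[symmetric]
    by (rule C.cpc_order_zero_weighted_seq[OF finL]) (use p_cont p_nonneg p_orth p_sum_le l in auto)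
  have equivariant: "\<phi> l (G_shift G H g h) = F_infty_action \<beta> g (\<phi> l h)" if l: "l < D" and g: "g \<in> carrier G" for l g h
  proof -
    let ?s = "C.weighted_seq L (p l) (G_shift G H g h)"
    let ?t = "\<lambda>n. \<beta> g (C.weighted_seq L (p l) h n)"
    have gL: "bij_betw (\<lambda>c. g <# c) L L" unfolding L_def by (rule bij_betw_lcosets[OF H(1) g])
    have shift: "G_shift G H g h (g <# c) = h c" if c: "c \<in> L" for c
    proof -
      have cc: "c \<subseteq> carrier G" using lcosets_eq_l_coset(1)[OF H(1)] c unfolding L_def by blast
      have "inv g <# (g <# c) = c" using lcos_m_assoc[OF cc, of "inv g" g] g lcos_mult_one[OF cc] by simp
      then show ?thesis using bij_betwE[OF gL] c g by (auto simp: G_shift_def induced_action_def L_def)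
    qed
    have "C.asymp_eq ?s ?t"
      unfolding C.asymp_eq_def
    proof (intro allI impI)
      fix \<epsilon> :: real assume \<epsilon>: "\<epsilon> > 0"
      \<comment> \<open>The 1 keeps \<open>M\<close> positive even if \<open>h\<close>
        vanishes.\<close>
      define M where "M = (\<Sum>c\<in>L. cmod (h c)) + 1"
      have M: "M > 0" unfolding M_def by (intro add_nonneg_pos sum_nonneg) auto
      then obtain N where N: "\<And>n c x. \<lbrakk>n \<ge> N; c \<in> L; x \<in> topspace X\<rbrakk> \<Longrightarrow>
          \<bar>p l n (g <# c) (\<alpha> g x) - p l n c x\<bar> \<le> \<epsilon> / M"
        using equiv[OF l g, of "\<epsilon> / M"] \<epsilon> by auto
      have "cmod (?s n x - ?t n x) \<le> \<epsilon>" if n: "n \<ge> N" and x: "x \<in> topspace X" for n x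
      proof -
        \<comment> \<open>Writing \<open>x = g y\<close> and summing over \<open>g c\<close> instead
          of \<open>c\<close> brings both sums into the form compared by almost
          equivariance.\<close>
        define y where "y = \<alpha> (inv g) x"
        have y: "y \<in> topspace X" "\<alpha> g y = x" using act_closed act_inv(2) g x by (auto simp: y_def)
        have "?s n x = (\<Sum>c\<in>L. G_shift G H g h (g <# c) * of_real (p l n (g <# c) x))"
          unfolding C.weighted_seq_eq[OF x]
          using sum.reindex_bij_betw[OF gL, of "\<lambda>c. G_shift G H g h c * of_real (p l n c x)"] by simp
        also have "\<dots> = (\<Sum>c\<in>L. h c * of_real (p l n (g <# c) x))" using shift by (intro sum.cong) auto
        finally have "?s n x - ?t n x = (\<Sum>c\<in>L. h c * of_real (p l n (g <# c) (\<alpha> g y) - p l n c y))"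
          using x y C.weighted_seq_eq[OF y(1)]
          by (simp add: induced_action_def y_def[symmetric] sum_subtractf right_diff_distrib)
        also have "cmod \<dots> \<le> (\<Sum>c\<in>L. cmod (h c) * (\<epsilon> / M))"
          unfolding norm_mult norm_of_real using N[OF n _ y(1)] by (intro sum_norm_le) (auto simp only: norm_mult norm_of_real intro!: mult_left_mono norm_ge_zero)
        also have "\<dots> \<le> M * (\<epsilon> / M)"
          unfolding sum_distrib_right[symmetric] M_def using \<epsilon> M by (intro mult_right_mono) (auto simp: M_def)
        also have "\<dots> = \<epsilon>" using M by simp
        finally show ?thesis .
      qed
      then show "\<exists>N. \<forall>n\<ge>N. \<forall>x\<in>topspace X. cmod (?s n x - ?t n x) \<le> \<epsilon>" by blast
    qed
    then have "C.F_class ?s = C.F_class ?t"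
      by (intro C.F_class_eqI bounded[OF l] bounded_seq_induced_action[OF g])
    then show ?thesis unfolding \<phi>_def F_infty_action_F_class[OF g bounded[OF l]] .
  qed
  have unit: "(\<Oplus>\<^bsub>F_infty (C_alg X)\<^esub>l\<in>{..<D}. \<phi> l \<one>\<^bsub>C_alg (coset_space G H)\<^esub>) = \<one>\<^bsub>F_infty (C_alg X)\<^esub>"
    unfolding \<phi>_def C.F_infty_sel(8)
  proof (rule C.F_infty_finsum)
    show "C.bounded_seq (\<lambda>n. \<one>\<^bsub>C_alg X\<^esub>)" by (intro C.bounded_seq_closed(3) C_alg_closed)
    show "\<one>\<^bsub>C_alg X\<^esub> x = (\<Sum>l<D. C.weighted_seq L (p l) \<one>\<^bsub>C_alg (coset_space G H)\<^esub> n x)"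
      if x: "x \<in> topspace X" for n x
    proof -
      have "(\<Sum>l<D. C.weighted_seq L (p l) \<one>\<^bsub>C_alg (coset_space G H)\<^esub> n x) =
          complex_of_real (\<Sum>l<D. \<Sum>c\<in>L. p l n c x)"
        unfolding C.weighted_seq_eq[OF x] of_real_sum
        by (intro sum.cong refl) (simp add: C_alg_sel(3) L_def)
      then show ?thesis using p_sum[OF x] x by (simp add: C_alg_sel(3))
    qed
  qed (use bounded in auto)
  \<comment> \<open>This needs \<open>D \<ge> 1\<close>, since the subtraction is truncated.\<close>
  have "{..D - 1} = {..<D}" using D1 unfolding D_def by auto
  then show "rokhlin_dim_sub_le G (C_alg X) \<beta> H ((d + 1) * m - 1)"
    unfolding rokhlin_dim_sub_le_def D_def[symmetric]
    using cpc equivariant unit D1 by (intro exI[of _ \<phi>]) (auto simp: D_def)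
qed

end

section \<open>The bound on the Rokhlin dimension\<close>

lemma enat_power: "enat a ^ n = enat (a ^ n)"
  by (induction n) (simp_all add: one_enat_def)

theorem corollary7p5:
  fixes G :: "'g monoid" and M :: "'x metric" and \<alpha> :: "'g \<Rightarrow> 'x \<Rightarrow> 'x"
  assumes "finitely_generated_group G"
    and "infinite (carrier G)"
    and "nilpotent_group G"
    and "compact_space (mtopology_of M)"
    and "covering_dim (mtopology_of M) < \<infinity>"
    and "group_action G (mspace M) \<alpha>"
    and "\<forall>g\<in>carrier G. homeomorphic_map (mtopology_of M) (mtopology_of M) (\<alpha> g)"
    and "\<forall>x\<in>mspace M. stabilizer G \<alpha> x = {\<one>\<^bsub>G\<^esub>}"
  shows "rokhlin_dim G (C_alg (mtopology_of M)) (induced_action G (mtopology_of M) \<alpha>) < \<infinity> \<and>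
         rokhlin_dim G (C_alg (mtopology_of M)) (induced_action G (mtopology_of M) \<alpha>) + 1
           \<le> 3 ^ hirsch_length G * (covering_dim (mtopology_of M) + 1)"
proof -
  let ?X = "mtopology_of M"
  let ?dim = "rokhlin_dim G (C_alg ?X) (induced_action G ?X \<alpha>)"
  interpret action: group_action G "mspace M" \<alpha> by (rule assms(6))
  have "group G" using assms(1) by (simp add: finitely_generated_group_def)
  interpret free_compact_action G ?X \<alpha>
  proof (intro free_compact_action.intro free_compact_action_axioms.intro)
    show "Hausdorff_space ?X"
      unfolding mtopology_of_def by (rule Metric_space.Hausdorff_space_mtopology[OF Metric_space_mspace_mdist])
    show "continuous_map ?X ?X (\<alpha> g)" if "g \<in> carrier G" for g
      using assms(7) that homeomorphic_imp_continuous_map by blast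
    \<comment> \<open>The maps of the action are elements of the group of bijections of
      \<open>mspace M\<close>, whose unit is the restricted identity.\<close>
    show "\<alpha> \<one>\<^bsub>G\<^esub> x = x" if "x \<in> topspace ?X" for x
      using action.id_eq_one that by (metis restrict_apply' topspace_mtopology_of)
    show "\<alpha> (g \<otimes>\<^bsub>G\<^esub> h) x = \<alpha> g (\<alpha> h x)" if "g \<in> carrier G" "h \<in> carrier G" "x \<in> topspace ?X" for g h x
      using action.composition_rule that by simp
    show "g = \<one>\<^bsub>G\<^esub>" if "g \<in> carrier G" "x \<in> topspace ?X" "\<alpha> g x = x" for g x
      using assms(8) that by (auto simp: stabilizer_def)
  qed (use assms(4) \<open>group G\<close> in auto)
  obtain S where S: "finite S" "S \<subseteq> carrier G" "generate G S = carrier G"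
    using assms(1) by (auto simp: finitely_generated_group_def)
  let ?D = "{enat n | n. covering_dim_le ?X n}"
  \<comment> \<open>Finite dimension excludes the infimum of the empty set, so the infimum of
    \<open>?D\<close> is attained by some \<open>d\<close>.\<close>
  have "?D \<noteq> {}"
  proof
    assume "?D = {}"
    then have "covering_dim ?X = \<infinity>" unfolding covering_dim_def by (simp only: Inf_enat_def) simp
    then show False using assms(5) by simp
  qed
  then have "covering_dim ?X \<in> ?D"
    unfolding covering_dim_def Inf_enat_def by (metis (mono_tags, lifting) LeastI ex_in_conv)
  then obtain d where d: "covering_dim ?X = enat d" "covering_dim_le ?X d" by blast
  obtain n where n: "central_chain {\<one>\<^bsub>G\<^esub>} n"
    using nilpotent_central_chain[OF assms(1,3)] by blast
  have towers: "has_towers {\<one>\<^bsub>G\<^esub>} (3 ^ n)" by (rule central_chain_has_towers[OF n])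
  define m where "m = (d + 1) * 3 ^ n"
  \<comment> \<open>Needed to recover \<open>m\<close> from \<open>m - 1\<close> when 1 is added to
    the Rokhlin dimension.\<close>
  have m: "m \<ge> 1" by (simp add: m_def Suc_le_eq)
  have "?dim \<le> enat (m - 1)"
    unfolding rokhlin_dim_def
  proof (rule Sup_least, clarify)
    fix H assume "subgroup H G" "finite (lcosets\<^bsub>G\<^esub> H)"
    then have "rokhlin_dim_sub_le G (C_alg ?X) (induced_action G ?X \<alpha>) H (m - 1)"
      unfolding m_def by (rule rokhlin_dim_sub_le_of_towers(2)[OF d(2) towers S])
    then show "rokhlin_dim_sub G (C_alg ?X) (induced_action G ?X \<alpha>) H \<le> enat (m - 1)"
      unfolding rokhlin_dim_sub_def by (intro Inf_lower) blast
  qed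
  then have fin: "?dim < \<infinity>" by (rule le_less_trans) simp
  have "?dim + 1 \<le> enat (m - 1) + 1" using \<open>?dim \<le> enat (m - 1)\<close> by (rule add_right_mono)
  also have "enat (m - 1) + 1 = enat m" using m by (simp add: one_enat_def)
  also have "\<dots> \<le> enat (3 ^ hirsch_length G * (d + 1))"
    unfolding m_def enat_ord_simps mult.commute[of "d + 1"]
    by (intro mult_right_mono power_increasing central_chain_le_hirsch_length[OF n]) simp_all
  also have "\<dots> = 3 ^ hirsch_length G * (covering_dim ?X + 1)"
    unfolding d(1) numeral_eq_enat one_enat_def enat_power plus_enat_simps times_enat_simps ..
  finally show ?thesis using fin by blast
qed

end
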